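(* Let $n\ge 1$, $\mathbb{F}=\mathbb{R}$ or $\mathbb{C}$, and let $\widetilde{\mathrm{H}}_{2n+1}(\mathbb{F})=\mathrm{H}_{2n+1}(\mathbb{F})/A$ be the reduced generalized Heisenberg group of dimension $2n+1$, where $A=\mathbb{Z}$ in the real case and $A=\mathbb{Z}^2$ in the complex case. Then the map of ordered commutators on connected components $$\pi_0(\mathrm{Hom}(\mathbb{Z}^k,\widetilde{\mathrm{H}}_{2n+1}(\mathbb{F})))\to H^2(\mathbb{Z}^k;A)$$ is injective for every $k\ge2$, and surjective if and only if $\lfloor k/2\rfloor\le n$. Moreover, each component parametrized by a form $\beta\in H^2(\mathbb{Z}^k;A)$ (i.e. mapping to $\beta$) is homotopy equivalent to $$V_r(D(\mathbb{F})^n)\times(S^1)^{k\dim_{\mathbb{R}}\mathbb{F}},$$ where $2r=\mathrm{rank}(\beta^{\mathrm{ad}})$.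
   Context: $\mathrm{H}_{2n+1}(\mathbb{F})$ is the group of $(n+2)\times(n+2)$ upper unitriangular matrices of block form $\begin{pmatrix}1&a&z\\0&I_n&b\\0&0&1\end{pmatrix}$ with $a\in\mathrm{Mat}_{1\times n}(\mathbb{F})$, $b\in\mathrm{Mat}_{n\times1}(\mathbb{F})$, $z\in\mathbb{F}$. $A$ is the central subgroup $a=0,b=0$, $z\in\mathbb{Z}$ (if $\mathbb{F}=\mathbb{R}$) or $z\in\mathbb{Z}[i]\cong\mathbb{Z}^2$ (if $\mathbb{F}=\mathbb{C}$); we also regard $A\subset\mathbb{F}$. The quotient $\widetilde{\mathrm{H}}_{2n+1}(\mathbb{F})$ has universal cover $\mathrm{H}_{2n+1}(\mathbb{F})$. $\mathrm{Hom}(\mathbb{Z}^k,G)$ is the space of homomorphisms, topologized as the subspace of commuting tuples in $G^k$. $H^2(\mathbb{Z}^k;A)\cong\mathrm{Ant}_k(A)$, the group of antisymmetric $k\times k$ matrices with entries in $A$. The map of ordered commutators sends $\rho$ to the matrix $([\tilde g_i,\tilde g_j])_{i,j}$, where $\tilde g_i\in \mathrm{H}_{2n+1}(\mathbb{F})$ is any lift of $\rho(e_i)$, $e_1,\dots,e_k$ is the canonical basis, and $[x,y]=x^{-1}y^{-1}xy$; it is locally constant in $\rho$. A class $\beta$ is regarded as a skew-symmetric bilinear form on $\mathbb{F}^k$ with adjoint $\beta^{\mathrm{ad}}\colon\mathbb{F}^k\to(\mathbb{F}^k)^*$, and rank is over $\mathbb{F}$. $D(\mathbb{R}):=\mathbb{C}$,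 $D(\mathbb{C}):=\mathbb{H}$ (quaternions), and $V_r(D(\mathbb{F})^n)$ is the Stiefel manifold of orthonormal $r$-frames in $D(\mathbb{F})^n$. *)

theory Defs
  imports
    "HOL-Analysis.Analysis"
    "HOL-Algebra.Coset"
    "HOL-Library.Function_Algebras"
begin

section \<open>Generalized Heisenberg groups\<close>

text \<open>Row and column indices of a matrix of size \<open>n + 2\<close> in block form \<open>1 + n + 1\<close>, where
  \<open>n = CARD('n)\<close>.\<close>

datatype 'n block = First | Mid 'n | Last

lemma UNIV_block: "(UNIV :: 'n block set) = {First, Last} \<union> range Mid"
proof -
  have "x \<in> {First, Last} \<union> range Mid" for x :: "'n block"
    by (cases x) auto
  then show ?thesis by blast
qed

instance block :: (finite) finite
  by standard (simp add: UNIV_block)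

lemma CARD_block: "CARD('n::finite block) = CARD('n) + 2"
proof -
  have "card (range (Mid :: 'n \<Rightarrow> _)) = CARD('n)"
    by (rule card_image) (auto simp: inj_on_def)
  moreover have "First \<notin> range (Mid :: 'n \<Rightarrow> _)" "Last \<notin> range (Mid :: 'n \<Rightarrow> _)"
    by auto
  ultimately show ?thesis
    by (simp add: UNIV_block card_insert_if)
qed

lemma sum_block:
  "(\<Sum>p\<in>UNIV. f p) = f First + (\<Sum>i\<in>UNIV. f (Mid i)) + f Last"
  for f :: "'n::finite block \<Rightarrow> 'a::comm_monoid_add"
proof -
  have "(\<Sum>p\<in>UNIV. f p) = (\<Sum>p\<in>insert First (insert Last (range Mid)). f p)"
    by (simp add: UNIV_block)
  also have "\<dots> = f First + (f Last + (\<Sum>p\<in>range Mid. f p))"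
    by (subst sum.insert; (subst sum.insert)?) auto
  also have "(\<Sum>p\<in>range Mid. f p) = (\<Sum>i\<in>UNIV. f (Mid i))"
    by (subst sum.reindex) (auto simp: inj_on_def)
  finally show ?thesis by (simp add: ac_simps)
qed

type_synonym ('f, 'n) block_matrix = "'f ^ 'n block ^ 'n block"

fun heis_entry :: "'f::zero_neq_one ^ 'n \<Rightarrow> 'f ^ 'n \<Rightarrow> 'f \<Rightarrow> 'n block \<Rightarrow> 'n block \<Rightarrow> 'f" where
  "heis_entry a b z First First = 1"
| "heis_entry a b z First (Mid j) = a $ j"
| "heis_entry a b z First Last = z"
| "heis_entry a b z (Mid i) First = 0"
| "heis_entry a b z (Mid i) (Mid j) = (if i = j then 1 else 0)"
| "heis_entry a b z (Mid i) Last = b $ i"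
| "heis_entry a b z Last First = 0"
| "heis_entry a b z Last (Mid j) = 0"
| "heis_entry a b z Last Last = 1"

definition heis_matrix ::
    "'f::zero_neq_one ^ 'n::finite \<Rightarrow> 'f ^ 'n \<Rightarrow> 'f \<Rightarrow> ('f, 'n) block_matrix" where
  "heis_matrix a b z = (\<chi> p q. heis_entry a b z p q)"

definition heisenberg :: "('f::field, 'n::finite) block_matrix monoid" where
  "heisenberg = \<lparr>carrier = {heis_matrix a b z | a b z. True}, mult = (**), one = mat 1\<rparr>"

text \<open>The central subgroup given by a subgroup \<open>A\<close> of the additive group of the field.\<close>

definition heis_central :: "'f::field set \<Rightarrow> ('f, 'n::finite) block_matrix set" where
  "heis_central A = {heis_matrix 0 0 z | z. z \<in> A}"

definition reduced_heisenberg :: "'f::field set \<Rightarrow> ('f, 'n::finite) block_matrix set monoid" where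
  "reduced_heisenberg A = heisenberg Mod heis_central A"

definition gaussian_integers :: "complex set" where
  "gaussian_integers = {z. Re z \<in> \<int> \<and> Im z \<in> \<int>}"

lemma heis_matrix_mult:
  "heis_matrix a b z ** heis_matrix a' b' z' =
    heis_matrix (a + a') (b + b') (z + z' + (\<Sum>i\<in>UNIV. a $ i * b' $ i))"
  for a :: "'f::field ^ 'n::finite"
proof -
  have delta: "(\<Sum>k\<in>UNIV. (if i = k then 1 else 0) * f k) = (f i :: 'f)"
    "(\<Sum>k\<in>UNIV. f k * (if k = i then 1 else 0)) = (f i :: 'f)" for i :: 'n and f
    by (simp_all add: if_distrib[of "\<lambda>x. x * _"] if_distrib[of "\<lambda>x. _ * x"] cong: if_cong)
  have "(heis_matrix a b z ** heis_matrix a' b' z') $ p $ q =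
      heis_matrix (a + a') (b + b') (z + z' + (\<Sum>i\<in>UNIV. a $ i * b' $ i)) $ p $ q" for p q
    by (cases p; cases q) (simp_all add: matrix_matrix_mult_def heis_matrix_def sum_block delta)
  then show ?thesis by (simp add: vec_eq_iff)
qed

lemma heis_matrix_one: "heis_matrix 0 0 0 = (mat 1 :: ('f::field, 'n::finite) block_matrix)"
proof -
  have "heis_matrix 0 0 0 $ p $ q = (mat 1 :: ('f, 'n) block_matrix) $ p $ q" for p q
    by (cases p; cases q) (simp_all add: heis_matrix_def mat_def)
  then show ?thesis by (simp add: vec_eq_iff)
qed

lemma heis_matrix_eq_iff: "heis_matrix a b z = heis_matrix a' b' z' \<longleftrightarrow> a = a' \<and> b = b' \<and> z = z'"
proof
  assume eq: "heis_matrix a b z = heis_matrix a' b' z'"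
  have "heis_matrix a b z $ p $ q = heis_matrix a' b' z' $ p $ q" for p q
    by (simp add: eq)
  from this[of First Last] this[of First "Mid _"] this[of "Mid _" Last]
  show "a = a' \<and> b = b' \<and> z = z'"
    by (simp add: heis_matrix_def vec_eq_iff)
qed simp

lemma group_heisenberg: "group (heisenberg :: ('f::field, 'n::finite) block_matrix monoid)"
proof (rule groupI)
  fix x :: "('f, 'n) block_matrix"
  assume "x \<in> carrier heisenberg"
  then obtain a b z where x: "x = heis_matrix a b z" by (auto simp: heisenberg_def)
  have "heis_matrix (- a) (- b) (- z + (\<Sum>i\<in>UNIV. a $ i * b $ i)) ** x = mat 1"
    by (simp add: x heis_matrix_mult sum_negf flip: heis_matrix_one)
  then show "\<exists>y\<in>carrier heisenberg. y \<otimes>\<^bsub>heisenberg\<^esub> x = \<one>\<^bsub>heisenberg\<^esub>"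
    unfolding heisenberg_def by auto
next
  show "\<one>\<^bsub>heisenberg\<^esub> \<in> carrier (heisenberg :: ('f, 'n) block_matrix monoid)"
    by (auto simp: heisenberg_def simp flip: heis_matrix_one)
next
  fix x y :: "('f, 'n) block_matrix"
  assume "x \<in> carrier heisenberg" "y \<in> carrier heisenberg"
  then show "x \<otimes>\<^bsub>heisenberg\<^esub> y \<in> carrier heisenberg"
    by (simp add: heisenberg_def) (metis heis_matrix_mult)
qed (auto simp: heisenberg_def matrix_mul_assoc)

lemma heis_inv:
  "inv\<^bsub>heisenberg\<^esub> (heis_matrix a b z) =
    heis_matrix (- a) (- b) (- z + (\<Sum>i\<in>UNIV. a $ i * b $ i))"
  by (rule group.inv_equality[OF group_heisenberg])
    (auto simp: heisenberg_def heis_matrix_mult sum_negf simp flip: heis_matrix_one)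

lemma normal_heis_central:
  assumes "0 \<in> A" "\<And>x y. x \<in> A \<Longrightarrow> y \<in> A \<Longrightarrow> x + y \<in> A" "\<And>x. x \<in> A \<Longrightarrow> - x \<in> A"
  shows "heis_central A \<lhd> (heisenberg :: ('f::field, 'n::finite) block_matrix monoid)"
proof (rule group.normalI[OF group_heisenberg])
  show "subgroup (heis_central A) (heisenberg :: ('f, 'n) block_matrix monoid)"
  proof (rule group.subgroupI[OF group_heisenberg])
    show "heis_central A \<noteq> ({} :: ('f, 'n) block_matrix set)"
      using assms(1) by (auto simp: heis_central_def)
    show "heis_central A \<subseteq> carrier (heisenberg :: ('f, 'n) block_matrix monoid)"
      by (auto simp: heis_central_def heisenberg_def)
  next
    fix x :: "('f, 'n) block_matrix" assume "x \<in> heis_central A"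
    then show "inv\<^bsub>heisenberg\<^esub> x \<in> heis_central A"
      using assms(3) by (auto simp: heis_central_def heis_inv heis_matrix_eq_iff)
  next
    fix x y :: "('f, 'n) block_matrix" assume "x \<in> heis_central A" "y \<in> heis_central A"
    then show "x \<otimes>\<^bsub>heisenberg\<^esub> y \<in> heis_central A"
      using assms(2) by (auto simp: heis_central_def heisenberg_def heis_matrix_mult heis_matrix_eq_iff)
  qed
  show "\<forall>x\<in>carrier (heisenberg :: ('f, 'n) block_matrix monoid).
      heis_central A #>\<^bsub>heisenberg\<^esub> x = x <#\<^bsub>heisenberg\<^esub> heis_central A"
    by (auto simp: r_coset_def l_coset_def heisenberg_def heis_central_def heis_matrix_mult
        heis_matrix_eq_iff add.commute)
qed

section \<open>Topology on quotient groups and on spaces of homomorphisms\<close>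

definition quotient_group_topology ::
    "('a, 'm) monoid_scheme \<Rightarrow> 'a topology \<Rightarrow> 'a set \<Rightarrow> 'a set topology" where
  "quotient_group_topology G T N =
    topology (\<lambda>U. U \<subseteq> rcosets\<^bsub>G\<^esub> N \<and> openin T {x \<in> topspace T. N #>\<^bsub>G\<^esub> x \<in> U})"

lemma openin_quotient_group_topology:
  "openin (quotient_group_topology G T N) U \<longleftrightarrow>
    U \<subseteq> rcosets\<^bsub>G\<^esub> N \<and> openin T {x \<in> topspace T. N #>\<^bsub>G\<^esub> x \<in> U}"
proof -
  have "istopology (\<lambda>U. U \<subseteq> rcosets\<^bsub>G\<^esub> N \<and> openin T {x \<in> topspace T. N #>\<^bsub>G\<^esub> x \<in> U})"
  proof (unfold istopology_def, intro conjI allI impI)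
    fix S U
    assume "S \<subseteq> rcosets\<^bsub>G\<^esub> N \<and> openin T {x \<in> topspace T. N #>\<^bsub>G\<^esub> x \<in> S}"
      and "U \<subseteq> rcosets\<^bsub>G\<^esub> N \<and> openin T {x \<in> topspace T. N #>\<^bsub>G\<^esub> x \<in> U}"
    moreover have "{x \<in> topspace T. N #>\<^bsub>G\<^esub> x \<in> S \<inter> U} =
        {x \<in> topspace T. N #>\<^bsub>G\<^esub> x \<in> S} \<inter> {x \<in> topspace T. N #>\<^bsub>G\<^esub> x \<in> U}"
      by auto
    ultimately show "openin T {x \<in> topspace T. N #>\<^bsub>G\<^esub> x \<in> S \<inter> U}" "S \<inter> U \<subseteq> rcosets\<^bsub>G\<^esub> N"
      by auto
  next
    fix K
    assume K: "\<forall>U\<in>K. U \<subseteq> rcosets\<^bsub>G\<^esub> N \<and> openin T {x \<in> topspace T. N #>\<^bsub>G\<^esub> x \<in> U}"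
    have "{x \<in> topspace T. N #>\<^bsub>G\<^esub> x \<in> \<Union>K} =
        (\<Union>U\<in>K. {x \<in> topspace T. N #>\<^bsub>G\<^esub> x \<in> U})"
      by auto
    with K show "openin T {x \<in> topspace T. N #>\<^bsub>G\<^esub> x \<in> \<Union>K}" "\<Union>K \<subseteq> rcosets\<^bsub>G\<^esub> N"
      by auto
  qed
  then show ?thesis
    by (simp add: quotient_group_topology_def topology_inverse')
qed

lemma quotient_map_quotient_group_topology:
  assumes "topspace T = carrier G"
  shows "quotient_map T (quotient_group_topology G T N) (r_coset G N)"
proof -
  have "{x \<in> topspace T. N #>\<^bsub>G\<^esub> x \<in> rcosets\<^bsub>G\<^esub> N} = topspace T"
    using assms by (auto simp: RCOSETS_def)
  then have "openin (quotient_group_topology G T N) (rcosets\<^bsub>G\<^esub> N)"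
    by (simp add: openin_quotient_group_topology)
  then have "topspace (quotient_group_topology G T N) = rcosets\<^bsub>G\<^esub> N"
    unfolding topspace_def using openin_quotient_group_topology[of G T N] by auto
  then show ?thesis
    unfolding quotient_map_def openin_quotient_group_topology
    using assms by (auto simp: RCOSETS_def)
qed

definition reduced_heisenberg_topology ::
    "'f::{field, topological_space} set \<Rightarrow> ('f, 'n::finite) block_matrix set topology" where
  "reduced_heisenberg_topology A =
    quotient_group_topology heisenberg (top_of_set (carrier heisenberg)) (heis_central A)"

definition Zk :: "(int ^ 'k) monoid" where
  "Zk = \<lparr>carrier = UNIV, mult = (+), one = 0\<rparr>"

text \<open>Pulling back along evaluation at the canonical basis makes the space of homomorphisms
  a subspace of the \<open>k\<close>-fold power of the target.\<close>

definition Hom_Zk ::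
    "('g, 'm) monoid_scheme \<Rightarrow> 'g topology \<Rightarrow> (int ^ 'k::finite \<Rightarrow> 'g) topology" where
  "Hom_Zk G T =
    pullback_topology (hom Zk G) (\<lambda>\<rho> i. \<rho> (axis i 1)) (product_topology (\<lambda>i. T) UNIV)"

definition Hom_heisenberg ::
    "'f::{field, topological_space} set
      \<Rightarrow> (int ^ 'k::finite \<Rightarrow> ('f, 'n::finite) block_matrix set) topology" where
  "Hom_heisenberg A = Hom_Zk (reduced_heisenberg A) (reduced_heisenberg_topology A)"

definition pi0 :: "'a topology \<Rightarrow> 'a set set" where
  "pi0 X = path_components_of X"

section \<open>The map of ordered commutators\<close>

definition commutator :: "('a, 'm) monoid_scheme \<Rightarrow> 'a \<Rightarrow> 'a \<Rightarrow> 'a" where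
  "commutator G x y = inv\<^bsub>G\<^esub> x \<otimes>\<^bsub>G\<^esub> inv\<^bsub>G\<^esub> y \<otimes>\<^bsub>G\<^esub> x \<otimes>\<^bsub>G\<^esub> y"

text \<open>Elements of the reduced group are cosets, so a lift is an element of the coset. The corner
  entry identifies the central subgroup \<open>heis_central A\<close> with \<open>A\<close>.\<close>

definition ordered_commutators ::
    "(int ^ 'k::finite \<Rightarrow> ('f::field, 'n::finite) block_matrix set) \<Rightarrow> 'f ^ 'k ^ 'k" where
  "ordered_commutators \<rho> =
    (let lift = (\<lambda>i. SOME g. g \<in> \<rho> (axis i 1))
     in (\<chi> i j. commutator heisenberg (lift i) (lift j) $ First $ Last))"

definition pi0_commutators ::
    "(int ^ 'k::finite \<Rightarrow> ('f::field, 'n::finite) block_matrix set) set \<Rightarrow> 'f ^ 'k ^ 'k" where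
  "pi0_commutators C = the_elem (ordered_commutators ` C)"

text \<open>\<open>Ant A\<close> is the group \<open>Ant\<^sub>k(A)\<close>, which stands for the second cohomology of
  \<open>\<int>\<^sup>k\<close> with coefficients in \<open>A\<close>.\<close>

definition Ant :: "'f::ab_group_add set \<Rightarrow> ('f ^ 'k ^ 'k) set" where
  "Ant A = {\<beta>. transpose \<beta> = - \<beta> \<and> (\<forall>i j. \<beta> $ i $ j \<in> A)}"

lemma commutator_heis_matrix:
  "commutator heisenberg (heis_matrix a b z) (heis_matrix a' b' z') =
    heis_matrix 0 0 (\<Sum>i\<in>UNIV. a $ i * b' $ i - a' $ i * b $ i)"
  unfolding commutator_def heis_inv
  by (simp add: heisenberg_def heis_matrix_mult heis_matrix_eq_iff sum_negf sum.distrib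
      sum_subtractf algebra_simps)

lemma commutator_lift_independent:
  assumes "q \<in> carrier (reduced_heisenberg A)" "q' \<in> carrier (reduced_heisenberg A)"
    and "g \<in> q" "h \<in> q" "g' \<in> q'" "h' \<in> q'"
  shows "commutator heisenberg g g' = commutator heisenberg h h'"
proof -
  have *: "\<exists>a b z w. x = heis_matrix a b z \<and> y = heis_matrix a b w"
    if "r \<in> carrier (reduced_heisenberg A)" "x \<in> r" "y \<in> r"
    for r and x y :: "('a, 'b) block_matrix"
  proof -
    from that(1) obtain a b z where
      "r = heis_central A #>\<^bsub>heisenberg\<^esub> heis_matrix a b z"
      unfolding reduced_heisenberg_def carrier_FactGroup by (auto simp: heisenberg_def)
    with that(2,3) show ?thesis
      by (auto simp: r_coset_def heis_central_def heisenberg_def heis_matrix_mult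
          heis_matrix_eq_iff)
  qed
  from *[OF assms(1,3,4)] *[OF assms(2,5,6)] show ?thesis
    by (auto simp: commutator_heis_matrix)
qed

section \<open>The rank of the adjoint of a form\<close>

definition bilinear_form :: "'f::field ^ 'k ^ 'k::finite \<Rightarrow> 'f ^ 'k \<Rightarrow> 'f ^ 'k \<Rightarrow> 'f" where
  "bilinear_form \<beta> x y = (\<Sum>i\<in>UNIV. \<Sum>j\<in>UNIV. x $ i * \<beta> $ i $ j * y $ j)"

text \<open>The adjoint \<open>x \<mapsto> \<beta>(x, _)\<close> is the curried form, with values in the dual space as a
  subspace of the space of all functions with pointwise operations; its rank is the dimension of
  its range.\<close>

definition rank_adjoint :: "'f::field ^ 'k ^ 'k::finite \<Rightarrow> nat" where
  "rank_adjoint \<beta> =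
    vector_space.dim (\<lambda>c (\<phi> :: 'f ^ 'k \<Rightarrow> 'f) y. c * \<phi> y) (range (\<lambda>x. bilinear_form \<beta> x))"

lemma vector_space_pointwise: "vector_space (\<lambda>c (\<phi> :: 'a \<Rightarrow> 'f::field) y. c * \<phi> y)"
  by unfold_locales (simp_all add: fun_eq_iff algebra_simps)

section \<open>Quaternions\<close>

codatatype quat = Quat (qRe: real) (qI: real) (qJ: real) (qK: real)

lemma quat_eq_iff: "x = y \<longleftrightarrow> qRe x = qRe y \<and> qI x = qI y \<and> qJ x = qJ y \<and> qK x = qK y"
  by (cases x; cases y) auto

instantiation quat :: ring_1
begin

primcorec zero_quat where
  "qRe 0 = 0" | "qI 0 = 0" | "qJ 0 = 0" | "qK 0 = 0"

primcorec one_quat where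
  "qRe 1 = 1" | "qI 1 = 0" | "qJ 1 = 0" | "qK 1 = 0"

primcorec plus_quat where
  "qRe (x + y) = qRe x + qRe y"
| "qI (x + y) = qI x + qI y"
| "qJ (x + y) = qJ x + qJ y"
| "qK (x + y) = qK x + qK y"

primcorec uminus_quat where
  "qRe (- x) = - qRe x"
| "qI (- x) = - qI x"
| "qJ (- x) = - qJ x"
| "qK (- x) = - qK x"

primcorec minus_quat where
  "qRe (x - y) = qRe x - qRe y"
| "qI (x - y) = qI x - qI y"
| "qJ (x - y) = qJ x - qJ y"
| "qK (x - y) = qK x - qK y"

primcorec times_quat where
  "qRe (x * y) = qRe x * qRe y - qI x * qI y - qJ x * qJ y - qK x * qK y"
| "qI (x * y) = qRe x * qI y + qI x * qRe y + qJ x * qK y - qK x * qJ y"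
| "qJ (x * y) = qRe x * qJ y - qI x * qK y + qJ x * qRe y + qK x * qI y"
| "qK (x * y) = qRe x * qK y + qI x * qJ y - qJ x * qI y + qK x * qRe y"

instance
  by standard (simp_all add: quat_eq_iff algebra_simps)

end

lemma quat_relations:
  "Quat 0 1 0 0 * Quat 0 1 0 0 = - 1"
  "Quat 0 0 1 0 * Quat 0 0 1 0 = - 1"
  "Quat 0 0 0 1 * Quat 0 0 0 1 = - 1"
  "Quat 0 1 0 0 * Quat 0 0 1 0 = Quat 0 0 0 1"
  by (simp_all add: quat_eq_iff)

instantiation quat :: real_vector
begin

primcorec scaleR_quat where
  "qRe (scaleR r x) = r * qRe x"
| "qI (scaleR r x) = r * qI x"
| "qJ (scaleR r x) = r * qJ x"
| "qK (scaleR r x) = r * qK x"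

instance
  by standard (simp_all add: quat_eq_iff algebra_simps)

end

instantiation quat :: real_inner
begin

definition inner_quat :: "quat \<Rightarrow> quat \<Rightarrow> real" where
  "inner_quat x y = qRe x * qRe y + qI x * qI y + qJ x * qJ y + qK x * qK y"

definition norm_quat :: "quat \<Rightarrow> real" where
  "norm_quat x = sqrt (inner x x)"

definition sgn_quat :: "quat \<Rightarrow> quat" where
  "sgn_quat x = x /\<^sub>R norm x"

definition dist_quat :: "quat \<Rightarrow> quat \<Rightarrow> real" where
  "dist_quat x y = norm (x - y)"

definition uniformity_quat :: "(quat \<times> quat) filter" where
  "uniformity_quat = (INF e\<in>{0 <..}. principal {(x, y). dist x y < e})"

definition open_quat :: "quat set \<Rightarrow> bool" where
  "open_quat U \<longleftrightarrow> (\<forall>x\<in>U. eventually (\<lambda>(x', y). x' = x \<longrightarrow> y \<in> U) uniformity)"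

instance
proof
  fix x :: quat
  have "inner x x = (qRe x)\<^sup>2 + (qI x)\<^sup>2 + (qJ x)\<^sup>2 + (qK x)\<^sup>2"
    by (simp add: inner_quat_def power2_eq_square)
  then show "0 \<le> inner x x" "inner x x = 0 \<longleftrightarrow> x = 0"
    by (simp_all add: quat_eq_iff add_nonneg_eq_0_iff)
qed (simp_all add: quat_eq_iff inner_quat_def norm_quat_def sgn_quat_def dist_quat_def
    uniformity_quat_def open_quat_def algebra_simps)

end

primcorec qcnj :: "quat \<Rightarrow> quat" where
  "qRe (qcnj x) = qRe x" | "qI (qcnj x) = - qI x" | "qJ (qcnj x) = - qJ x" | "qK (qcnj x) = - qK x"

section \<open>Stiefel manifolds and tori\<close>

definition hermitian :: "('d \<Rightarrow> 'd) \<Rightarrow> 'd::ring_1 ^ 'n::finite \<Rightarrow> 'd ^ 'n \<Rightarrow> 'd" where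
  "hermitian cj v w = (\<Sum>a\<in>UNIV. v $ a * cj (w $ a))"

definition stiefel ::
    "('d \<Rightarrow> 'd) \<Rightarrow> nat \<Rightarrow> (nat \<Rightarrow> 'd::{ring_1, topological_space} ^ 'n::finite) topology" where
  "stiefel cj r =
    subtopology (product_topology (\<lambda>i. euclidean) {..<r})
      {v. \<forall>i<r. \<forall>j<r. hermitian cj (v i) (v j) = (if i = j then 1 else 0)}"

definition torus :: "nat \<Rightarrow> (nat \<Rightarrow> complex) topology" where
  "torus m = product_topology (\<lambda>i. top_of_set (sphere 0 1)) {..<m}"

end

(* Write H = V x F with V = F^2n and symplectic form omega, so that commutators are the values of
   omega.  A homomorphism from Z^k is a tuple of vectors v_i in V with omega(v_i, v_j) in the lattice,
   together with a point of a torus, and the matrix of these values is locally constant because the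
   lattice is countable.  The fibre over a form beta consists of the maps F^k -> V pulling omega back
   to beta, times the torus.  A maximal hyperbolic system (p_i, q_i) of beta splits off the radical,
   which can be scaled to zero, so that the fibre is homotopy equivalent to the space of symplectic
   r-frames (e, f) of V.

   Frames are connected because transvections act transitively and each of them is joined to the
   identity by scaling.  A frame is deformed by moving e linearly to its Gram-Schmidt
   orthonormalization u while carrying f along as a dual family, and then moving f linearly to J u;
   at each time the family dual to e is made isotropic by adding the vectors
   1/2 sum_i omega(f_i, f_j) e_i.  An orthonormal isotropic frame of V is an orthonormal frame over
   the algebra D = F + F j, whose hermitian form is h - omega j. *)

theory Submission
  imports Defs
begin

text \<open>The relations defining a frame are quadratic, so straight-line homotopies leave the
  space of frames. The remedy is to separate them: for fixed isotropic e, duality with e is an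
  affine condition on f, and only the isotropy of f has to be repaired afterwards. The straight path
  from e to its orthonormalization is safe because Gram-Schmidt is triangular with positive
  diagonal, so the pairing of the moving family with f stays invertible.

  Injectivity needs no separate argument: commutators are constant on a component and the fibres are
  path connected, so a component is a whole fibre. Surjectivity is a dimension count: a form of rank
  2r is realizable exactly when r \<le> n, and the largest r occurring among forms on F^k is the
  integer part of k/2.

  The two fields are treated at once. The lattice is defined through the Euclidean basis,
  conjugation is abstract (the identity or complex conjugation), and the doubled algebra enters only
  through its coordinates and one product formula; the last section supplies the two
  instances.\<close>

section \<open>Alternating forms\<close>

text \<open>Applying \<open>L j\<close> to a vanishing linear combination isolates its j-th
  coefficient. The general setting serves two different spaces: coordinate vectors, and functionals
  under pointwise operations.\<close>

lemma (in vector_space) dual_family_independent: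
  assumes "finite I"
    and L_add: "\<And>i v w. L i (v + w) = L i v + L i w"
    and L_scale: "\<And>i c v. L i (scale c v) = c * L i v"
    and dual: "\<And>i j. i \<in> I \<Longrightarrow> j \<in> I \<Longrightarrow> L i (x j) = (if i = j then 1 else 0)"
  shows "inj_on x I" "independent (x ` I)"
proof -
  show inj: "inj_on x I"
  proof (rule inj_onI)
    fix i j assume "i \<in> I" "j \<in> I" "x i = x j"
    then show "i = j" using dual[of i i] dual[of i j] by (auto split: if_splits)
  qed
  have L_zero: "L i 0 = 0" for i using L_scale[of i 0 0] by simp
  have L_sum: "L i (\<Sum>a\<in>S. g a) = (\<Sum>a\<in>S. L i (g a))" for i S and g :: "'d \<Rightarrow> 'b"
    by (induction S rule: infinite_finite_induct) (simp_all add: L_zero L_add)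
  show "independent (x ` I)"
  proof
    assume "dependent (x ` I)"
    then obtain u j where j: "j \<in> I" "u (x j) \<noteq> 0" and zero: "(\<Sum>v\<in>x ` I. scale (u v) v) = 0"
      unfolding dependent_finite[OF finite_imageI[OF \<open>finite I\<close>]] by blast
    have "(\<Sum>i\<in>I. scale (u (x i)) (x i)) = 0"
      using zero by (simp add: sum.reindex[OF inj])
    then have "0 = L j (\<Sum>i\<in>I. scale (u (x i)) (x i))" by (simp add: L_zero)
    also have "\<dots> = (\<Sum>i\<in>I. if j = i then u (x i) else 0)"
      unfolding L_sum L_scale by (rule sum.cong) (use dual j in auto)
    also have "\<dots> = u (x j)" using j \<open>finite I\<close> by simp
    finally show False using j by simp
  qed
qed

text \<open>The form is a parameter because the notion is used both for the form \<beta> on F^k and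
  for \<open>omega\<close> on V. Values at indices from r on are unconstrained.\<close>

definition hyperbolic ::
    "('v \<Rightarrow> 'v \<Rightarrow> 'f::zero_neq_one) \<Rightarrow> nat \<Rightarrow> (nat \<Rightarrow> 'v) \<Rightarrow> (nat \<Rightarrow> 'v) \<Rightarrow> bool" where
  "hyperbolic B r e f \<longleftrightarrow> (\<forall>i<r. \<forall>j<r. B (e i) (e j) = 0 \<and> B (f i) (f j) = 0 \<and>
     B (e i) (f j) = (if i = j then 1 else 0))"

lemma hyperbolicD:
  assumes "hyperbolic B r e f" "i < r" "j < r"
  shows "B (e i) (e j) = 0" "B (f i) (f j) = 0" "B (e i) (f j) = (if i = j then 1 else 0)"
  using assms by (auto simp: hyperbolic_def)

text \<open>In characteristic zero skewness already gives B x x = 0. Degenerate forms are included,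
  since \<beta> may have a radical.\<close>

locale alternating_form =
  fixes B :: "'f::field_char_0 ^ 'm::finite \<Rightarrow> 'f ^ 'm \<Rightarrow> 'f"
  assumes add_left: "B (x + y) z = B x z + B y z"
    and scale_left: "B (c *s x) y = c * B x y"
    and skew: "B y x = - B x y"
begin

lemma add_right: "B x (y + z) = B x y + B x z"
  by (metis add_left minus_add_distrib skew)

lemma scale_right: "B x (c *s y) = c * B x y"
  by (metis mult_minus_right scale_left skew)

lemma self [simp]: "B x x = 0"
  using skew[of x x] by (simp add: eq_neg_iff_add_eq_0 flip: mult_2)

lemma zero_left [simp]: "B 0 x = 0"
  using scale_left[of 0 0 x] by simp

lemma zero_right [simp]: "B x 0 = 0"
  by (simp add: skew[of x 0])

lemma minus_left: "B (- x) y = - B x y"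
  using add_left[of "- x" x y] by (simp add: eq_neg_iff_add_eq_0)

lemma minus_right: "B x (- y) = - B x y"
  by (metis minus_left skew)

lemma diff_left: "B (x - y) z = B x z - B y z"
  using add_left[of x "- y" z] by (simp add: minus_left)

lemma diff_right: "B x (y - z) = B x y - B x z"
  using add_right[of x y "- z"] by (simp add: minus_right)

lemma sum_left: "B (\<Sum>i\<in>I. g i) y = (\<Sum>i\<in>I. B (g i) y)"
  by (induction I rule: infinite_finite_induct) (simp_all add: add_left)

lemma sum_right: "B x (\<Sum>i\<in>I. g i) = (\<Sum>i\<in>I. B x (g i))"
  by (induction I rule: infinite_finite_induct) (simp_all add: add_right)

lemmas bilinear = add_left add_right scale_left scale_right minus_left minus_right
  diff_left diff_right sum_left sum_right

lemma hyperbolic_flip: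
  assumes "hyperbolic B r e f" "i < r" "j < r"
  shows "B (f i) (e j) = (if i = j then - 1 else 0)"
  using hyperbolicD(3)[OF assms(1,3,2)] by (auto simp: skew[of "f i" "e j"])

text \<open>The functionals B(-, f i) and -B(-, e i) are dual to the vectors e i and f i, so these
  2r vectors are independent. A Boolean tag merges e and f into one indexed family.\<close>

lemma hyperbolic_bound:
  assumes "hyperbolic B r e f"
  shows "2 * r \<le> CARD('m)"
proof -
  let ?I = "(UNIV :: bool set) \<times> {..<r}"
  define x where "x = (\<lambda>(b, i). if b then e i else f i)"
  define L where "L = (\<lambda>(b, i) v. if b then B v (f i) else - B v (e i))"
  have L: "L k (v + w) = L k v + L k w" "L k (c *s v) = c * L k v" for k v w c
    by (auto simp: L_def bilinear split: prod.splits)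
  have "L k (x l) = (if k = l then 1 else 0)" if "k \<in> ?I" "l \<in> ?I" for k l
    using that hyperbolicD[OF assms] hyperbolic_flip[OF assms]
    by (cases k; cases l) (auto simp: L_def x_def)
  note * = vec.dual_family_independent[of ?I L x, OF _ L this, simplified finite_SigmaI]
  have "card (x ` ?I) \<le> vec.dim (UNIV :: ('f ^ 'm) set)"
    by (rule vec.independent_card_le_dim) (use * in auto)
  moreover have "card (x ` ?I) = 2 * r"
    using *(1) by (simp add: card_image card_cartesian_product)
  ultimately show ?thesis using vec_dim_card[where 'a = 'f and 'n = 'm] by metis
qed

text \<open>The expansion says that every vector agrees modulo the radical of B with its projection
  to the span of the p i and q i; the system thus captures the whole nondegenerate part of
  B.\<close>

definition complete :: "nat \<Rightarrow> (nat \<Rightarrow> 'f ^ 'm) \<Rightarrow> (nat \<Rightarrow> 'f ^ 'm) \<Rightarrow> bool" where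
  "complete r p q \<longleftrightarrow> hyperbolic B r p q \<and>
     (\<forall>x y. B x y = (\<Sum>i<r. B x (q i) * B (p i) y - B x (p i) * B (q i) y))"

text \<open>For a hyperbolic system this is the B-orthogonal projection onto its span; the minus
  sign reflects B (q i) (p i) = -1.\<close>

definition proj :: "nat \<Rightarrow> (nat \<Rightarrow> 'f ^ 'm) \<Rightarrow> (nat \<Rightarrow> 'f ^ 'm) \<Rightarrow> 'f ^ 'm \<Rightarrow> 'f ^ 'm" where
  "proj r p q x = (\<Sum>i<r. B x (q i) *s p i - B x (p i) *s q i)"

lemma proj_form:
  "B (proj r p q x) y = (\<Sum>i<r. B x (q i) * B (p i) y - B x (p i) * B (q i) y)"
  by (simp add: proj_def bilinear)

lemma proj_form_basis:
  assumes "hyperbolic B r p q" "j < r"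
  shows "B (proj r p q x) (p j) = B x (p j)" "B (proj r p q x) (q j) = B x (q j)"
proof -
  have "B (proj r p q x) (p j) = (\<Sum>i<r. if i = j then B x (p i) else 0)"
    unfolding proj_form using hyperbolicD[OF assms(1) _ assms(2)] hyperbolic_flip[OF assms(1) _ assms(2)]
    by (intro sum.cong) auto
  then show "B (proj r p q x) (p j) = B x (p j)" using assms by simp
  have "B (proj r p q x) (q j) = (\<Sum>i<r. if i = j then B x (q i) else 0)"
    unfolding proj_form using hyperbolicD[OF assms(1) _ assms(2)] hyperbolic_flip[OF assms(1) _ assms(2)]
    by (intro sum.cong) auto
  then show "B (proj r p q x) (q j) = B x (q j)" using assms by simp
qed

text \<open>A hyperbolic system of maximal length, which exists by the dimension bound, is complete.
  If the expansion fails at x and y, the components of x and y orthogonal to the system pair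
  nontrivially and, after scaling one of them, form one more hyperbolic pair.\<close>

lemma complete_exists: "\<exists>r p q. complete r p q"
proof -
  have "\<exists>p q. hyperbolic B 0 p q" by (simp add: hyperbolic_def)
  moreover have "r \<le> CARD('m)" if "\<exists>p q. hyperbolic B r p q" for r
    using that hyperbolic_bound by (metis le_add2 le_trans mult_2)
  ultimately obtain r where "\<exists>p q. hyperbolic B r p q"
    and max: "\<And>s. \<exists>p q. hyperbolic B s p q \<Longrightarrow> s \<le> r"
    using ex_has_greatest_nat[of "\<lambda>r. \<exists>p q. hyperbolic B r p q" 0 "\<lambda>r. r" "Suc (CARD('m))"]
    by (metis le_imp_less_Suc)
  then obtain p q where hyp: "hyperbolic B r p q" by blast
  note perp = proj_form_basis[OF hyp]
  have "complete r p q"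
  proof (rule ccontr)
    assume "\<not> complete r p q"
    then obtain x y where neq: "B x y \<noteq> B (proj r p q x) y"
      using hyp by (auto simp: complete_def proj_form)
    define x' y' where "x' = x - proj r p q x" and "y' = y - proj r p q y"
    have x': "B x' (p j) = 0" "B x' (q j) = 0" "B (p j) x' = 0" "B (q j) x' = 0"
      and y': "B y' (p j) = 0" "B y' (q j) = 0" "B (p j) y' = 0" "B (q j) y' = 0" if "j < r" for j
      using perp[OF that] skew[of "p j"] skew[of "q j"] by (simp_all add: x'_def y'_def diff_left)
    \<comment> \<open>Since x' is orthogonal to the system, projecting y away does not change its
      pairing with x'; what remains is exactly the defect of the expansion at x and y.\<close>
    have "B x' (proj r p q y) = 0"
      using x' by (simp add: proj_def bilinear)
    then have "B x' y' = B x y - B (proj r p q x) y"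
      by (simp add: y'_def diff_right) (simp add: x'_def diff_left)
    with neq have c: "B x' y' \<noteq> 0" by simp
    have "hyperbolic B (Suc r) (p(r := x')) (q(r := inverse (B x' y') *s y'))"
      using hyp c x' y' unfolding hyperbolic_def less_Suc_eq
      by (auto simp: scale_right scale_left)
    then show False using max[of "Suc r"] by auto
  qed
  then show ?thesis by blast
qed

end

section \<open>Skew matrices as alternating forms, and the rank of the adjoint\<close>

lemma alternating_bilinear_form:
  assumes "transpose \<beta> = - \<beta>"
  shows "alternating_form (bilinear_form (\<beta> :: 'f::field_char_0 ^ 'k ^ 'k::finite))"
proof
  fix x y z :: "'f ^ 'k" and c :: 'f
  have skew: "\<beta> $ i $ j = - \<beta> $ j $ i" for i j
    using arg_cong[OF assms, of "\<lambda>M. M $ j $ i"] by (simp add: transpose_def)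
  show "bilinear_form \<beta> (x + y) z = bilinear_form \<beta> x z + bilinear_form \<beta> y z"
    by (simp add: bilinear_form_def algebra_simps sum.distrib)
  show "bilinear_form \<beta> (c *s x) y = c * bilinear_form \<beta> x y"
    by (simp add: bilinear_form_def sum_distrib_left algebra_simps)
  have "bilinear_form \<beta> y x = (\<Sum>j\<in>UNIV. \<Sum>i\<in>UNIV. y $ i * \<beta> $ i $ j * x $ j)"
    unfolding bilinear_form_def by (rule sum.swap)
  also have "\<dots> = (\<Sum>j\<in>UNIV. \<Sum>i\<in>UNIV. - (x $ j * \<beta> $ j $ i * y $ i))"
  proof (intro sum.cong refl)
    fix i j
    show "y $ i * \<beta> $ i $ j * x $ j = - (x $ j * \<beta> $ j $ i * y $ i)"
      by (simp add: skew[of i j])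
  qed
  finally show "bilinear_form \<beta> y x = - bilinear_form \<beta> x y"
    by (simp add: bilinear_form_def sum_negf)
qed

lemma bilinear_form_axis [simp]: "bilinear_form \<beta> (axis i 1) (axis j 1) = \<beta> $ i $ j"
proof -
  have "bilinear_form \<beta> (axis i 1) (axis j 1) =
      (\<Sum>a\<in>UNIV. \<Sum>b\<in>UNIV. if b = j then if a = i then \<beta> $ a $ b else 0 else 0)"
    unfolding bilinear_form_def by (intro sum.cong) (auto simp: axis_def)
  then show ?thesis by simp
qed

lemma sum_fun_apply: "(\<Sum>i\<in>I. g i) y = (\<Sum>i\<in>I. g i y)" for g :: "'i \<Rightarrow> 'a \<Rightarrow> 'b::comm_monoid_add"
  by (induction I rule: infinite_finite_induct) simp_all

text \<open>The functionals B (p i) and B (q i) form a basis of the range of the adjoint: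
  completeness makes them span it, and evaluation at q i and at -(p i) gives a dual family.\<close>

lemma rank_adjoint_complete:
  fixes \<beta> :: "'f::field_char_0 ^ 'k ^ 'k::finite"
  assumes "transpose \<beta> = - \<beta>"
    and complete: "alternating_form.complete (bilinear_form \<beta>) r p q"
  shows "rank_adjoint \<beta> = 2 * r"
proof -
  define B where "B = bilinear_form \<beta>"
  interpret B: alternating_form B
    unfolding B_def by (rule alternating_bilinear_form) fact
  interpret V: vector_space "\<lambda>c (\<phi> :: 'f ^ 'k \<Rightarrow> 'f) y. c * \<phi> y" by (rule vector_space_pointwise)
  have hyp: "hyperbolic B r p q"
    and expand: "B x y = (\<Sum>i<r. B x (q i) * B (p i) y - B x (p i) * B (q i) y)" for x y
    using complete unfolding B_def[symmetric] B.complete_def by blast+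
  let ?I = "(UNIV :: bool set) \<times> {..<r}"
  define x where "x = (\<lambda>(b, i). if b then B (p i) else B (q i))"
  define L where "L = (\<lambda>(b, i) (\<phi> :: 'f ^ 'k \<Rightarrow> 'f). if b then \<phi> (q i) else - \<phi> (p i))"
  have L: "L k (v + w) = L k v + L k w" "L k (\<lambda>y. c * v y) = c * L k v" for k v w c
    by (auto simp: L_def split: prod.splits)
  have "L k (x l) = (if k = l then 1 else 0)" if "k \<in> ?I" "l \<in> ?I" for k l
    using that hyperbolicD[OF hyp] B.hyperbolic_flip[OF hyp]
    by (cases k; cases l) (auto simp: L_def x_def)
  note * = V.dual_family_independent[of ?I L x, OF _ L this, simplified finite_SigmaI]
  have "V.dim (range B) = card (x ` ?I)"
  proof (rule V.dim_unique)
    show "x ` ?I \<subseteq> range B" by (auto simp: x_def)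
    show "range B \<subseteq> V.span (x ` ?I)"
    proof
      fix \<phi> assume "\<phi> \<in> range B"
      then obtain v where v: "\<phi> = B v" by blast
      have "\<phi> = (\<Sum>i<r. (\<lambda>y. B v (q i) * x (True, i) y) - (\<lambda>y. B v (p i) * x (False, i) y))"
        
      proof
        show "\<phi> y = (\<Sum>i<r. (\<lambda>y. B v (q i) * x (True, i) y) - (\<lambda>y. B v (p i) * x (False, i) y)) y" for y
          by (simp add: v expand[of v y] x_def sum_fun_apply)
      qed
      also have "\<dots> \<in> V.span (x ` ?I)"
        by (intro V.span_sum V.span_diff V.span_scale V.span_base) auto
      finally show "\<phi> \<in> V.span (x ` ?I)" .
    qed
    show "V.independent (x ` ?I)" using * by auto
  qed auto
  moreover have "card (x ` ?I) = 2 * r"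
    using *(1) by (simp add: card_image card_cartesian_product)
  ultimately show ?thesis by (simp add: rank_adjoint_def B_def)
qed

section \<open>Symplectic frames\<close>

definition omega :: "'f::field ^ ('n::finite + 'n) \<Rightarrow> 'f ^ ('n + 'n) \<Rightarrow> 'f" where
  "omega v w = (\<Sum>i\<in>UNIV. v $ Inl i * w $ Inr i - w $ Inl i * v $ Inr i)"

interpretation omega: alternating_form "omega :: 'f::field_char_0 ^ ('n::finite + 'n) \<Rightarrow> _"
  by unfold_locales
    (simp_all add: omega_def sum_distrib_left algebra_simps sum.distrib sum_subtractf flip: sum_negf)

lemma continuous_on_scalar_mult [continuous_intros]:
  fixes c :: "'a::topological_space \<Rightarrow> 'f::real_normed_field" and v :: "'a \<Rightarrow> 'f ^ 'm"
  assumes "continuous_on S c" "continuous_on S v"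
  shows "continuous_on S (\<lambda>x. c x *s v x)"
  unfolding vector_scalar_mult_def using assms by (intro continuous_intros)

lemma continuous_on_omega [continuous_intros]:
  fixes v w :: "'a::topological_space \<Rightarrow> 'f::real_normed_field ^ ('n::finite + 'n)"
  assumes "continuous_on S v" "continuous_on S w"
  shows "continuous_on S (\<lambda>x. omega (v x) (w x))"
  unfolding omega_def using assms by (intro continuous_intros)

lemma continuous_on_fst_coordinate [continuous_intros]:
  "continuous_on S (\<lambda>x. fst x i)"
  for S :: "(('i \<Rightarrow> 'a::topological_space) \<times> 'b::topological_space) set"
  by (rule continuous_on_product_then_coordinatewise[OF continuous_on_fst[OF continuous_on_id]])

lemma continuous_on_snd_coordinate [continuous_intros]:
  "continuous_on S (\<lambda>x. snd x i)"
  for S :: "('b::topological_space \<times> ('i \<Rightarrow> 'a::topological_space)) set"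
  by (rule continuous_on_product_then_coordinatewise[OF continuous_on_snd[OF continuous_on_id]])

type_synonym ('f, 'n) frame = "(nat \<Rightarrow> 'f ^ ('n + 'n)) \<times> (nat \<Rightarrow> 'f ^ ('n + 'n))"

text \<open>Padding by zero makes a frame an ordinary pair of functions determined by its first r
  vectors, so that the type class topology on functions can be used.\<close>

definition frames :: "nat \<Rightarrow> ('f::real_normed_field, 'n::finite) frame set" where
  "frames r = {(e, f). hyperbolic omega r e f \<and> (\<forall>i\<ge>r. e i = 0 \<and> f i = 0)}"

subsection \<open>Connectedness by transvections\<close>

definition transvection ::
    "'f::real_normed_field ^ ('n::finite + 'n) \<Rightarrow> 'f \<Rightarrow> 'f ^ ('n + 'n) \<Rightarrow> 'f ^ ('n + 'n)" where
  "transvection u c x = x + (c * omega x u) *s u"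

text \<open>The two mixed terms cancel by skewness, and the remaining one contains omega u u =
  0.\<close>

lemma omega_transvection: "omega (transvection u c x) (transvection u c y) = omega x y"
  using omega.skew[of u y] by (simp add: transvection_def omega.bilinear)

lemma transvection_frames:
  assumes "(e, f) \<in> frames r"
  shows "(transvection u c \<circ> e, transvection u c \<circ> f) \<in> frames r"
  using assms by (auto simp: frames_def hyperbolic_def omega_transvection transvection_def[of _ _ 0])

text \<open>K holds the vectors that are already in their final position. Asking for a path from
  every frame, and not from one chosen frame, makes moves composable.\<close>

definition frame_move ::
    "nat \<Rightarrow> ('f::real_normed_field ^ ('n::finite + 'n)) set \<Rightarrow> ('f ^ ('n + 'n) \<Rightarrow> 'f ^ ('n + 'n)) \<Rightarrow> bool"
  where "frame_move r K \<phi> \<longleftrightarrow> (\<forall>k\<in>K. \<phi> k = k) \<and>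
    (\<forall>x\<in>frames r. path_component (frames r) x (\<phi> \<circ> fst x, \<phi> \<circ> snd x))"

lemma frame_move_frames:
  assumes "frame_move r K \<phi>" "x \<in> frames r"
  shows "(\<phi> \<circ> fst x, \<phi> \<circ> snd x) \<in> frames r"
  using assms path_component_mem(2) unfolding frame_move_def by blast

lemma frame_move_transvection:
  fixes u :: "'f::real_normed_field ^ ('n::finite + 'n)"
  assumes "\<And>k. k \<in> K \<Longrightarrow> omega k u = 0"
  shows "frame_move r K (transvection u c)"
  unfolding frame_move_def
proof (intro conjI ballI)
  show "transvection u c k = k" if "k \<in> K" for k
    using assms[OF that] by (simp add: transvection_def)
next
  fix x :: "('f, 'n) frame"
  assume "x \<in> frames r"
  define \<gamma> where "\<gamma> t = (transvection u (of_real t * c) \<circ> fst x, transvection u (of_real t * c) \<circ> snd x)" for t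
  have "path \<gamma>"
    unfolding path_def \<gamma>_def transvection_def o_def by (intro continuous_intros)
  moreover have "path_image \<gamma> \<subseteq> frames r"
    using \<open>x \<in> frames r\<close> transvection_frames[of "fst x" "snd x"] by (auto simp: path_image_def \<gamma>_def)
  ultimately show "path_component (frames r) x (transvection u c \<circ> fst x, transvection u c \<circ> snd x)"
    unfolding path_component_def
    by (intro exI[of _ \<gamma>]) (auto simp: pathstart_def pathfinish_def \<gamma>_def transvection_def prod_eq_iff)
qed

lemma frame_move_comp:
  assumes "frame_move r K \<phi>" "frame_move r K \<psi>"
  shows "frame_move r K (\<psi> \<circ> \<phi>)"
  unfolding frame_move_def
proof (intro conjI ballI)
  show "(\<psi> \<circ> \<phi>) k = k" if "k \<in> K" for k
    using that assms by (simp add: frame_move_def)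
next
  fix x :: "('a, 'b) frame"
  assume x: "x \<in> frames r"
  have "path_component (frames r) x (\<phi> \<circ> fst x, \<phi> \<circ> snd x)"
    using x assms(1) by (simp add: frame_move_def)
  moreover have "path_component (frames r) (\<phi> \<circ> fst x, \<phi> \<circ> snd x) (\<psi> \<circ> (\<phi> \<circ> fst x), \<psi> \<circ> (\<phi> \<circ> snd x))"
    using frame_move_frames[OF assms(1) x] assms(2) unfolding frame_move_def by force
  ultimately show "path_component (frames r) x (\<psi> \<circ> \<phi> \<circ> fst x, \<psi> \<circ> \<phi> \<circ> snd x)"
    unfolding comp_assoc by (rule path_component_trans)
qed

lemma frame_move_mono: "frame_move r K \<phi> \<Longrightarrow> L \<subseteq> K \<Longrightarrow> frame_move r L \<phi>"
  by (auto simp: frame_move_def)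

text \<open>Along u = y - x one has omega x u = omega x y, so the coefficient
  \<open>inverse (omega x y)\<close> adds exactly y - x to x. Vectors pairing equally with x and y
  are orthogonal to u and stay fixed.\<close>

lemma frame_move_direct:
  assumes "omega x y \<noteq> 0" "\<And>k. k \<in> K \<Longrightarrow> omega k x = omega k y"
  shows "\<exists>\<phi>. frame_move r K \<phi> \<and> \<phi> x = y"
proof (intro exI conjI)
  show "frame_move r K (transvection (y - x) (inverse (omega x y)))"
    by (rule frame_move_transvection) (simp add: assms(2) omega.diff_right)
  show "transvection (y - x) (inverse (omega x y)) x = y"
    using assms(1) by (simp add: transvection_def omega.diff_right)
qed

text \<open>No single transvection carries x to a different y with omega x y = 0: its direction
  would be proportional to y - x, which is orthogonal to x. A vector z pairing nontrivially with
  both gives a detour.\<close>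

lemma frame_move_via:
  assumes "omega x z \<noteq> 0" "omega z y \<noteq> 0"
    and "\<And>k. k \<in> K \<Longrightarrow> omega k x = omega k z" "\<And>k. k \<in> K \<Longrightarrow> omega k z = omega k y"
  shows "\<exists>\<phi>. frame_move r K \<phi> \<and> \<phi> x = y"
proof -
  obtain \<phi> where \<phi>: "frame_move r K \<phi>" "\<phi> x = z"
    using frame_move_direct[OF assms(1,3)] by blast
  obtain \<psi> where \<psi>: "frame_move r K \<psi>" "\<psi> z = y"
    using frame_move_direct[OF assms(2,4)] by blast
  show ?thesis
    by (rule exI[of _ "\<psi> \<circ> \<phi>"]) (simp add: \<phi> \<psi> frame_move_comp)
qed

text \<open>The partners x' and y' supply the intermediate vector: x' if it pairs nontrivially with
  y, otherwise y' if it pairs nontrivially with x. If both pairings vanish, x' + y' pairs to 1 with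
  x, and its pairing with y is -1.\<close>

lemma frame_move_isotropic:
  assumes "omega x x' = 1" "omega y y' = 1"
    and K: "\<And>k. k \<in> K \<Longrightarrow> omega k x = 0 \<and> omega k y = 0 \<and> omega k x' = 0 \<and> omega k y' = 0"
  shows "\<exists>\<phi>. frame_move r K \<phi> \<and> \<phi> x = y"
proof (cases "omega x' y = 0")
  case False
  then show ?thesis
    using assms by (intro frame_move_via[of x x' y]) auto
next
  case 1: True
  show ?thesis
  proof (cases "omega x y' = 0")
    case False
    then show ?thesis
      using assms omega.skew[of y y'] by (intro frame_move_via[of x y' y]) auto
  next
    case True
    then show ?thesis
      using assms 1 omega.skew[of y y']
      by (intro frame_move_via[of x "x' + y'" y]) (auto simp: omega.bilinear)
  qed
qed

text \<open>When y and y' are orthogonal, the detour goes through x + y. All three vectors pair to 1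
  with x, so x itself stays fixed.\<close>

lemma frame_move_dual:
  assumes "omega x y = 1" "omega x y' = 1"
    and K: "\<And>k. k \<in> K \<Longrightarrow> omega k x = 0 \<and> omega k y = 0 \<and> omega k y' = 0"
  shows "\<exists>\<phi>. frame_move r (insert x K) \<phi> \<and> \<phi> y = y'"
proof (cases "omega y y' = 0")
  case False
  then show ?thesis
    using assms by (intro frame_move_direct) auto
next
  case True
  then show ?thesis
    using assms omega.skew[of x y]
    by (intro frame_move_via[of y "x + y" y']) (auto simp: omega.bilinear)
qed

text \<open>The pairs are matched one at a time. First e m is moved with all earlier target pairs
  fixed, then f m with e' m fixed as well.\<close>

lemma frame_move_agree:
  assumes x: "(e, f) \<in> frames r" and y: "(e', f') \<in> frames r" and "m \<le> r"
  shows "\<exists>\<phi>. frame_move r {} \<phi> \<and> (\<forall>i<m. \<phi> (e i) = e' i \<and> \<phi> (f i) = f' i)"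
  using \<open>m \<le> r\<close>
proof (induction m)
  case 0
  \<comment> \<open>The transvection along the zero vector is the identity, which matches zero
    pairs.\<close>
  have "frame_move r {} (transvection (0 :: 'a ^ ('b + 'b)) 0)"
    by (rule frame_move_transvection) simp
  then show ?case by blast
next
  case (Suc m)
  then obtain \<phi> where \<phi>: "frame_move r {} \<phi>" "\<And>i. i < m \<Longrightarrow> \<phi> (e i) = e' i \<and> \<phi> (f i) = f' i"
    by auto
  have m: "m < r" using Suc by simp
  define K where "K = e' ` {..<m} \<union> f' ` {..<m}"
  have hyp': "hyperbolic omega r e' f'" using y by (simp add: frames_def)
  have K': "omega k (e' m) = 0 \<and> omega k (f' m) = 0" if "k \<in> K" for k
    using that m hyperbolicD[OF hyp' _ m] omega.hyperbolic_flip[OF hyp' _ m] unfolding K_def by force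
  \<comment> \<open>An already matched vector of K is also a member of the moved frame, so the
    relations of that frame make it orthogonal to the pair still to be moved.\<close>
  have K: "omega k (\<psi> (e m)) = 0 \<and> omega k (\<psi> (f m)) = 0"
    if "k \<in> K" "(\<psi> \<circ> e, \<psi> \<circ> f) \<in> frames r" "\<And>i. i < m \<Longrightarrow> \<psi> (e i) = e' i \<and> \<psi> (f i) = f' i" for k \<psi>
  proof -
    have hyp: "hyperbolic omega r (\<psi> \<circ> e) (\<psi> \<circ> f)" using that by (simp add: frames_def)
    have "k \<in> (\<psi> \<circ> e) ` {..<m} \<union> (\<psi> \<circ> f) ` {..<m}"
      using that(1,3) unfolding K_def by (auto simp: image_iff)
    then show ?thesis
      using m hyperbolicD[OF hyp _ m] omega.hyperbolic_flip[OF hyp _ m] by force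
  qed
  have \<phi>_frames: "(\<phi> \<circ> e, \<phi> \<circ> f) \<in> frames r"
    using frame_move_frames[OF \<phi>(1) x] by simp
  obtain \<psi> where \<psi>: "frame_move r K \<psi>" "\<psi> (\<phi> (e m)) = e' m"
  proof -
    have "omega (\<phi> (e m)) (\<phi> (f m)) = 1"
      using \<phi>_frames m by (auto simp: frames_def hyperbolic_def)
    moreover have "omega (e' m) (f' m) = 1"
      using y m by (auto simp: frames_def hyperbolic_def)
    ultimately show ?thesis
      using frame_move_isotropic[of "\<phi> (e m)" "\<phi> (f m)" "e' m" "f' m" K r] K'
        K[OF _ \<phi>_frames \<phi>(2)] that by blast
  qed
  have \<psi>_frames: "((\<psi> \<circ> \<phi>) \<circ> e, (\<psi> \<circ> \<phi>) \<circ> f) \<in> frames r"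
    using frame_move_frames[OF \<psi>(1) \<phi>_frames] by (simp add: o_assoc)
  have \<psi>_K: "(\<psi> \<circ> \<phi>) (e i) = e' i \<and> (\<psi> \<circ> \<phi>) (f i) = f' i" if "i < m" for i
    using that \<psi>(1) \<phi>(2)[OF that] by (auto simp: frame_move_def K_def)
  obtain \<theta> where \<theta>: "frame_move r (insert (e' m) K) \<theta>" "\<theta> (\<psi> (\<phi> (f m))) = f' m"
  proof -
    have "omega (e' m) (\<psi> (\<phi> (f m))) = 1"
      using \<psi>_frames m \<psi>(2) by (force simp: frames_def hyperbolic_def)
    moreover have "omega (e' m) (f' m) = 1"
      using y m by (auto simp: frames_def hyperbolic_def)
    ultimately show ?thesis
      using frame_move_dual[of "e' m" "\<psi> (\<phi> (f m))" "f' m" K r] K'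
        K[OF _ \<psi>_frames \<psi>_K] that by auto
  qed
  have "frame_move r {} (\<theta> \<circ> (\<psi> \<circ> \<phi>))"
    using \<phi> \<psi> \<theta> by (intro frame_move_comp) (auto intro: frame_move_mono)
  moreover have "(\<theta> \<circ> (\<psi> \<circ> \<phi>)) (e i) = e' i \<and> (\<theta> \<circ> (\<psi> \<circ> \<phi>)) (f i) = f' i" if "i < Suc m" for i
  proof (cases "i = m")
    case True
    then show ?thesis using \<theta> \<psi>(2) by (auto simp: frame_move_def)
  next
    case False
    then show ?thesis using that \<psi>_K[of i] \<theta>(1) by (auto simp: frame_move_def K_def)
  qed
  ultimately show ?case by blast
qed

lemma path_connected_frames: "path_connected (frames r :: ('f::real_normed_field, 'n::finite) frame set)"
  unfolding path_connected_component
proof (intro ballI)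
  fix x y :: "('f, 'n) frame"
  assume x: "x \<in> frames r" and y: "y \<in> frames r"
  then obtain \<phi> where \<phi>: "frame_move r {} \<phi>"
      "\<And>i. i < r \<Longrightarrow> \<phi> (fst x i) = fst y i \<and> \<phi> (snd x i) = snd y i"
    using frame_move_agree[of "fst x" "snd x" r "fst y" "snd y" r] by auto
  have "(\<phi> \<circ> fst x, \<phi> \<circ> snd x) \<in> frames r"
    by (rule frame_move_frames[OF \<phi>(1) x])
  \<comment> \<open>From index r on both sides vanish, because the moved pair is again in
    \<open>frames r\<close>.\<close>
  then have "\<phi> (fst x i) = fst y i \<and> \<phi> (snd x i) = snd y i" for i
    using \<phi>(2)[of i] y by (cases "i < r") (auto simp: frames_def)
  then have "(\<phi> \<circ> fst x, \<phi> \<circ> snd x) = y" by (auto simp: prod_eq_iff)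
  then show "path_component (frames r) x y"
    using \<phi>(1) x by (auto simp: frame_move_def)
qed

lemma frames_nonempty_iff: "(frames r :: ('f::real_normed_field, 'n::finite) frame set) \<noteq> {} \<longleftrightarrow> r \<le> CARD('n)"
proof
  assume "(frames r :: ('f, 'n) frame set) \<noteq> {}"
  then obtain e f :: "nat \<Rightarrow> 'f ^ ('n + 'n)" where "hyperbolic omega r e f" by (auto simp: frames_def)
  then have "2 * r \<le> CARD('n + 'n)" by (rule omega.hyperbolic_bound)
  then show "r \<le> CARD('n)" by simp
next
  assume "r \<le> CARD('n)"
  then obtain g :: "nat \<Rightarrow> 'n" where g: "inj_on g {..<r}"
    using card_le_inj[of "{..<r}" "UNIV :: 'n set"] by auto
  let ?e = "\<lambda>i. if i < r then axis (Inl (g i)) 1 else 0 :: 'f ^ ('n + 'n)"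
  let ?f = "\<lambda>i. if i < r then axis (Inr (g i)) 1 else 0 :: 'f ^ ('n + 'n)"
  have "omega (?e i) (?f j) = (if i = j then 1 else 0)" if "i < r" "j < r" for i j
  proof -
    have "omega (?e i) (?f j) = (\<Sum>a\<in>UNIV. if a = g i then if g i = g j then 1 else 0 else 0)"
      using that unfolding omega_def by (intro sum.cong) (auto simp: axis_def)
    also have "\<dots> = (if i = j then 1 else 0)"
      using that g by (auto simp: inj_on_eq_iff)
    finally show ?thesis .
  qed
  moreover have "omega (axis (Inl a) 1) (axis (Inl b) (1 :: 'f)) = 0"
      "omega (axis (Inr a) 1) (axis (Inr b) (1 :: 'f)) = 0" for a b :: 'n
    by (simp_all add: omega_def axis_def)
  ultimately have "(?e, ?f) \<in> frames r"
    unfolding frames_def hyperbolic_def by simp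
  then show "(frames r :: ('f, 'n) frame set) \<noteq> {}" by blast
qed

section \<open>Deformation onto unitary frames\<close>

text \<open>Because \<rho> is an exact left inverse of \<sigma>, a single homotopy, on X, is all
  that remains to be given.\<close>

lemma homotopy_equivalent_retractI:
  fixes X :: "'a::topological_space set" and Y :: "'b::topological_space set"
  assumes "continuous_on X \<rho>" "\<rho> ` X \<subseteq> Y" "continuous_on Y \<sigma>" "\<sigma> ` Y \<subseteq> X"
    and "\<And>y. y \<in> Y \<Longrightarrow> \<rho> (\<sigma> y) = y"
    and H: "continuous_on ({0..1} \<times> X) H" "\<And>t x. t \<in> {0..1} \<Longrightarrow> x \<in> X \<Longrightarrow> H (t, x) \<in> X"
      "\<And>x. x \<in> X \<Longrightarrow> H (0 :: real, x) = x" "\<And>x. x \<in> X \<Longrightarrow> H (1, x) = \<sigma> (\<rho> x)"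
  shows "top_of_set X homotopy_equivalent_space top_of_set Y"
proof (rule deformation_retraction_imp_homotopy_equivalent_space)
  have "continuous_map (prod_topology (top_of_set {0..1}) (top_of_set X)) (top_of_set X) H"
    using H(1,2) by (auto simp: prod_topology_subtopology_eu continuous_map_subtopology_eu)
  then have "homotopic_with (\<lambda>x. True) (top_of_set X) (top_of_set X) id (\<sigma> \<circ> \<rho>)"
    using H(3,4) by (subst homotopic_with) (auto intro!: exI[of _ H])
  then show "homotopic_with (\<lambda>x. True) (top_of_set X) (top_of_set X) (\<sigma> \<circ> \<rho>) id"
    by (rule homotopic_with_symD)
  show "retraction_maps (top_of_set X) (top_of_set Y) \<rho> \<sigma>"
    using assms(1-5) by (auto simp: retraction_maps_def continuous_map_subtopology_eu)
qed

lemma scaleR_vec_conv: "c *\<^sub>R v = of_real c *s v" for v :: "'f::real_normed_field ^ 'm"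
proof -
  have "(c *\<^sub>R v) $ i = (of_real c *s v) $ i" for i
    unfolding vector_scaleR_component vector_smult_component by (rule scaleR_conv_of_real)
  then show ?thesis unfolding vec_eq_iff by blast
qed

lemma omega_scaleR [simp]:
  "omega (c *\<^sub>R v) w = of_real c * omega v w"
  "omega v (c *\<^sub>R w) = of_real c * omega v w"
  for v w :: "'f::real_normed_field ^ ('n::finite + 'n)"
  by (simp_all add: scaleR_vec_conv omega.bilinear)

subsection \<open>Restoring the symplectic relations\<close>

definition isotropize ::
    "nat \<Rightarrow> (nat \<Rightarrow> 'f::real_normed_field ^ ('n::finite + 'n)) \<Rightarrow> (nat \<Rightarrow> 'f ^ ('n + 'n)) \<Rightarrow> nat \<Rightarrow> 'f ^ ('n + 'n)"
  where "isotropize r e f j = f j + (\<Sum>i<r. (omega (f i) (f j) / 2) *s e i)"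

text \<open>The corrections lie in the isotropic span of e, so the pairings with e do not change. In
  the pairing of two corrected vectors each correction removes half of omega (f i) (f j), which
  explains the factor 1/2, and the corrections do not pair with each other.\<close>

lemma isotropize_frames:
  assumes "\<And>i j. i < r \<Longrightarrow> j < r \<Longrightarrow> omega (e i) (e j) = 0"
    and "\<And>i j. i < r \<Longrightarrow> j < r \<Longrightarrow> omega (e i) (f j) = (if i = j then 1 else 0)"
    and "\<And>i. i \<ge> r \<Longrightarrow> e i = 0 \<and> f i = 0"
  shows "(e, isotropize r e f) \<in> frames r"
proof -
  have ef: "omega (e i) (isotropize r e f j) = (if i = j then 1 else 0)" if "i < r" "j < r" for i j
    using assms that by (simp add: isotropize_def omega.bilinear)
  have fe: "omega (f i) (e j) = (if j = i then - 1 else 0)" if "i < r" "j < r" for i j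
    using assms(2)[OF that(2,1)] omega.skew[of "f i" "e j"] by simp
  have "omega (isotropize r e f i) (isotropize r e f j) = 0" if "i < r" "j < r" for i j
  proof -
    let ?y = "isotropize r e f j"
    have "omega (isotropize r e f i) ?y = omega (f i) ?y + (\<Sum>a<r. omega (f a) (f i) / 2 * omega (e a) ?y)"
      by (subst isotropize_def) (simp add: omega.add_left omega.sum_left omega.scale_left)
    also have "(\<Sum>a<r. omega (f a) (f i) / 2 * omega (e a) ?y) =
        (\<Sum>a<r. if a = j then omega (f a) (f i) / 2 else 0)"
      using ef that by (intro sum.cong) auto
    also have "omega (f i) ?y = omega (f i) (f j) + (\<Sum>a<r. omega (f a) (f j) / 2 * omega (f i) (e a))"
      by (simp add: isotropize_def omega.bilinear)
    also have "(\<Sum>a<r. omega (f a) (f j) / 2 * omega (f i) (e a)) =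
        (\<Sum>a<r. if a = i then - omega (f a) (f j) / 2 else 0)"
      using fe that by (intro sum.cong) auto
    finally have "omega (isotropize r e f i) ?y =
        omega (f i) (f j) - omega (f i) (f j) / 2 + omega (f j) (f i) / 2"
      using that by simp
    also have "\<dots> = 0" using omega.skew[of "f i" "f j"] by simp
    finally show ?thesis .
  qed
  moreover have "isotropize r e f i = 0" if "i \<ge> r" for i
    using assms(3)[OF that] by (simp add: isotropize_def)
  ultimately show ?thesis
    using assms(1,3) ef by (simp add: frames_def hyperbolic_def)
qed

lemma isotropize_id:
  assumes "\<And>i j. i < r \<Longrightarrow> j < r \<Longrightarrow> omega (f i) (f j) = 0" "\<And>i. i \<ge> r \<Longrightarrow> f i = 0"
  shows "isotropize r e f = f"
proof
  show "isotropize r e f j = f j" for j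
    using assms by (cases "j < r") (auto simp: isotropize_def)
qed

lemma continuous_on_isotropize [continuous_intros]:
  assumes "\<And>j. continuous_on S (\<lambda>x. e x j)" "\<And>j. continuous_on S (\<lambda>x. f x j)"
  shows "continuous_on S (\<lambda>x. isotropize r (e x) (f x) j)"
  unfolding isotropize_def by (intro continuous_intros assms) simp_all

text \<open>Back substitution for a triangular pairing matrix: the vectors with larger index are
  already dual to e and clear the entries omega (e m) (f j) with m > j, and the division normalizes
  the diagonal. The recursion involves only continuous operations as long as the diagonal does not
  vanish.\<close>

function dual_frame ::
    "nat \<Rightarrow> (nat \<Rightarrow> 'f::real_normed_field ^ ('n::finite + 'n)) \<Rightarrow> (nat \<Rightarrow> 'f ^ ('n + 'n)) \<Rightarrow> nat \<Rightarrow> 'f ^ ('n + 'n)"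
  where "dual_frame r e f j = (if j < r
    then inverse (omega (e j) (f j)) *s (f j - (\<Sum>m\<in>{j<..<r}. omega (e m) (f j) *s dual_frame r e f m))
    else 0)"
  by pat_completeness auto
termination by (relation "Wellfounded.measure (\<lambda>(r, e, f, j). r - j)") auto

declare dual_frame.simps [simp del]

lemma dual_frame_dual:
  assumes tri: "\<And>i j. i < j \<Longrightarrow> j < r \<Longrightarrow> omega (e i) (f j) = 0"
    and diag: "\<And>j. j < r \<Longrightarrow> omega (e j) (f j) \<noteq> 0"
    and "i < r" "j < r"
  shows "omega (e i) (dual_frame r e f j) = (if i = j then 1 else 0)"
  using \<open>j < r\<close>
proof (induction "r - j" arbitrary: j rule: less_induct)
  case less
  have IH: "omega (e i) (dual_frame r e f m) = (if i = m then 1 else 0)" if "m \<in> {j<..<r}" for m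
    using less.hyps[of m] less.prems that by auto
  have "(\<Sum>m\<in>{j<..<r}. omega (e m) (f j) * omega (e i) (dual_frame r e f m)) =
      (\<Sum>m\<in>{j<..<r}. if i = m then omega (e m) (f j) else 0)"
    using IH by (intro sum.cong) auto
  also have "\<dots> = (if j < i then omega (e i) (f j) else 0)"
    using \<open>i < r\<close> by auto
  finally have "omega (e i) (dual_frame r e f j) =
      inverse (omega (e j) (f j)) * (omega (e i) (f j) - (if j < i then omega (e i) (f j) else 0))"
    using less.prems by (subst dual_frame.simps) (simp add: omega.bilinear)
  then show ?case
    using tri[of i j] diag[of j] less.prems by (cases i j rule: linorder_cases) auto
qed

lemma dual_frame_id:
  assumes "\<And>i j. i < r \<Longrightarrow> j < r \<Longrightarrow> omega (e i) (f j) = (if i = j then 1 else 0)"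
    and "\<And>i. i \<ge> r \<Longrightarrow> f i = 0"
  shows "dual_frame r e f = f"
proof
  show "dual_frame r e f j = f j" for j
    using assms by (subst dual_frame.simps) auto
qed

lemma dual_frame_zero: "j \<ge> r \<Longrightarrow> dual_frame r e f j = 0"
  by (simp add: dual_frame.simps)

lemma continuous_on_dual_frame:
  assumes "\<And>j. continuous_on S (\<lambda>x. e x j)" "\<And>j. continuous_on S (\<lambda>x. f x j)"
    and "\<And>x j. x \<in> S \<Longrightarrow> j < r \<Longrightarrow> omega (e x j) (f x j) \<noteq> 0"
  shows "continuous_on S (\<lambda>x. dual_frame r (e x) (f x) j)"
proof (induction "r - j" arbitrary: j rule: less_induct)
  case less
  show ?case
  proof (cases "j < r")
    case True
    then have "continuous_on S (\<lambda>x. dual_frame r (e x) (f x) m)" if "m \<in> {j<..<r}" for m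
      using that by (intro less) auto
    then show ?thesis
      using True assms(3) by (subst dual_frame.simps) (auto intro!: continuous_intros assms(1,2))
  qed (simp add: dual_frame_zero)
qed

subsection \<open>Orthonormalization\<close>

text \<open>The identity on the reals and conjugation on the complex numbers. \<open>cj_norm\<close>
  ties the hermitian form to the Euclidean norm.\<close>

locale conj_field =
  fixes cj :: "'f::real_normed_field \<Rightarrow> 'f"
  assumes cj_add: "cj (x + y) = cj x + cj y"
    and cj_mult: "cj (x * y) = cj x * cj y"
    and cj_cj: "cj (cj x) = x"
    and cj_norm: "x * cj x = of_real ((norm x)\<^sup>2)"
    and continuous_cj: "continuous_on UNIV cj"
begin

lemma cj_zero [simp]: "cj 0 = 0"
  using cj_add[of 0 0] by simp

lemma cj_one [simp]: "cj 1 = 1"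
  using cj_norm[of 1] by simp

lemma cj_minus: "cj (- x) = - cj x"
  using cj_add[of "- x" x] by (simp add: eq_neg_iff_add_eq_0)

lemma cj_diff: "cj (x - y) = cj x - cj y"
  using cj_add[of x "- y"] by (simp add: cj_minus)

lemma cj_sum: "cj (\<Sum>i\<in>I. g i) = (\<Sum>i\<in>I. cj (g i))"
  by (induction I rule: infinite_finite_induct) (simp_all add: cj_add)

lemma continuous_on_cj [continuous_intros]: "continuous_on S g \<Longrightarrow> continuous_on S (\<lambda>x. cj (g x))"
  using continuous_on_compose2[OF continuous_cj, of S g] by simp

definition herm :: "'f ^ ('n::finite + 'n) \<Rightarrow> 'f ^ ('n + 'n) \<Rightarrow> 'f" where
  "herm v w = (\<Sum>s\<in>UNIV. v $ s * cj (w $ s))"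

text \<open>Writing (a, b) as a + b j with j a = cj a j and j^2 = -1, this is left multiplication by
  j. It turns \<open>omega\<close> into the hermitian form, so J u is dual to an orthonormal u, and
  isotropic if u is.\<close>

definition J :: "'f ^ ('n::finite + 'n) \<Rightarrow> 'f ^ ('n + 'n)" where
  "J v = (\<chi> s. case s of Inl i \<Rightarrow> - cj (v $ Inr i) | Inr i \<Rightarrow> cj (v $ Inl i))"

lemma sum_UNIV_sum:
  "(\<Sum>s\<in>UNIV. g s) = (\<Sum>i\<in>UNIV. g (Inl i)) + (\<Sum>i\<in>UNIV. g (Inr i))"
  for g :: "'n::finite + 'm::finite \<Rightarrow> 'f"
  using sum.Plus[of "UNIV :: 'n set" "UNIV :: 'm set" g] by (simp add: o_def UNIV_Plus_UNIV)

lemma omega_J: "omega v (J w) = herm v w"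
  by (simp add: omega_def J_def herm_def sum_UNIV_sum sum.distrib algebra_simps)

lemma omega_J_J: "omega (J v) (J w) = cj (omega v w)"
  by (simp add: omega_def J_def cj_sum cj_diff cj_mult algebra_simps)

lemma J_zero [simp]: "J 0 = 0"
proof -
  have "J 0 $ s = 0" for s :: "'a + 'a" by (cases s) (simp_all add: J_def)
  then show ?thesis by (simp add: vec_eq_iff)
qed

lemma herm_J: "herm (J v) w = cj (omega v w)"
  by (simp add: omega_J_J flip: omega_J)

lemma herm_cj: "herm w v = cj (herm v w)"
  by (simp add: herm_def cj_sum cj_mult cj_cj mult.commute)

lemma herm_diff: "herm (u - v) w = herm u w - herm v w"
  and herm_scale: "herm (c *s v) w = c * herm v w"
  and herm_zero [simp]: "herm 0 w = 0"
  by (simp_all add: omega.bilinear flip: omega_J)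

lemma herm_scaleR: "herm (t *\<^sub>R v) w = of_real t * herm v w"
  by (simp add: scaleR_vec_conv herm_scale)

lemma herm_sum: "herm (\<Sum>i\<in>I. g i) w = (\<Sum>i\<in>I. herm (g i) w)"
  by (simp add: omega.bilinear flip: omega_J)

lemma herm_self: "herm v v = of_real ((norm v)\<^sup>2)"
  by (simp add: herm_def cj_norm norm_vec_def L2_set_def sum_nonneg)

lemma continuous_on_herm [continuous_intros]:
  assumes "continuous_on S v" "continuous_on S w"
  shows "continuous_on S (\<lambda>x. herm (v x) (w x))"
  unfolding herm_def using assms by (intro continuous_intros)

lemma continuous_on_J [continuous_intros]:
  assumes "continuous_on S v"
  shows "continuous_on S (\<lambda>x. J (v x))"
  unfolding J_def
proof (intro continuous_on_vec_lambda)
  fix s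
  show "continuous_on S (\<lambda>x. case s of Inl i \<Rightarrow> - cj (v x $ Inr i) | Inr i \<Rightarrow> cj (v x $ Inl i))"
    using assms by (cases s) (auto intro!: continuous_intros)
qed

text \<open>Normalization by \<open>sgn\<close> sends zero to zero, so the recursion makes sense for
  dependent families and respects the zero padding of frames.\<close>

function gram_schmidt :: "(nat \<Rightarrow> 'f ^ ('n::finite + 'n)) \<Rightarrow> nat \<Rightarrow> 'f ^ ('n + 'n)" where
  "gram_schmidt e j =
    sgn (e j - (\<Sum>i<j. herm (e j) (gram_schmidt e i) *s gram_schmidt e i))"
  by pat_completeness auto
termination by (relation "Wellfounded.measure snd") auto

declare gram_schmidt.simps [simp del]

definition residual :: "(nat \<Rightarrow> 'f ^ ('n::finite + 'n)) \<Rightarrow> nat \<Rightarrow> 'f ^ ('n + 'n)" where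
  "residual e j = e j - (\<Sum>i<j. herm (e j) (gram_schmidt e i) *s gram_schmidt e i)"

lemma gram_schmidt_residual: "gram_schmidt e j = inverse (norm (residual e j)) *\<^sub>R residual e j"
  by (simp add: gram_schmidt.simps[of e j] residual_def sgn_div_norm)

text \<open>The vector \<open>gram_schmidt e j\<close> lies in the span of e 0, ..., e j, so a
  functional that kills these kills it too.\<close>

lemma gram_schmidt_annihilated:
  assumes "\<And>i. i \<le> j \<Longrightarrow> omega (e i) y = 0"
  shows "omega (gram_schmidt e j) y = 0"
  using assms
proof (induction j rule: less_induct)
  case (less j)
  then have "omega (gram_schmidt e i) y = 0" if "i < j" for i
    using that by auto
  then show ?case
    using less.prems[of j] by (simp add: gram_schmidt_residual[of e j] residual_def omega.bilinear)
qed

lemma gram_schmidt_zero: "e j = 0 \<Longrightarrow> gram_schmidt e j = 0"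
  by (simp add: gram_schmidt_residual[of e j] residual_def)

lemma continuous_on_gram_schmidt:
  assumes "\<And>j. continuous_on S (\<lambda>x. e x j)"
    and "\<And>x i. x \<in> S \<Longrightarrow> i \<le> j \<Longrightarrow> residual (e x) i \<noteq> 0"
  shows "continuous_on S (\<lambda>x. gram_schmidt (e x) j)"
  using assms(2)
proof (induction j rule: less_induct)
  case (less j)
  then have "continuous_on S (\<lambda>x. gram_schmidt (e x) i)" if "i < j" for i
    using that by auto
  then have "continuous_on S (\<lambda>x. residual (e x) j)"
    unfolding residual_def by (intro continuous_intros assms(1)) auto
  then show ?case
    unfolding gram_schmidt_residual using less.prems by (auto intro!: continuous_intros)
qed

definition unitary :: "nat \<Rightarrow> (nat \<Rightarrow> 'f ^ ('n::finite + 'n)) \<Rightarrow> bool" where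
  "unitary r u \<longleftrightarrow> (\<forall>i<r. \<forall>j<r. herm (u i) (u j) = (if i = j then 1 else 0))"

lemma gram_schmidt_unitary:
  assumes "\<And>j. j < r \<Longrightarrow> residual e j \<noteq> 0"
  shows "unitary r (gram_schmidt e)"
proof -
  have diag: "herm (gram_schmidt e j) (gram_schmidt e j) = 1" if "j < r" for j
    unfolding herm_self using assms[OF that] by (simp add: gram_schmidt_residual)
  have off: "\<forall>i<j. herm (gram_schmidt e j) (gram_schmidt e i) = 0" if "j < r" for j
    using that
  proof (induction j rule: less_induct)
    case (less j)
    have IH: "herm (gram_schmidt e l) (gram_schmidt e i) = (if l = i then 1 else 0)"
      if "l < j" "i < j" for l i
    proof (cases l i rule: linorder_cases)
      case less': less
      then show ?thesis
        using less.IH[of i] less.prems that herm_cj[of "gram_schmidt e l" "gram_schmidt e i"] by simp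
    next
      case greater
      then show ?thesis using less.IH[of l] less.prems that by simp
    qed (use that less.prems diag in simp)
    show ?case
    proof (intro allI impI)
      fix i assume i: "i < j"
      have "(\<Sum>l<j. herm (e j) (gram_schmidt e l) * herm (gram_schmidt e l) (gram_schmidt e i)) =
          (\<Sum>l<j. if l = i then herm (e j) (gram_schmidt e l) else 0)"
        using IH i by (intro sum.cong) auto
      then have "herm (residual e j) (gram_schmidt e i) = 0"
        using i by (simp add: residual_def herm_diff herm_sum herm_scale)
      then show "herm (gram_schmidt e j) (gram_schmidt e i) = 0"
        by (simp add: gram_schmidt_residual[of e j] herm_scaleR)
    qed
  qed
  show ?thesis
    unfolding unitary_def
  proof (intro allI impI)
    fix i j assume "i < r" "j < r"
    then show "herm (gram_schmidt e i) (gram_schmidt e j) = (if i = j then 1 else 0)"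
      using off[of i] off[of j] diag herm_cj[of "gram_schmidt e i" "gram_schmidt e j"]
      by (cases i j rule: linorder_cases) auto
  qed
qed

lemma gram_schmidt_id:
  assumes "unitary r u" "j < r"
  shows "gram_schmidt u j = u j"
  using \<open>j < r\<close>
proof (induction j rule: less_induct)
  case (less j)
  then have "residual u j = u j - (\<Sum>i<j. herm (u j) (u i) *s u i)"
    unfolding residual_def by (intro arg_cong2[where f = "(-)"] sum.cong) auto
  also have "\<dots> = u j"
    using assms(1) less.prems by (simp add: unitary_def)
  finally have "residual u j = u j" .
  moreover have "norm (u j) = 1"
  proof -
    have "herm (u j) (u j) = 1"
      using assms(1) less.prems by (simp add: unitary_def)
    then have "of_real ((norm (u j))\<^sup>2) = (1 :: 'f)" unfolding herm_self .
    then have "(norm (u j))\<^sup>2 = 1" unfolding of_real_eq_1_iff .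
    then show ?thesis by (smt (verit) norm_ge_zero power2_eq_1_iff)
  qed
  ultimately show ?case by (simp add: gram_schmidt_residual)
qed

text \<open>The family f witnesses the independence of e. Earlier orthonormalized vectors do not
  pair with f j, hence the residual still pairs to 1 with f j and cannot vanish; after normalization
  the diagonal pairing is the positive number 1 / norm (residual e j).\<close>

lemma frames_gram_schmidt:
  assumes "(e, f) \<in> frames r"
  shows "i < j \<Longrightarrow> j < r \<Longrightarrow> omega (gram_schmidt e i) (f j) = 0"
    and "j < r \<Longrightarrow> residual e j \<noteq> 0"
    and "j < r \<Longrightarrow> omega (gram_schmidt e j) (f j) = of_real (inverse (norm (residual e j)))"
    and "i < r \<Longrightarrow> j < r \<Longrightarrow> omega (gram_schmidt e i) (e j) = 0"
    and "i < r \<Longrightarrow> j < r \<Longrightarrow> omega (gram_schmidt e i) (gram_schmidt e j) = 0"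
proof -
  have hyp: "hyperbolic omega r e f" using assms by (simp add: frames_def)
  show zero: "omega (gram_schmidt e i) (f j) = 0" if "i < j" "j < r" for i j
    using that hyperbolicD(3)[OF hyp, of _ j] by (intro gram_schmidt_annihilated) auto
  have one: "omega (residual e j) (f j) = 1" if "j < r" for j
    using that zero hyperbolicD(3)[OF hyp, of j j] by (simp add: residual_def omega.bilinear)
  show "residual e j \<noteq> 0" if "j < r"
    using one[OF that] by auto
  show "omega (gram_schmidt e j) (f j) = of_real (inverse (norm (residual e j)))" if "j < r"
    by (simp add: gram_schmidt_residual one[OF that])
  show e: "omega (gram_schmidt e i) (e j) = 0" if "i < r" "j < r" for i j
    using that hyperbolicD(1)[OF hyp, of _ j] by (intro gram_schmidt_annihilated) auto
  show "omega (gram_schmidt e i) (gram_schmidt e j) = 0" if "i < r" "j < r"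
  proof -
    have "omega (gram_schmidt e j) (gram_schmidt e i) = 0"
      using that e omega.skew[of _ "gram_schmidt e i"] by (intro gram_schmidt_annihilated) auto
    then show ?thesis using omega.skew[of "gram_schmidt e i"] by simp
  qed
qed

section \<open>Deformation in two stages: first e becomes orthonormal, then f becomes J e\<close>

definition half_unitary_frames :: "nat \<Rightarrow> ('f, 'n::finite) frame set" where
  "half_unitary_frames r = {(u, f) \<in> frames r. unitary r u}"

definition unitary_frames :: "nat \<Rightarrow> (nat \<Rightarrow> 'f ^ ('n::finite + 'n)) set" where
  "unitary_frames r = {u. unitary r u \<and> (\<forall>i<r. \<forall>j<r. omega (u i) (u j) = 0) \<and> (\<forall>i\<ge>r. u i = 0)}"

definition gs_homotopy :: "real \<times> (nat \<Rightarrow> 'f ^ ('n::finite + 'n)) \<Rightarrow> nat \<Rightarrow> 'f ^ ('n + 'n)" where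
  "gs_homotopy = (\<lambda>(t, e) j. (1 - t) *\<^sub>R e j + t *\<^sub>R gram_schmidt e j)"

definition frame_homotopy :: "nat \<Rightarrow> real \<times> ('f, 'n::finite) frame \<Rightarrow> ('f, 'n) frame" where
  "frame_homotopy r = (\<lambda>(t, e, f). (gs_homotopy (t, e),
     isotropize r (gs_homotopy (t, e)) (dual_frame r (gs_homotopy (t, e)) f)))"

text \<open>Both ends of the segment pair triangularly with f and have positive diagonal, 1 at one
  end and 1 / norm (residual e j) at the other. Convex combinations keep the diagonal positive, so
  \<open>dual_frame\<close> applies at every time.\<close>

lemma gs_homotopy_pairing:
  assumes "(e, f) \<in> frames r" "t \<in> {0..1}"
  shows "i < j \<Longrightarrow> j < r \<Longrightarrow> omega (gs_homotopy (t, e) i) (f j) = 0"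
    and "j < r \<Longrightarrow> omega (gs_homotopy (t, e) j) (f j) \<noteq> 0"
    and "i < r \<Longrightarrow> j < r \<Longrightarrow> omega (gs_homotopy (t, e) i) (gs_homotopy (t, e) j) = 0"
    and "j \<ge> r \<Longrightarrow> gs_homotopy (t, e) j = 0"
proof -
  note gs = frames_gram_schmidt[OF assms(1)]
  have hyp: "hyperbolic omega r e f" using assms by (simp add: frames_def)
  show "omega (gs_homotopy (t, e) i) (f j) = 0" if "i < j" "j < r"
    using that gs(1)[OF that] hyperbolicD(3)[OF hyp, of i j] by (simp add: gs_homotopy_def omega.bilinear)
  show "omega (gs_homotopy (t, e) j) (f j) \<noteq> 0" if "j < r"
  proof -
    define s where "s = inverse (norm (residual e j))"
    have "s > 0" using gs(2)[OF that] by (simp add: s_def)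
    then have "(1 - t) + t * s > 0"
      using assms(2) by (cases "t = 0") (auto intro!: add_nonneg_pos)
    moreover have "omega (gs_homotopy (t, e) j) (f j) = of_real ((1 - t) + t * s)"
      using gs(3)[OF that] hyperbolicD(3)[OF hyp that that]
      by (simp add: gs_homotopy_def omega.bilinear s_def)
    ultimately show ?thesis by (metis less_irrefl of_real_eq_0_iff)
  qed
  show "omega (gs_homotopy (t, e) i) (gs_homotopy (t, e) j) = 0" if "i < r" "j < r"
    using gs(4)[OF that] gs(4)[OF that(2,1)] gs(5)[OF that] hyperbolicD(1)[OF hyp that]
      omega.skew[of "e i" "gram_schmidt e j"]
    by (simp add: gs_homotopy_def omega.bilinear)
  show "gs_homotopy (t, e) j = 0" if "j \<ge> r"
    using assms(1) that by (simp add: gs_homotopy_def frames_def gram_schmidt_zero)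
qed

lemma frame_homotopy_frames:
  assumes "x \<in> frames r" "t \<in> {0..1}"
  shows "frame_homotopy r (t, x) \<in> frames r"
proof -
  obtain e f where x: "x = (e, f)" by fastforce
  note * = gs_homotopy_pairing[OF assms(1)[unfolded x] assms(2)]
  show ?thesis
    unfolding frame_homotopy_def x prod.case
    by (intro isotropize_frames dual_frame_dual) (use * dual_frame_zero in auto)
qed

lemma frame_homotopy_0:
  assumes "x \<in> frames r"
  shows "frame_homotopy r (0, x) = x"
proof -
  obtain e f where x: "x = (e, f)" by fastforce
  have "gs_homotopy (0, e) = e" by (simp add: gs_homotopy_def)
  moreover have "dual_frame r e f = f" "isotropize r e f = f"
    using assms by (auto simp: x frames_def hyperbolic_def intro!: dual_frame_id isotropize_id)
  ultimately show ?thesis by (simp add: frame_homotopy_def x)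
qed

lemma frame_homotopy_1:
  assumes "x \<in> frames r"
  shows "frame_homotopy r (1, x) \<in> half_unitary_frames r"
proof -
  have "unitary r (gram_schmidt (fst x))"
    using frames_gram_schmidt(2)[of "fst x" "snd x" r] assms by (intro gram_schmidt_unitary) auto
  then show ?thesis
    using frame_homotopy_frames[OF assms, of 1]
    by (simp add: half_unitary_frames_def frame_homotopy_def gs_homotopy_def split: prod.splits)
qed

text \<open>Gram-Schmidt leaves an orthonormal family alone, and neither repair changes a family
  that already has the right pairings. Hence the end map is an exact retraction.\<close>

lemma frame_homotopy_fixed:
  assumes "x \<in> half_unitary_frames r"
  shows "frame_homotopy r (t, x) = x"
proof -
  obtain u f where x: "x = (u, f)" by fastforce
  have "gram_schmidt u j = u j" for j
    using assms gram_schmidt_id[of r u j]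
    by (cases "j < r") (auto simp: x half_unitary_frames_def frames_def gram_schmidt_zero)
  then have "gs_homotopy (t, u) = u" by (auto simp: gs_homotopy_def simp flip: scaleR_left_distrib)
  moreover have "dual_frame r u f = f" "isotropize r u f = f"
    using assms
    by (auto simp: x half_unitary_frames_def frames_def hyperbolic_def intro!: dual_frame_id isotropize_id)
  ultimately show ?thesis by (simp add: frame_homotopy_def x)
qed

lemma continuous_on_gs_homotopy:
  fixes S :: "(real \<times> ('f, 'n::finite) frame) set"
  assumes "S \<subseteq> {0..1} \<times> frames r"
  shows "continuous_on S (\<lambda>x. gs_homotopy (fst x, fst (snd x)) j)"
proof (cases "j < r")
  case True
  have "residual (fst (snd x)) i \<noteq> 0" if "x \<in> S" "i \<le> j" for x i
    using frames_gram_schmidt(2)[of "fst (snd x)" "snd (snd x)" r i] that assms True by auto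
  then have "continuous_on S (\<lambda>x. gram_schmidt (fst (snd x)) j)"
    by (intro continuous_on_gram_schmidt)
      (auto intro!: continuous_on_product_then_coordinatewise continuous_on_fst continuous_on_snd continuous_on_id)
  moreover have "continuous_on S (\<lambda>x. fst (snd x) j)"
    by (auto intro!: continuous_on_product_then_coordinatewise continuous_on_fst continuous_on_snd continuous_on_id)
  ultimately show ?thesis
    unfolding gs_homotopy_def prod.case by (intro continuous_intros)
next
  case False
  \<comment> \<open>From index r on the residuals are zero and normalization is not continuous
    there; continuity holds because the vectors are constantly zero.\<close>
  have "gs_homotopy (fst x, fst (snd x)) j = 0" if "x \<in> S" for x
    using gs_homotopy_pairing(4)[of "fst (snd x)" "snd (snd x)" r "fst x" j] that assms False by auto
  then have "continuous_on S (\<lambda>x. gs_homotopy (fst x, fst (snd x)) j) \<longleftrightarrow> continuous_on S (\<lambda>x. 0 :: 'f ^ ('n + 'n))"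
    by (intro continuous_on_cong) auto
  then show ?thesis by simp
qed

lemma continuous_on_frame_homotopy:
  "continuous_on ({0..1} \<times> frames r) (frame_homotopy r :: real \<times> ('f, 'n::finite) frame \<Rightarrow> _)"
proof -
  let ?S = "{0..1} \<times> frames r :: (real \<times> ('f, 'n) frame) set"
  have f: "continuous_on ?S (\<lambda>x. snd (snd x) j)" for j
    by (auto intro!: continuous_on_product_then_coordinatewise continuous_on_fst continuous_on_snd continuous_on_id)
  have gs: "continuous_on ?S (\<lambda>x. gs_homotopy (fst x, fst (snd x)) j)" for j
    by (rule continuous_on_gs_homotopy[of _ r]) simp
  have "continuous_on ?S (\<lambda>x. dual_frame r (gs_homotopy (fst x, fst (snd x))) (snd (snd x)) j)" for j
    by (rule continuous_on_dual_frame[OF gs f]) (use gs_homotopy_pairing(2) in fastforce)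
  then have "continuous_on ?S (\<lambda>x. (gs_homotopy (fst x, fst (snd x)),
      isotropize r (gs_homotopy (fst x, fst (snd x)))
        (dual_frame r (gs_homotopy (fst x, fst (snd x))) (snd (snd x)))))"
    by (intro continuous_intros gs)
  then show ?thesis by (simp add: frame_homotopy_def case_prod_unfold)
qed

lemma frames_homotopy_equivalent_half_unitary:
  "top_of_set (frames r :: ('f, 'n::finite) frame set) homotopy_equivalent_space
    top_of_set (half_unitary_frames r :: ('f, 'n) frame set)"
proof (rule homotopy_equivalent_retractI[where \<rho> = "\<lambda>x :: ('f, 'n) frame. frame_homotopy r (1, x)" and \<sigma> = "\<lambda>x. x"
      and H = "frame_homotopy r"])
  show "continuous_on (frames r) (\<lambda>x :: ('f, 'n) frame. frame_homotopy r (1, x))"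
    by (rule continuous_on_compose2[OF continuous_on_frame_homotopy]) (auto intro!: continuous_intros)
  show "(\<lambda>x :: ('f, 'n) frame. frame_homotopy r (1, x)) ` frames r \<subseteq> half_unitary_frames r"
    using frame_homotopy_1 by blast
  show "(\<lambda>x. x) ` half_unitary_frames r \<subseteq> (frames r :: ('f, 'n) frame set)"
    by (auto simp: half_unitary_frames_def)
qed (simp_all add: frame_homotopy_0 frame_homotopy_frames frame_homotopy_fixed continuous_on_frame_homotopy
    continuous_on_id)

lemma unitary_frames_section:
  assumes "u \<in> unitary_frames r"
  shows "(u, J \<circ> u) \<in> half_unitary_frames r"
  using assms
  by (auto simp: unitary_frames_def half_unitary_frames_def frames_def hyperbolic_def unitary_def
      omega_J herm_J)

text \<open>The families dual to a fixed u form a convex set containing f and J u, so along the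
  segment between them only isotropy has to be restored.\<close>

lemma half_unitary_homotopy_equivalent_unitary:
  "top_of_set (half_unitary_frames r :: ('f, 'n::finite) frame set) homotopy_equivalent_space
    top_of_set (unitary_frames r :: (nat \<Rightarrow> 'f ^ ('n + 'n)) set)"
proof (rule homotopy_equivalent_retractI[where \<rho> = fst and
      \<sigma> = "\<lambda>u :: nat \<Rightarrow> 'f ^ ('n + 'n). (u, J \<circ> u)" and
      H = "\<lambda>(t, u, f). (u, isotropize r u (\<lambda>j. (1 - t) *\<^sub>R f j + t *\<^sub>R J (u j)))"])
  let ?S = "{0..1} \<times> half_unitary_frames r :: (real \<times> ('f, 'n) frame) set"
  have *: "continuous_on ?S (\<lambda>x. fst (snd x) j)" "continuous_on ?S (\<lambda>x. snd (snd x) j)" for j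
    by (auto intro!: continuous_on_product_then_coordinatewise continuous_on_fst continuous_on_snd continuous_on_id)
  have "continuous_on ?S (\<lambda>x. (fst (snd x),
      isotropize r (fst (snd x)) (\<lambda>j. (1 - fst x) *\<^sub>R snd (snd x) j + fst x *\<^sub>R J (fst (snd x) j))))"
    by (intro continuous_intros *)
  then show "continuous_on ?S (\<lambda>(t, u, f). (u, isotropize r u (\<lambda>j. (1 - t) *\<^sub>R f j + t *\<^sub>R J (u j))))"
    by (simp add: case_prod_unfold)
next
  fix t :: real and x :: "('f, 'n) frame"
  assume x: "x \<in> half_unitary_frames r" and t: "t \<in> {0..1}"
  obtain u f where uf: "x = (u, f)" by fastforce
  have "(u, isotropize r u (\<lambda>j. (1 - t) *\<^sub>R f j + t *\<^sub>R J (u j))) \<in> frames r"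
    using x by (intro isotropize_frames)
      (auto simp: uf half_unitary_frames_def frames_def hyperbolic_def unitary_def omega.bilinear omega_J
        simp flip: of_real_add)
  then show "(case (t, x) of (t, u, f) \<Rightarrow> (u, isotropize r u (\<lambda>j. (1 - t) *\<^sub>R f j + t *\<^sub>R J (u j))))
      \<in> half_unitary_frames r"
    using x by (simp add: uf half_unitary_frames_def)
next
  fix x :: "('f, 'n) frame"
  assume x: "x \<in> half_unitary_frames r"
  obtain u f where uf: "x = (u, f)" by fastforce
  have "isotropize r u f = f"
    using x by (auto simp: uf half_unitary_frames_def frames_def hyperbolic_def intro!: isotropize_id)
  then show "(case (0, x) of (t, u, f) \<Rightarrow> (u, isotropize r u (\<lambda>j. (1 - t) *\<^sub>R f j + t *\<^sub>R J (u j)))) = x"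
    by (simp add: uf)
  have "isotropize r u (\<lambda>j. J (u j)) = (\<lambda>j. J (u j))"
    using x by (intro isotropize_id)
      (auto simp: uf half_unitary_frames_def frames_def hyperbolic_def omega_J_J unitary_frames_def)
  then show "(case (1, x) of (t, u, f) \<Rightarrow> (u, isotropize r u (\<lambda>j. (1 - t) *\<^sub>R f j + t *\<^sub>R J (u j)))) =
      (fst x, J \<circ> fst x)"
    by (simp add: uf o_def)
next
  show "continuous_on (unitary_frames r) (\<lambda>u :: nat \<Rightarrow> 'f ^ ('n + 'n). (u, J \<circ> u))"
    unfolding o_def
    by (intro continuous_intros continuous_on_product_then_coordinatewise[OF continuous_on_id])
  show "fst ` half_unitary_frames r \<subseteq> (unitary_frames r :: (nat \<Rightarrow> 'f ^ ('n + 'n)) set)"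
  proof clarify
    fix u f :: "nat \<Rightarrow> 'f ^ ('n + 'n)"
    assume "(u, f) \<in> half_unitary_frames r"
    then have "hyperbolic omega r u f" "unitary r u" "\<forall>i\<ge>r. u i = 0"
      by (simp_all add: half_unitary_frames_def frames_def)
    then show "fst (u, f) \<in> unitary_frames r"
      using hyperbolicD(1)[of omega r u f] by (simp add: unitary_frames_def)
  qed
qed (auto simp: unitary_frames_section continuous_on_fst continuous_on_id)

lemma frames_homotopy_equivalent_unitary:
  "top_of_set (frames r :: ('f, 'n::finite) frame set) homotopy_equivalent_space
    top_of_set (unitary_frames r :: (nat \<Rightarrow> 'f ^ ('n + 'n)) set)"
  using frames_homotopy_equivalent_half_unitary half_unitary_homotopy_equivalent_unitary
  by (rule homotopy_eqv_trans)

end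

subsection \<open>Stiefel manifolds over the doubled algebra\<close>

text \<open>\<open>mk a b\<close> stands for a + b j with j a = cj a j and j^2 = -1. The law
  \<open>mk_times\<close> is the resulting formula for x times the conjugate of y, the only product
  that the hermitian form involves.\<close>

locale hermitian_double = conj_field cj
  for cj :: "'f::real_normed_field \<Rightarrow> 'f" +
  fixes dcj :: "'d::{ring_1, topological_space} \<Rightarrow> 'd" and mk :: "'f \<Rightarrow> 'f \<Rightarrow> 'd" and p1 p2 :: "'d \<Rightarrow> 'f"
  assumes p1_mk [simp]: "p1 (mk a b) = a" and p2_mk [simp]: "p2 (mk a b) = b"
    and mk_p [simp]: "mk (p1 d) (p2 d) = d"
    and mk_add: "mk (a + a') (b + b') = mk a b + mk a' b'"
    and mk_one: "mk 1 0 = 1"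
    and mk_times: "mk a b * dcj (mk a' b') = mk (a * cj a' + b * cj b') (b * a' - a * b')"
    and continuous_p1: "continuous_on UNIV p1" and continuous_p2: "continuous_on UNIV p2"
    and continuous_mk: "continuous_on UNIV (\<lambda>(a, b). mk a b)"
begin

lemma mk_zero: "mk 0 0 = 0"
  using mk_add[of 0 0 0 0] by simp

lemma mk_sum: "(\<Sum>i\<in>I. mk (g i) (h i)) = mk (\<Sum>i\<in>I. g i) (\<Sum>i\<in>I. h i)"
  by (induction I rule: infinite_finite_induct) (simp_all add: mk_zero mk_add)

lemma mk_eq_iff: "mk a b = mk a' b' \<longleftrightarrow> a = a' \<and> b = b'"
  by (metis p1_mk p2_mk)

definition merge_vec :: "'f ^ ('n::finite + 'n) \<Rightarrow> 'd ^ 'n" where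
  "merge_vec v = (\<chi> a. mk (v $ Inl a) (v $ Inr a))"

definition split_vec :: "'d ^ 'n::finite \<Rightarrow> 'f ^ ('n + 'n)" where
  "split_vec v = (\<chi> s. case s of Inl a \<Rightarrow> p1 (v $ a) | Inr a \<Rightarrow> p2 (v $ a))"

lemma merge_split [simp]: "merge_vec (split_vec v) = v"
  by (simp add: merge_vec_def split_vec_def vec_eq_iff)

lemma split_merge [simp]: "split_vec (merge_vec v) = v"
proof -
  have "split_vec (merge_vec v) $ s = v $ s" for s
    by (cases s) (simp_all add: merge_vec_def split_vec_def)
  then show ?thesis by (simp add: vec_eq_iff)
qed

lemma hermitian_merge: "hermitian dcj (merge_vec v) (merge_vec w) = mk (herm v w) (- omega v w)"
  by (simp add: hermitian_def merge_vec_def mk_times mk_sum herm_def sum_UNIV_sum omega_def mk_eq_iff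
      sum.distrib algebra_simps flip: sum_negf)

lemma hermitian_merge_delta:
  "hermitian dcj (merge_vec v) (merge_vec w) = (if P then 1 else 0) \<longleftrightarrow>
    herm v w = (if P then 1 else 0) \<and> omega v w = 0"
  by (simp add: hermitian_merge mk_eq_iff flip: mk_one mk_zero)

lemma continuous_merge: "continuous_on S (merge_vec :: 'f ^ ('n::finite + 'n) \<Rightarrow> 'd ^ 'n)"
proof -
  have "continuous_on S (\<lambda>v :: 'f ^ ('n + 'n). case (v $ Inl a, v $ Inr a) of (a, b) \<Rightarrow> mk a b)" for a
    by (rule continuous_on_compose2[OF continuous_mk]) (auto intro!: continuous_intros)
  then show ?thesis unfolding merge_vec_def by (intro continuous_on_vec_lambda) simp
qed

lemma continuous_split_vec: "continuous_on S (split_vec :: 'd ^ 'n::finite \<Rightarrow> 'f ^ ('n + 'n))"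
  unfolding split_vec_def
proof (intro continuous_on_vec_lambda)
  fix s :: "'n + 'n"
  show "continuous_on S (\<lambda>v :: 'd ^ 'n. case s of Inl a \<Rightarrow> p1 (v $ a) | Inr a \<Rightarrow> p2 (v $ a))"
    by (cases s) (auto intro!: continuous_on_compose2[OF continuous_p1]
      continuous_on_compose2[OF continuous_p2] continuous_intros)
qed

lemma unitary_frames_homeomorphic_stiefel:
  "top_of_set (unitary_frames r :: (nat \<Rightarrow> 'f ^ ('n::finite + 'n)) set) homeomorphic_space
    (stiefel dcj r :: (nat \<Rightarrow> 'd ^ 'n) topology)"
proof -
  \<comment> \<open>The two sides use different conventions outside the first r indices:
    \<open>stiefel\<close> consists of extensional functions, whereas unitary frames are padded by
    zero.\<close>
  define to_d :: "(nat \<Rightarrow> 'f ^ ('n + 'n)) \<Rightarrow> nat \<Rightarrow> 'd ^ 'n"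
    where "to_d u = (\<lambda>i\<in>{..<r}. merge_vec (u i))" for u
  define from_d :: "(nat \<Rightarrow> 'd ^ 'n) \<Rightarrow> nat \<Rightarrow> 'f ^ ('n + 'n)"
    where "from_d v = (\<lambda>i. if i < r then split_vec (v i) else 0)" for v
  have "continuous_map (top_of_set (unitary_frames r)) euclidean (\<lambda>u. merge_vec (u i))" for i
    unfolding continuous_map_iff_continuous
    by (rule continuous_on_compose2[OF continuous_merge])
      (auto intro!: continuous_on_product_then_coordinatewise continuous_on_id)
  then have "continuous_map (top_of_set (unitary_frames r)) (product_topology (\<lambda>i. euclidean) {..<r}) to_d"
    by (auto simp only: continuous_map_componentwise to_d_def restrict_extensional restrict_apply lessThan_iff if_True image_subset_iff)
  then have to_d: "continuous_map (top_of_set (unitary_frames r)) (stiefel dcj r) to_d"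
    unfolding stiefel_def
    by (rule continuous_map_into_subtopology)
      (auto simp: to_d_def hermitian_merge_delta unitary_frames_def unitary_def)
  have "continuous_map (stiefel dcj r) euclidean (\<lambda>v. from_d v i)" for i
  proof (cases "i < r")
    case True
    have "continuous_map (stiefel dcj r) euclidean (\<lambda>v :: nat \<Rightarrow> 'd ^ 'n. v i)"
      unfolding stiefel_def using True
      by (intro continuous_map_from_subtopology continuous_map_product_projection) simp
    from continuous_map_compose[OF this, of euclidean split_vec] show ?thesis
      using True by (simp add: from_d_def o_def continuous_split_vec)
  qed (simp add: from_d_def)
  then have "continuous_map (stiefel dcj r) (product_topology (\<lambda>i. euclidean) UNIV) from_d"
    by (simp add: continuous_map_componentwise_UNIV)
  moreover have "from_d v \<in> unitary_frames r" if "v \<in> topspace (stiefel dcj r)" for v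
  proof -
    have "hermitian dcj (merge_vec (split_vec (v i))) (merge_vec (split_vec (v j))) = (if i = j then 1 else 0)"
      if "i < r" "j < r" for i j
      using that \<open>v \<in> _\<close> by (simp add: stiefel_def)
    then show ?thesis
      unfolding hermitian_merge_delta by (simp add: from_d_def unitary_frames_def unitary_def)
  qed
  ultimately have from_d: "continuous_map (stiefel dcj r) (top_of_set (unitary_frames r)) from_d"
    by (intro continuous_map_into_subtopology) (auto simp: euclidean_product_topology)
  have "from_d (to_d u) = u" if "u \<in> unitary_frames r" for u
    using that by (auto simp: from_d_def to_d_def unitary_frames_def)
  moreover have "to_d (from_d v) = v" if "v \<in> topspace (stiefel dcj r)" for v
    using that by (auto simp: from_d_def to_d_def stiefel_def restrict_def PiE_def extensional_def fun_eq_iff)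
  ultimately show ?thesis
    unfolding homeomorphic_space_def homeomorphic_maps_def using to_d from_d by auto
qed

lemma frames_homotopy_equivalent_stiefel:
  "top_of_set (frames r :: ('f, 'n::finite) frame set) homotopy_equivalent_space
    (stiefel dcj r :: (nat \<Rightarrow> 'd ^ 'n) topology)"
  using frames_homotopy_equivalent_unitary
    homeomorphic_imp_homotopy_equivalent_space[OF unitary_frames_homeomorphic_stiefel]
  by (rule homotopy_eqv_trans)

end

section \<open>Realizations of a form\<close>

definition realizations ::
    "'f::field ^ 'k ^ 'k \<Rightarrow> ('k \<Rightarrow> 'f ^ ('n::finite + 'n)) set" where
  "realizations \<beta> = {w. \<forall>i j. omega (w i) (w j) = \<beta> $ i $ j}"

text \<open>The linear map F^k -> V with the values w on the canonical basis.\<close>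

definition lincomb :: "('k::finite \<Rightarrow> 'f::field ^ 'm) \<Rightarrow> 'f ^ 'k \<Rightarrow> 'f ^ 'm" where
  "lincomb w x = (\<Sum>i\<in>UNIV. x $ i *s w i)"

lemma lincomb_linear:
  "lincomb w (x + y) = lincomb w x + lincomb w y"
  "lincomb w (x - y) = lincomb w x - lincomb w y"
  "lincomb w (c *s x) = c *s lincomb w x"
  "lincomb w 0 = 0"
  by (simp_all add: lincomb_def sum.distrib sum_subtractf vec_eq_iff sum_distrib_left algebra_simps)

lemma lincomb_sum: "lincomb w (\<Sum>a\<in>I. g a) = (\<Sum>a\<in>I. lincomb w (g a))"
  by (induction I rule: infinite_finite_induct) (simp_all add: lincomb_linear)

lemma lincomb_axis: "lincomb w (axis i 1) = w i"
proof -
  have "lincomb w (axis i 1) = (\<Sum>j\<in>UNIV. if j = i then w j else 0)"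
    unfolding lincomb_def by (intro sum.cong) (auto simp: axis_def)
  then show ?thesis by simp
qed

lemma omega_lincomb:
  fixes \<beta> :: "'f::field_char_0 ^ 'k ^ 'k::finite"
  assumes "w \<in> realizations \<beta>"
  shows "omega (lincomb w x) (lincomb w y) = bilinear_form \<beta> x y"
proof -
  have "omega (lincomb w x) (lincomb w y) = (\<Sum>j\<in>UNIV. \<Sum>i\<in>UNIV. x $ i * \<beta> $ i $ j * y $ j)"
    using assms
    by (simp add: lincomb_def omega.bilinear realizations_def sum_distrib_left mult_ac)
  also have "\<dots> = bilinear_form \<beta> x y"
    unfolding bilinear_form_def by (rule sum.swap)
  finally show ?thesis .
qed

section \<open>Splitting off the radical of a form\<close>

locale complete_system =
  fixes \<beta> :: "'f::real_normed_field ^ 'k ^ 'k::finite" and r :: nat and p q :: "nat \<Rightarrow> 'f ^ 'k"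
  assumes skew_matrix: "transpose \<beta> = - \<beta>"
    and complete_pq: "alternating_form.complete (bilinear_form \<beta>) r p q"
begin

abbreviation B :: "'f ^ 'k \<Rightarrow> 'f ^ 'k \<Rightarrow> 'f" where
  "B \<equiv> bilinear_form \<beta>"

sublocale B: alternating_form B
  by (rule alternating_bilinear_form) (rule skew_matrix)

lemma hyperbolic_pq: "hyperbolic B r p q"
  using complete_pq unfolding B.complete_def by blast

lemma B_proj: "B (B.proj r p q x) y = B x y"
  unfolding B.proj_form by (rule sym) (use complete_pq in \<open>unfold B.complete_def, blast\<close>)

definition restriction :: "('k \<Rightarrow> 'f ^ ('n::finite + 'n)) \<Rightarrow> ('f, 'n) frame" where
  "restriction w = (\<lambda>m. if m < r then lincomb w (p m) else 0, \<lambda>m. if m < r then lincomb w (q m) else 0)"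

text \<open>The linear map that sends p m and q m to the two halves of the frame and kills the
  radical of B; its coefficients are those of \<open>B.proj\<close>.\<close>

definition extension :: "('f, 'n::finite) frame \<Rightarrow> 'f ^ 'k \<Rightarrow> 'f ^ ('n + 'n)" where
  "extension x v = (\<Sum>m<r. B v (q m) *s fst x m - B v (p m) *s snd x m)"

lemma lincomb_extension: "lincomb (\<lambda>i. extension x (axis i 1)) v = extension x v"
proof -
  have v: "v = (\<Sum>i\<in>UNIV. v $ i *s axis i 1)"
    by (rule basis_expansion[symmetric])
  have lin: "extension x (\<Sum>i\<in>I. c i *s axis i 1) = (\<Sum>i\<in>I. c i *s extension x (axis i 1))"
    if "finite I" for I and c :: "'k \<Rightarrow> 'f"
    using that
    by (induction I) (simp_all add: extension_def B.bilinear vec.scale_right_diff_distrib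
        vec.scale_sum_right sum.distrib sum_subtractf vec.scale_left_distrib)
  show ?thesis
    unfolding lincomb_def by (subst (2) v) (simp only: lin[OF finite])
qed

text \<open>The frame carries the hyperbolic relations of p and q over to V, and projecting to their
  span does not change B.\<close>

lemma omega_extension:
  assumes "x \<in> frames r"
  shows "omega (extension x v) (extension x w) = B v w"
proof -
  have hyp: "hyperbolic omega r (fst x) (snd x)" using assms by (auto simp: frames_def)
  have e: "omega (fst x m) (extension x w) = - B w (p m)" if "m < r" for m
  proof -
    have "omega (fst x m) (extension x w) = (\<Sum>l<r. if m = l then - B w (p l) else 0)"
      unfolding extension_def omega.sum_right
      by (rule sum.cong) (use hyperbolicD[OF hyp that] in \<open>simp_all add: omega.bilinear\<close>)
    then show ?thesis using that by simp
  qed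
  have f: "omega (snd x m) (extension x w) = - B w (q m)" if "m < r" for m
  proof -
    have "omega (snd x m) (extension x w) = (\<Sum>l<r. if m = l then - B w (q l) else 0)"
      unfolding extension_def omega.sum_right
      by (rule sum.cong)
        (use hyperbolicD[OF hyp that] omega.hyperbolic_flip[OF hyp that] in \<open>simp_all add: omega.bilinear\<close>)
    then show ?thesis using that by simp
  qed
  have "omega (extension x v) (extension x w) =
      (\<Sum>m<r. B v (q m) * omega (fst x m) (extension x w) - B v (p m) * omega (snd x m) (extension x w))"
    by (subst (1) extension_def) (simp add: omega.sum_left omega.diff_left omega.scale_left)
  also have "\<dots> = (\<Sum>m<r. B v (q m) * B (p m) w - B v (p m) * B (q m) w)"
    using e f B.skew[of w] by (intro sum.cong) auto
  also have "\<dots> = B v w"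
    using B_proj[of v w] by (simp only: B.proj_form)
  finally show ?thesis .
qed

definition reconstruct :: "('f, 'n::finite) frame \<Rightarrow> 'k \<Rightarrow> 'f ^ ('n + 'n)" where
  "reconstruct x = (\<lambda>i. extension x (axis i 1))"

lemma reconstruct_realizations: "x \<in> frames r \<Longrightarrow> reconstruct x \<in> realizations \<beta>"
  by (simp add: realizations_def reconstruct_def omega_extension)

lemma restriction_frames: "w \<in> realizations \<beta> \<Longrightarrow> restriction w \<in> frames r"
  using hyperbolic_pq by (simp add: frames_def restriction_def hyperbolic_def omega_lincomb)

lemma restriction_reconstruct:
  assumes "x \<in> frames r"
  shows "restriction (reconstruct x) = x"
proof -
  have "extension x (p j) = fst x j" if "j < r" for j
  proof -
    have "extension x (p j) = (\<Sum>m<r. if j = m then fst x m else 0)"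
      unfolding extension_def
      by (rule sum.cong) (use hyperbolicD[OF hyperbolic_pq that] in simp_all)
    then show ?thesis using that by simp
  qed
  moreover have "extension x (q j) = snd x j" if "j < r" for j
  proof -
    have "extension x (q j) = (\<Sum>m<r. if j = m then snd x m else 0)"
      unfolding extension_def
      by (rule sum.cong)
        (use hyperbolicD[OF hyperbolic_pq that] B.hyperbolic_flip[OF hyperbolic_pq that] in simp_all)
    then show ?thesis using that by simp
  qed
  ultimately show ?thesis
    using assms by (auto simp: restriction_def reconstruct_def lincomb_extension prod_eq_iff frames_def fun_eq_iff)
qed

definition contraction :: "real \<times> ('k \<Rightarrow> 'f ^ ('n::finite + 'n)) \<Rightarrow> 'k \<Rightarrow> 'f ^ ('n + 'n)" where
  "contraction = (\<lambda>(t, w) i. (1 - t) *\<^sub>R w i + t *\<^sub>R reconstruct (restriction w) i)"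

lemma reconstruct_restriction: "reconstruct (restriction w) i = lincomb w (B.proj r p q (axis i 1))"
  by (simp add: reconstruct_def restriction_def extension_def B.proj_def lincomb_sum lincomb_linear)

text \<open>Projecting a basis vector changes it only by an element of the radical, so all pairings
  between w and its projected version, mixed ones included, equal \<beta>. The weights of the
  combination then add up to ((1 - t) + t)^2 = 1.\<close>

lemma contraction_realizations:
  assumes "w \<in> realizations \<beta>"
  shows "contraction (t, w) \<in> realizations \<beta>"
proof -
  let ?\<pi> = "\<lambda>i. B.proj r p q (axis i 1)"
  have "B (axis i 1) (?\<pi> j) = \<beta> $ i $ j" for i j
    using B_proj[of "axis j 1" "axis i 1"] B.skew[of "axis i 1" "?\<pi> j"] B.skew[of "axis j 1" "axis i 1"]
    by simp
  then have "omega (w i) (reconstruct (restriction w) j) = \<beta> $ i $ j"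
    "omega (reconstruct (restriction w) i) (w j) = \<beta> $ i $ j"
    "omega (reconstruct (restriction w) i) (reconstruct (restriction w) j) = \<beta> $ i $ j"
    "omega (w i) (w j) = \<beta> $ i $ j" for i j
    using omega_lincomb[OF assms, of "axis i 1" "?\<pi> j"] omega_lincomb[OF assms, of "?\<pi> i" "axis j 1"]
      omega_lincomb[OF assms, of "?\<pi> i" "?\<pi> j"] assms
    by (simp_all add: reconstruct_restriction lincomb_axis B_proj realizations_def)
  then have "omega (contraction (t, w) i) (contraction (t, w) j) = \<beta> $ i $ j" for i j
    by (simp add: contraction_def omega.bilinear algebra_simps)
  then show ?thesis by (simp add: realizations_def)
qed

lemma continuous_restriction:
  assumes "\<And>i. continuous_on S (\<lambda>x. w x i)"
  shows "continuous_on S (\<lambda>x. restriction (w x))"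
proof -
  have "continuous_on S (\<lambda>x. lincomb (w x) v)" for v
    unfolding lincomb_def by (intro continuous_intros assms)
  then have "continuous_on S (\<lambda>x. fst (restriction (w x)) m)" "continuous_on S (\<lambda>x. snd (restriction (w x)) m)" for m
    by (cases "m < r"; simp add: restriction_def)+
  then have "continuous_on S (\<lambda>x. (fst (restriction (w x)), snd (restriction (w x))))"
    by (intro continuous_intros)
  then show ?thesis by simp
qed

lemma continuous_reconstruct:
  assumes "continuous_on S x"
  shows "continuous_on S (\<lambda>y. reconstruct (x y) i)"
proof -
  have "continuous_on S (\<lambda>y. fst (x y) m)" "continuous_on S (\<lambda>y. snd (x y) m)" for m
    using assms by (auto intro!: continuous_on_product_then_coordinatewise continuous_on_fst continuous_on_snd)
  then show ?thesis
    unfolding reconstruct_def extension_def by (intro continuous_intros)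
qed

lemma continuous_contraction:
  "continuous_on S (contraction :: real \<times> ('k \<Rightarrow> 'f ^ ('n::finite + 'n)) \<Rightarrow> _)"
proof -
  have "continuous_on S (\<lambda>x. \<lambda>i. (1 - fst x) *\<^sub>R snd x i + fst x *\<^sub>R reconstruct (restriction (snd x)) i)"
    by (intro continuous_intros continuous_reconstruct continuous_restriction)
  then show ?thesis by (simp add: contraction_def case_prod_unfold)
qed

lemma realizations_homotopy_equivalent_frames:
  "top_of_set (realizations \<beta> :: ('k \<Rightarrow> 'f ^ ('n::finite + 'n)) set) homotopy_equivalent_space
    top_of_set (frames r :: ('f, 'n) frame set)"
proof (rule homotopy_equivalent_retractI[where \<rho> = restriction and \<sigma> = reconstruct and H = contraction])
  show "continuous_on (realizations \<beta>) (restriction :: _ \<Rightarrow> ('f, 'n) frame)"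
    by (intro continuous_restriction continuous_on_product_then_coordinatewise[OF continuous_on_id])
  show "continuous_on (frames r) (reconstruct :: ('f, 'n) frame \<Rightarrow> _)"
    by (intro continuous_on_coordinatewise_then_product continuous_reconstruct continuous_on_id)
qed (auto simp: restriction_frames reconstruct_realizations restriction_reconstruct contraction_realizations
    continuous_contraction, simp_all add: contraction_def)

text \<open>Contraction joins each realization to one reconstructed from a frame, and the
  reconstructed ones form a continuous image of the connected space of frames.\<close>

lemma path_connected_realizations: "path_connected (realizations \<beta> :: ('k \<Rightarrow> 'f ^ ('n::finite + 'n)) set)"
proof -
  let ?R = "realizations \<beta> :: ('k \<Rightarrow> 'f ^ ('n + 'n)) set"
  have to_image: "path_component ?R w (reconstruct (restriction w))" if "w \<in> ?R" for w
    unfolding path_component_def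
  proof (intro exI conjI)
    show "path (\<lambda>t. contraction (t, w))"
      unfolding path_def by (rule continuous_on_compose2[OF continuous_contraction]) (auto intro!: continuous_intros)
    show "path_image (\<lambda>t. contraction (t, w)) \<subseteq> ?R"
      using contraction_realizations[OF that] by (auto simp: path_image_def)
  qed (auto simp: pathstart_def pathfinish_def contraction_def)
  have "path_connected (reconstruct ` (frames r :: ('f, 'n) frame set))"
    by (intro path_connected_continuous_image path_connected_frames
        continuous_on_coordinatewise_then_product continuous_reconstruct continuous_on_id)
  moreover have "reconstruct ` (frames r :: ('f, 'n) frame set) \<subseteq> ?R"
    using reconstruct_realizations by blast
  ultimately have "path_component ?R (reconstruct (restriction v)) (reconstruct (restriction w))"
    if "v \<in> ?R" "w \<in> ?R" for v w
    using that restriction_frames unfolding path_connected_component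
    by (meson image_eqI path_component_of_subset)
  then show ?thesis
    unfolding path_connected_component using to_image path_component_sym path_component_trans by meson
qed

lemma realizations_nonempty_iff:
  "(realizations \<beta> :: ('k \<Rightarrow> 'f ^ ('n::finite + 'n)) set) \<noteq> {} \<longleftrightarrow> r \<le> CARD('n)"
proof -
  have "(realizations \<beta> :: ('k \<Rightarrow> 'f ^ ('n + 'n)) set) \<noteq> {} \<longleftrightarrow> (frames r :: ('f, 'n) frame set) \<noteq> {}"
    using restriction_frames reconstruct_realizations by blast
  then show ?thesis by (simp only: frames_nonempty_iff)
qed

lemma rank_le: "2 * r \<le> CARD('k)"
  by (rule B.hyperbolic_bound) (rule hyperbolic_pq)

lemma rank_adjoint_eq: "rank_adjoint \<beta> = 2 * r"
  by (rule rank_adjoint_complete) (rule skew_matrix complete_pq)+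

end

lemma complete_system_exists:
  fixes \<beta> :: "'f::real_normed_field ^ 'k ^ 'k::finite"
  assumes "transpose \<beta> = - \<beta>"
  shows "\<exists>r p q. complete_system \<beta> r p q"
  using alternating_form.complete_exists[OF alternating_bilinear_form[OF assms]] assms
  by (auto simp: complete_system_def)

section \<open>The exponential map of the integral lattice\<close>

text \<open>A uniform description of the two lattices: the integers in the reals and the Gaussian
  integers in the complex numbers.\<close>

definition unit_lattice :: "'f::euclidean_space set" where
  "unit_lattice = {z. \<forall>b\<in>Basis. z \<bullet> b \<in> \<int>}"

lemma unit_lattice_add: "x \<in> unit_lattice \<Longrightarrow> y \<in> unit_lattice \<Longrightarrow> x + y \<in> unit_lattice"
  by (simp add: unit_lattice_def inner_add_left)

lemma unit_lattice_minus: "x \<in> unit_lattice \<Longrightarrow> - x \<in> unit_lattice"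
  by (simp add: unit_lattice_def)

lemma unit_lattice_zero [simp]: "0 \<in> unit_lattice"
  by (simp add: unit_lattice_def)

lemma unit_lattice_sum: "(\<And>i. i \<in> I \<Longrightarrow> g i \<in> unit_lattice) \<Longrightarrow> (\<Sum>i\<in>I. g i) \<in> unit_lattice"
  by (induction I rule: infinite_finite_induct) (auto intro: unit_lattice_add)

lemma unit_lattice_of_int_mult:
  fixes x :: "'f::{real_normed_field, euclidean_space}"
  assumes "x \<in> unit_lattice"
  shows "of_int c * x \<in> unit_lattice"
proof -
  have "of_int c * x = real_of_int c *\<^sub>R x" by (simp add: scaleR_conv_of_real)
  then show ?thesis using assms by (simp add: unit_lattice_def)
qed

lemma countable_lattice: "countable (unit_lattice :: 'f::euclidean_space set)"
proof (rule countable_image_inj_on)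
  let ?c = "\<lambda>z :: 'f. \<lambda>b\<in>Basis. z \<bullet> b"
  have "?c ` unit_lattice \<subseteq> PiE Basis (\<lambda>_. \<int>)"
    by (auto simp: unit_lattice_def)
  moreover have "countable (PiE (Basis :: 'f set) (\<lambda>_. \<int> :: real set))"
    by (intro countable_PiE) (auto simp: Ints_def)
  ultimately show "countable (?c ` unit_lattice)" by (rule countable_subset)
  show "inj_on ?c unit_lattice"
    by (rule inj_onI) (metis euclidean_eqI restrict_apply')
qed

abbreviation circle :: "complex topology" where
  "circle \<equiv> top_of_set (sphere 0 1)"

definition lattice_exp :: "'f::euclidean_space \<Rightarrow> 'f \<Rightarrow> complex" where
  "lattice_exp z = (\<lambda>b\<in>Basis. cis (2 * pi * (z \<bullet> b)))"

abbreviation basis_torus :: "('f::euclidean_space \<Rightarrow> complex) topology" where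
  "basis_torus \<equiv> product_topology (\<lambda>b. circle) Basis"

lemma cis_2pi_eq_iff: "cis (2 * pi * s) = cis (2 * pi * t) \<longleftrightarrow> s - t \<in> \<int>"
proof -
  have "cis (2 * pi * s) = cis (2 * pi * t) \<longleftrightarrow> (\<exists>n::int. 2 * pi * s = 2 * pi * t + 2 * pi * n)"
    unfolding sin_cos_eq_iff[symmetric] by (auto simp: complex_eq_iff)
  also have "\<dots> \<longleftrightarrow> (\<exists>n::int. s - t = n)"
  proof (intro iff_exI)
    fix n :: int
    have "2 * pi * s = 2 * pi * t + 2 * pi * n \<longleftrightarrow> 2 * pi * (s - t - n) = 0"
      by (simp add: algebra_simps)
    also have "\<dots> \<longleftrightarrow> s - t = n" by simp
    finally show "2 * pi * s = 2 * pi * t + 2 * pi * n \<longleftrightarrow> s - t = n" .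
  qed
  also have "\<dots> \<longleftrightarrow> s - t \<in> \<int>" by (auto simp: Ints_def)
  finally show ?thesis .
qed

lemma lattice_exp_eq_iff: "lattice_exp z = lattice_exp w \<longleftrightarrow> z - w \<in> unit_lattice"
proof -
  have "lattice_exp z = lattice_exp w \<longleftrightarrow> (\<forall>b\<in>Basis. cis (2 * pi * (z \<bullet> b)) = cis (2 * pi * (w \<bullet> b)))"
    by (auto simp: lattice_exp_def fun_eq_iff restrict_def)
  then show ?thesis by (simp add: cis_2pi_eq_iff unit_lattice_def inner_diff_left)
qed

lemma continuous_lattice_exp: "continuous_map euclidean basis_torus lattice_exp"
  unfolding continuous_map_componentwise
proof (intro conjI ballI)
  fix b :: 'a assume b: "b \<in> Basis"
  have "continuous_on UNIV (\<lambda>z. cis (2 * pi * (z \<bullet> b)))" by (intro continuous_intros)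
  then show "continuous_map euclidean circle (\<lambda>z. lattice_exp z b)"
    using b by (simp add: lattice_exp_def continuous_map_in_subtopology)
qed (auto simp: lattice_exp_def)

text \<open>Arguments divided by 2 pi give a lift. What matters is that some compact cube covers the
  torus, so a crude bound on \<open>Arg\<close> is enough.\<close>

lemma lattice_exp_surj_cube:
  assumes "\<tau> \<in> topspace basis_torus"
  obtains z where "z \<in> cbox (- One) One" "lattice_exp z = \<tau>"
proof
  define z where "z = (\<Sum>b\<in>Basis. (Arg (\<tau> b) / (2 * pi)) *\<^sub>R b)"
  have zb: "z \<bullet> b = Arg (\<tau> b) / (2 * pi)" if "b \<in> Basis" for b
    using that by (simp add: z_def inner_sum_left inner_Basis if_distrib cong: if_cong)
  have "\<bar>Arg (\<tau> b)\<bar> \<le> 2 * pi" for b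
    using Arg_bounded[of "\<tau> b"] pi_gt_zero by linarith
  then have "\<bar>z \<bullet> b\<bar> \<le> 1" if "b \<in> Basis" for b
    using that by (simp add: zb)
  then show "z \<in> cbox (- One) One"
    by (force simp: mem_box abs_le_iff)
  have "cis (Arg (\<tau> b)) = \<tau> b" if "b \<in> Basis" for b
  proof -
    have "norm (\<tau> b) = 1" using assms that by (auto simp: PiE_iff)
    then have "\<tau> b \<noteq> 0" by force
    from cis_Arg[OF this] show ?thesis using \<open>norm (\<tau> b) = 1\<close> by (simp add: sgn_div_norm)
  qed
  then show "lattice_exp z = \<tau>"
    using assms by (auto simp: lattice_exp_def zb fun_eq_iff restrict_def PiE_iff extensional_def)
qed

text \<open>On the cube the exponential is a continuous surjection from a compact to a Hausdorff
  space, hence a quotient map. The preimage in the cube of the image of U is cut out by the lattice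
  translates of U, whose union is open.\<close>

lemma open_lattice_exp:
  fixes U :: "'f::euclidean_space set"
  assumes "open U"
  shows "openin basis_torus (lattice_exp ` U)"
proof -
  let ?K = "cbox (- One) One :: 'f set"
  have surj: "lattice_exp ` ?K = topspace basis_torus"
  proof
    show "lattice_exp ` ?K \<subseteq> topspace basis_torus"
      using continuous_map_image_subset_topspace[OF continuous_lattice_exp] by auto
    show "topspace basis_torus \<subseteq> lattice_exp ` ?K"
      using lattice_exp_surj_cube by blast
  qed
  have "quotient_map (top_of_set ?K) basis_torus lattice_exp"
  proof (rule continuous_imp_quotient_map)
    show "continuous_map (top_of_set ?K) basis_torus lattice_exp"
      by (intro continuous_map_from_subtopology continuous_lattice_exp)
    show "compact_space (top_of_set ?K)" by (simp add: compact_space_subtopology)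
    show "Hausdorff_space basis_torus"
      by (simp add: Hausdorff_space_product_topology Hausdorff_space_subtopology)
  qed (use surj in simp)
  moreover have "lattice_exp ` U \<subseteq> topspace basis_torus"
    using continuous_map_image_subset_topspace[OF continuous_lattice_exp] by auto
  moreover have "openin (top_of_set ?K) {x \<in> topspace (top_of_set ?K). lattice_exp x \<in> lattice_exp ` U}"
  proof -
    have "{x \<in> ?K. lattice_exp x \<in> lattice_exp ` U} = ?K \<inter> (\<Union>a\<in>unit_lattice. (+) a ` U)"
    proof (intro equalityI subsetI)
      fix x assume "x \<in> {x \<in> ?K. lattice_exp x \<in> lattice_exp ` U}"
      then obtain u where "x \<in> ?K" "u \<in> U" "x - u \<in> unit_lattice" by (auto simp: lattice_exp_eq_iff)
      moreover have "x = (x - u) + u" by simp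
      ultimately show "x \<in> ?K \<inter> (\<Union>a\<in>unit_lattice. (+) a ` U)" by blast
    next
      fix x assume "x \<in> ?K \<inter> (\<Union>a\<in>unit_lattice. (+) a ` U)"
      then obtain a u where "x \<in> ?K" "u \<in> U" "a \<in> unit_lattice" "x = a + u" by blast
      moreover from this have "lattice_exp x = lattice_exp u" by (simp add: lattice_exp_eq_iff)
      ultimately show "x \<in> {x \<in> ?K. lattice_exp x \<in> lattice_exp ` U}" by blast
    qed
    moreover have "open (\<Union>a\<in>unit_lattice. (+) a ` U)"
      using assms open_translation by blast
    ultimately show ?thesis by (auto intro: openin_open_Int)
  qed
  ultimately show ?thesis unfolding quotient_map_def by blast
qed

section \<open>Products of circles as tori\<close>

lemma product_topology_reindex:
  assumes "bij_betw \<pi> I K"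
  shows "product_topology (\<lambda>_. T) K homeomorphic_space product_topology (\<lambda>_. T) I"
  unfolding homeomorphic_space_def homeomorphic_maps_def
proof (intro exI conjI)
  let ?f = "\<lambda>x. \<lambda>i\<in>I. x (\<pi> i)" and ?g = "\<lambda>y. \<lambda>k\<in>K. y (inv_into I \<pi> k)"
  have \<pi>: "\<pi> i \<in> K" "inv_into I \<pi> (\<pi> i) = i" if "i \<in> I" for i
    using assms that by (auto simp: bij_betw_def)
  have \<pi>': "inv_into I \<pi> k \<in> I" "\<pi> (inv_into I \<pi> k) = k" if "k \<in> K" for k
    using assms that by (auto simp: bij_betw_def inv_into_into f_inv_into_f)
  show "continuous_map (product_topology (\<lambda>_. T) K) (product_topology (\<lambda>_. T) I) ?f"
    using \<pi>(1) by (auto simp: continuous_map_componentwise intro!: continuous_map_product_projection)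
  show "continuous_map (product_topology (\<lambda>_. T) I) (product_topology (\<lambda>_. T) K) ?g"
    using \<pi>'(1) by (auto simp: continuous_map_componentwise intro!: continuous_map_product_projection)
  show "\<forall>x\<in>topspace (product_topology (\<lambda>_. T) K). ?g (?f x) = x"
    using \<pi>' by (auto simp: fun_eq_iff restrict_def PiE_iff extensional_def)
  show "\<forall>y\<in>topspace (product_topology (\<lambda>_. T) I). ?f (?g y) = y"
    using \<pi> by (auto simp: fun_eq_iff restrict_def PiE_iff extensional_def)
qed

lemma homeomorphic_torus:
  assumes "finite I"
  shows "product_topology (\<lambda>_. circle) I homeomorphic_space torus (card I)"
proof -
  obtain \<pi> where "bij_betw \<pi> {..<card I} I"
    using assms bij_betw_from_nat_into_finite by (metis atLeast0LessThan ex_bij_betw_nat_finite)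
  then show ?thesis unfolding torus_def by (rule product_topology_reindex)
qed

lemma path_connected_circle_product: "path_connected_space (product_topology (\<lambda>_. circle) I)"
proof -
  have "path_connected (sphere (0 :: complex) 1)" by (rule path_connected_sphere) simp
  then have "path_connected_space circle"
    using path_connectedin_subtopology[of euclidean "sphere (0 :: complex) 1" "sphere 0 1"]
    by (simp flip: path_connectedin_topspace)
  then show ?thesis by (simp only: path_connected_space_product_topology) simp
qed

section \<open>The reduced Heisenberg group\<close>

definition heis :: "'f::field ^ ('n::finite + 'n) \<Rightarrow> 'f \<Rightarrow> ('f, 'n) block_matrix" where
  "heis v z = heis_matrix (\<chi> i. v $ Inl i) (\<chi> i. v $ Inr i) z"

definition heis_vector :: "('f::field, 'n::finite) block_matrix \<Rightarrow> 'f ^ ('n + 'n)" where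
  "heis_vector M = (\<chi> s. case s of Inl i \<Rightarrow> M $ First $ Mid i | Inr i \<Rightarrow> M $ Mid i $ Last)"

definition heis_cocycle :: "'f::field ^ ('n::finite + 'n) \<Rightarrow> 'f ^ ('n + 'n) \<Rightarrow> 'f" where
  "heis_cocycle v w = (\<Sum>i\<in>UNIV. v $ Inl i * w $ Inr i)"

lemma omega_cocycle: "omega v w = heis_cocycle v w - heis_cocycle w v"
  by (simp add: omega_def heis_cocycle_def sum_subtractf)

lemma heis_vector_heis [simp]: "heis_vector (heis v z) = v"
proof -
  have "heis_vector (heis v z) $ s = v $ s" for s
    by (cases s) (simp_all add: heis_vector_def heis_def heis_matrix_def)
  then show ?thesis by (simp add: vec_eq_iff)
qed

lemma heis_corner [simp]: "heis v z $ First $ Last = z"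
  by (simp add: heis_def heis_matrix_def)

lemma heis_eq_iff: "heis v z = heis w y \<longleftrightarrow> v = w \<and> z = y"
  by (metis heis_vector_heis heis_corner)

lemma heis_surj:
  fixes M :: "('f::field, 'n::finite) block_matrix"
  assumes "M \<in> carrier heisenberg"
  shows "M = heis (heis_vector M) (M $ First $ Last)"
  using assms by (auto simp: heisenberg_def heis_def heis_vector_def heis_matrix_def vec_lambda_eta)

lemma heis_carrier [simp]: "heis v z \<in> carrier heisenberg"
  by (auto simp: heis_def heisenberg_def)

lemma carrier_heisenberg: "carrier heisenberg = range (\<lambda>(v, z). heis v z)"
  using heis_surj by (force simp: image_iff)

lemma heis_mult: "heis v z \<otimes>\<^bsub>heisenberg\<^esub> heis w y = heis (v + w) (z + y + heis_cocycle v w)"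
  by (simp add: heisenberg_def heis_def heis_matrix_mult heis_cocycle_def plus_vec_def)

definition heis_coset :: "'f::{field, euclidean_space} ^ ('n::finite + 'n) \<Rightarrow> 'f \<Rightarrow> ('f, 'n) block_matrix set" where
  "heis_coset v z = heis_central unit_lattice #>\<^bsub>heisenberg\<^esub> heis v z"

lemma normal_lattice:
  "heis_central (unit_lattice :: 'f::{field, euclidean_space} set) \<lhd>
    (heisenberg :: ('f, 'n::finite) block_matrix monoid)"
  by (rule normal_heis_central) (auto intro: unit_lattice_add unit_lattice_minus)

lemma heis_zero_vector: "heis_matrix 0 0 a = heis 0 a"
  by (simp add: heis_def zero_vec_def)

lemma heis_coset_image: "heis_coset v z = (\<lambda>a. heis v (z + a)) ` unit_lattice"
  unfolding heis_coset_def r_coset_def heis_central_def heis_zero_vector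
  by (auto simp: heis_mult heis_cocycle_def add.commute)

lemma heis_coset_eq_iff: "heis_coset v z = heis_coset w y \<longleftrightarrow> v = w \<and> z - y \<in> unit_lattice"
proof
  assume eq: "heis_coset v z = heis_coset w y"
  have "heis v z \<in> heis_coset v z"
    unfolding heis_coset_image by (rule image_eqI[of _ _ 0]) auto
  then have "heis v z \<in> heis_coset w y" by (simp add: eq)
  then show "v = w \<and> z - y \<in> unit_lattice"
    by (auto simp: heis_coset_image heis_eq_iff)
next
  assume *: "v = w \<and> z - y \<in> unit_lattice"
  have "heis_coset v z \<subseteq> heis_coset v y" if "z - y \<in> unit_lattice" for z y
  proof
    fix x assume "x \<in> heis_coset v z"
    then obtain a where "a \<in> unit_lattice" "x = heis v (z + a)" by (auto simp: heis_coset_image)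
    then have "x = heis v (y + ((z - y) + a))" "(z - y) + a \<in> unit_lattice"
      using that by (auto intro: unit_lattice_add)
    then show "x \<in> heis_coset v y" unfolding heis_coset_image by blast
  qed
  from this[of z y] this[of y z] * show "heis_coset v z = heis_coset w y"
    using unit_lattice_minus[of "z - y"] by auto
qed

lemma carrier_reduced:
  "carrier (reduced_heisenberg unit_lattice) = range (\<lambda>(v, z). heis_coset v z)"
  by (auto simp: reduced_heisenberg_def carrier_FactGroup carrier_heisenberg heis_coset_def)

lemma heis_coset_mult:
  "heis_coset v z \<otimes>\<^bsub>reduced_heisenberg unit_lattice\<^esub> heis_coset w y = heis_coset (v + w) (z + y + heis_cocycle v w)"
  using normal.rcos_sum[OF normal_lattice heis_carrier heis_carrier, of v z w y]
  by (simp add: reduced_heisenberg_def heis_coset_def heis_mult mult_FactGroup)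

lemma group_reduced: "group (reduced_heisenberg (unit_lattice :: 'f::{field, euclidean_space} set) ::
    ('f, 'n::finite) block_matrix set monoid)"
  unfolding reduced_heisenberg_def by (rule normal.factorgroup_is_group[OF normal_lattice])

lemma continuous_heis:
  "continuous_on UNIV (\<lambda>p. heis (fst p) (snd p) :: ('f::{real_normed_field, euclidean_space}, 'n::finite) block_matrix)"
  unfolding heis_def heis_matrix_def
proof (intro continuous_on_vec_lambda)
  fix r c :: "'n block"
  show "continuous_on UNIV (\<lambda>p. heis_entry (\<chi> i. fst p $ Inl i) (\<chi> i. fst p $ Inr i) (snd p) r c :: 'f)"
    by (cases r; cases c) (auto intro!: continuous_intros)
qed

lemma continuous_heis_vector:
  "continuous_on S (heis_vector :: ('f::{real_normed_field, euclidean_space}, 'n::finite) block_matrix \<Rightarrow> _)"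
  unfolding heis_vector_def
proof (intro continuous_on_vec_lambda)
  fix s :: "'n + 'n"
  show "continuous_on S (\<lambda>M :: ('f, 'n) block_matrix. case s of Inl i \<Rightarrow> M $ First $ Mid i | Inr i \<Rightarrow> M $ Mid i $ Last)"
    by (cases s) (auto intro!: continuous_intros)
qed

lemma quotient_map_heis_coset:
  "quotient_map euclidean (reduced_heisenberg_topology (unit_lattice :: 'f::{real_normed_field, euclidean_space} set))
    (\<lambda>p :: ('f ^ ('n::finite + 'n)) \<times> 'f. heis_coset (fst p) (snd p))"
proof -
  let ?H = "carrier (heisenberg :: ('f, 'n) block_matrix monoid)"
  have "homeomorphic_maps euclidean (top_of_set ?H) (\<lambda>p. heis (fst p) (snd p))
      (\<lambda>M. (heis_vector M, M $ First $ Last))"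
    unfolding homeomorphic_maps_def
  proof (intro conjI)
    show "continuous_map euclidean (top_of_set ?H) (\<lambda>p. heis (fst p) (snd p))"
      using continuous_heis by (simp add: continuous_map_in_subtopology)
    show "continuous_map (top_of_set ?H) euclidean (\<lambda>M. (heis_vector M, M $ First $ Last))"
      by (simp add: continuous_map_iff_continuous)
        (intro continuous_on_Pair continuous_heis_vector continuous_intros)
  qed (simp_all add: heis_surj[symmetric])
  then have "quotient_map euclidean (top_of_set ?H) (\<lambda>p. heis (fst p) (snd p))"
    unfolding homeomorphic_maps_map homeomorphic_map_def by blast
  moreover have "quotient_map (top_of_set ?H) (reduced_heisenberg_topology unit_lattice)
      (r_coset heisenberg (heis_central unit_lattice))"
    unfolding reduced_heisenberg_topology_def by (rule quotient_map_quotient_group_topology) simp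
  ultimately have "quotient_map euclidean (reduced_heisenberg_topology unit_lattice)
      (r_coset heisenberg (heis_central unit_lattice) \<circ> (\<lambda>p :: ('f ^ ('n + 'n)) \<times> 'f. heis (fst p) (snd p)))"
    by (rule quotient_map_compose)
  then show ?thesis by (simp add: o_def heis_coset_def)
qed

text \<open>A product of quotient maps need not be a quotient map; here the openness of
  \<open>lattice_exp\<close> settles it.\<close>

lemma quotient_map_vector_exp:
  "quotient_map euclidean (prod_topology euclidean basis_torus)
    (\<lambda>p :: 'v::topological_space \<times> 'f::euclidean_space. (fst p, lattice_exp (snd p)))" (is "quotient_map _ _ ?\<kappa>")
proof (subst continuous_open_quotient_map)
  show "continuous_map euclidean (prod_topology euclidean basis_torus) ?\<kappa>"
  proof (intro continuous_map_pairedI)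
    show "continuous_map euclidean euclidean (fst :: 'v \<times> 'f \<Rightarrow> 'v)"
      by (simp add: continuous_on_fst continuous_on_id)
    show "continuous_map euclidean basis_torus (\<lambda>p :: 'v \<times> 'f. lattice_exp (snd p))"
      using continuous_map_compose[OF _ continuous_lattice_exp, of euclidean "snd :: 'v \<times> 'f \<Rightarrow> 'f"]
      by (simp add: o_def continuous_on_snd continuous_on_id)
  qed
  show "open_map euclidean (prod_topology euclidean basis_torus) ?\<kappa>"
    unfolding open_map_def openin_prod_topology_alt
  proof (intro allI impI)
    fix U :: "('v \<times> 'f) set" and v \<tau>
    assume U: "openin euclidean U" and "(v, \<tau>) \<in> ?\<kappa> ` U"
    then obtain z where z: "(v, z) \<in> U" "\<tau> = lattice_exp z" by auto
    from U have "open U" by simp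
    then obtain S T where ST: "open S" "open T" "(v, z) \<in> S \<times> T" "S \<times> T \<subseteq> U"
      using z(1) by (rule open_prod_elim)
    have "S \<times> lattice_exp ` T \<subseteq> ?\<kappa> ` U"
    proof clarify
      fix s t assume "s \<in> S" "t \<in> T"
      then show "(s, lattice_exp t) \<in> ?\<kappa> ` U"
        using ST(4) by (intro image_eqI[of _ _ "(s, t)"]) auto
    qed
    then show "\<exists>S T. openin euclidean S \<and> openin basis_torus T \<and> v \<in> S \<and> \<tau> \<in> T \<and> S \<times> T \<subseteq> ?\<kappa> ` U"
      using ST z(2) open_lattice_exp[OF ST(2)]
      by (intro exI[of _ S] exI[of _ "lattice_exp ` T"]) auto
  qed
  have "\<exists>z. lattice_exp z = \<tau>" if "\<tau> \<in> topspace basis_torus" for \<tau> :: "'f \<Rightarrow> complex"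
    using lattice_exp_surj_cube[OF that] by blast
  then have "topspace basis_torus \<subseteq> range (lattice_exp :: 'f \<Rightarrow> _)" by blast
  moreover have "range (lattice_exp :: 'f \<Rightarrow> _) \<subseteq> topspace basis_torus"
    using continuous_map_image_subset_topspace[OF continuous_lattice_exp] by auto
  ultimately have "range (lattice_exp :: 'f \<Rightarrow> _) = topspace basis_torus" by blast
  moreover have "range ?\<kappa> = UNIV \<times> range lattice_exp"
  proof (intro equalityI subsetI)
    fix y :: "'v \<times> ('f \<Rightarrow> complex)" assume "y \<in> UNIV \<times> range lattice_exp"
    then have "snd y \<in> range lattice_exp" by (simp only: mem_Times_iff)
    then obtain z where "snd y = lattice_exp z" by blast
    then have "y = ?\<kappa> (fst y, z)" by (simp only: prod_eq_iff fst_conv snd_conv)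
    then show "y \<in> range ?\<kappa>" by (rule range_eqI)
  qed auto
  ultimately show "?\<kappa> ` topspace euclidean = topspace (prod_topology euclidean basis_torus)"
    by (simp only: topspace_prod_topology topspace_euclidean)
qed

text \<open>The coset map and the exponential are quotient maps of the same space V x F with the
  same fibres, so each factors through the other and the two induced maps are mutually
  inverse.\<close>

lemma reduced_heisenberg_coordinates:
  obtains \<theta> \<eta> where
    "homeomorphic_maps (reduced_heisenberg_topology (unit_lattice :: 'f::{real_normed_field, euclidean_space} set))
      (prod_topology (euclidean :: ('f ^ ('n::finite + 'n)) topology) basis_torus) \<theta> \<eta>"
    "\<And>v z. \<theta> (heis_coset v z) = (v, lattice_exp z)"
proof -
  let ?Q = "reduced_heisenberg_topology (unit_lattice :: 'f set) :: ('f, 'n) block_matrix set topology"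
  let ?P = "prod_topology (euclidean :: ('f ^ ('n + 'n)) topology) (basis_torus :: ('f \<Rightarrow> complex) topology)"
  let ?q = "\<lambda>p :: ('f ^ ('n + 'n)) \<times> 'f. heis_coset (fst p) (snd p)"
  let ?\<kappa> = "\<lambda>p :: ('f ^ ('n + 'n)) \<times> 'f. (fst p, lattice_exp (snd p))"
  note q = quotient_map_heis_coset[where 'f = 'f and 'n = 'n]
  note \<kappa> = quotient_map_vector_exp[where 'f = 'f and 'v = "'f ^ ('n + 'n)"]
  have same: "?q x = ?q y \<longleftrightarrow> ?\<kappa> x = ?\<kappa> y" for x y
    by (simp add: heis_coset_eq_iff lattice_exp_eq_iff)
  obtain \<theta> where \<theta>: "continuous_map ?Q ?P \<theta>" "\<And>x. \<theta> (?q x) = ?\<kappa> x"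
    by (rule quotient_map_lift_exists[OF q quotient_imp_continuous_map[OF \<kappa>] same[THEN iffD1]]) auto
  obtain \<eta> where \<eta>: "continuous_map ?P ?Q \<eta>" "\<And>x. \<eta> (?\<kappa> x) = ?q x"
    by (rule quotient_map_lift_exists[OF \<kappa> quotient_imp_continuous_map[OF q] same[THEN iffD2]]) auto
  have Q: "topspace ?Q = range ?q" and P: "topspace ?P = range ?\<kappa>"
    using quotient_imp_surjective_map[OF q] quotient_imp_surjective_map[OF \<kappa>] by simp_all
  have "\<eta> (\<theta> x) = x" if x: "x \<in> topspace ?Q" for x
  proof -
    obtain y where "x = ?q y" using x unfolding Q by blast
    then show ?thesis by (simp only: \<theta>(2) \<eta>(2))
  qed
  moreover have "\<theta> (\<eta> x) = x" if x: "x \<in> topspace ?P" for x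
  proof -
    obtain y where "x = ?\<kappa> y" using x unfolding P by blast
    then show ?thesis by (simp only: \<theta>(2) \<eta>(2))
  qed
  ultimately have "homeomorphic_maps ?Q ?P \<theta> \<eta>"
    using \<theta>(1) \<eta>(1) by (simp add: homeomorphic_maps_def)
  then show thesis using that[of \<theta> \<eta>] \<theta>(2)[of "(_, _)"] by simp
qed

section \<open>Homomorphisms from a free abelian group\<close>

lemma heis_cocycle_bilinear:
  "heis_cocycle (\<Sum>i\<in>I. c i *s v i) (\<Sum>j\<in>K. d j *s w j) =
    (\<Sum>i\<in>I. \<Sum>j\<in>K. c i * d j * heis_cocycle (v i) (w j))"
  for v :: "'i \<Rightarrow> 'f::field ^ ('n::finite + 'n)"
proof -
  have "heis_cocycle (\<Sum>i\<in>I. c i *s v i) (\<Sum>j\<in>K. d j *s w j) =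
      (\<Sum>l\<in>UNIV. \<Sum>i\<in>I. \<Sum>j\<in>K. c i * d j * (v i $ Inl l * w j $ Inr l))"
    unfolding heis_cocycle_def by (simp add: sum_product) (simp add: mult_ac)
  also have "\<dots> = (\<Sum>i\<in>I. \<Sum>l\<in>UNIV. \<Sum>j\<in>K. c i * d j * (v i $ Inl l * w j $ Inr l))"
    by (rule sum.swap)
  also have "\<dots> = (\<Sum>i\<in>I. \<Sum>j\<in>K. \<Sum>l\<in>UNIV. c i * d j * (v i $ Inl l * w j $ Inr l))"
    by (intro sum.cong refl sum.swap)
  finally show ?thesis by (simp add: heis_cocycle_def sum_distrib_left)
qed

lemma hom_Zk_add: "\<rho> \<in> hom Zk G \<Longrightarrow> \<rho> (x + y) = \<rho> x \<otimes>\<^bsub>G\<^esub> \<rho> y"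
  by (simp add: hom_def Zk_def)

lemma hom_Zk_closed: "\<rho> \<in> hom Zk G \<Longrightarrow> \<rho> x \<in> carrier G"
  by (auto simp: hom_def Zk_def)

lemma hom_heis_coset:
  assumes "\<rho> \<in> hom Zk (reduced_heisenberg unit_lattice)"
  obtains v z where "\<rho> x = heis_coset v z"
  using hom_Zk_closed[OF assms, of x] by (auto simp: carrier_reduced)

lemma hom_omega:
  assumes \<rho>: "\<rho> \<in> hom Zk (reduced_heisenberg unit_lattice)"
    and "\<rho> x = heis_coset v z" "\<rho> y = heis_coset w u"
  shows "omega v w \<in> unit_lattice"
proof -
  have "heis_coset (v + w) (z + u + heis_cocycle v w) = \<rho> (x + y)"
    by (simp add: hom_Zk_add[OF \<rho>] assms heis_coset_mult)
  also have "\<dots> = heis_coset (w + v) (u + z + heis_cocycle w v)"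
    by (subst add.commute) (simp add: hom_Zk_add[OF \<rho>] assms heis_coset_mult)
  finally show ?thesis
    by (simp add: heis_coset_eq_iff omega_cocycle)
qed

lemma hom_Zk_unique:
  fixes \<rho> \<sigma> :: "int ^ 'k::finite \<Rightarrow> 'g"
  assumes "group G" and \<rho>: "\<rho> \<in> hom Zk G" and \<sigma>: "\<sigma> \<in> hom Zk G"
    and eq: "\<And>i. \<rho> (axis i 1) = \<sigma> (axis i 1)"
  shows "\<rho> = \<sigma>"
proof -
  interpret G: group G by fact
  note closed = hom_Zk_closed[OF \<rho>] hom_Zk_closed[OF \<sigma>]
  have add: "\<rho> (x + y) = \<sigma> (x + y)" if "\<rho> x = \<sigma> x" "\<rho> y = \<sigma> y" for x y
    by (simp add: hom_Zk_add[OF \<rho>] hom_Zk_add[OF \<sigma>] that)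
  have diff: "\<rho> (x - y) = \<sigma> (x - y)" if "\<rho> x = \<sigma> x" "\<rho> y = \<sigma> y" for x y
  proof -
    have "\<rho> (x - y) \<otimes>\<^bsub>G\<^esub> \<rho> y = \<sigma> (x - y) \<otimes>\<^bsub>G\<^esub> \<rho> y"
      using that hom_Zk_add[OF \<rho>, of "x - y" y] hom_Zk_add[OF \<sigma>, of "x - y" y] by simp
    then show ?thesis using closed by (simp only: G.right_cancel)
  qed
  \<comment> \<open>Zero is the difference of a basis vector with itself; any index serves.\<close>
  have zero: "\<rho> 0 = \<sigma> 0"
    using diff[OF eq eq, of undefined undefined] by simp
  have mult: "\<rho> (c *s axis i 1) = \<sigma> (c *s axis i 1)" for c i
  proof (induction c rule: int_induct[where k = 0])
    case base
    then show ?case using zero by simp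
  next
    case (step1 c)
    then show ?case
      using add[OF step1(2) eq[of i]] by (simp add: vec.scale_left_distrib)
  next
    case (step2 c)
    then show ?case
      using diff[OF step2(2) eq[of i]] by (simp add: vec.scale_left_diff_distrib)
  qed
  have "\<rho> (\<Sum>i\<in>I. x $ i *s axis i 1) = \<sigma> (\<Sum>i\<in>I. x $ i *s axis i 1)" for I x
    by (induction I rule: infinite_finite_induct) (simp_all add: zero add mult)
  then have "\<rho> x = \<sigma> x" for x
    using basis_expansion[of x] by metis
  then show ?thesis by blast
qed

text \<open>A homomorphism with prescribed values on the basis is a quadratic refinement of the cocycle
  modulo the lattice; an injection into \<open>\<nat>\<close> orders the indices so that the off-diagonal part of
  the quadratic form can be taken triangular.\<close>

lemma hom_heisenberg_exists:
  fixes w :: "'k::finite \<Rightarrow> 'f::{real_normed_field, euclidean_space} ^ ('n::finite + 'n)" and z :: "'k \<Rightarrow> 'f"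
  assumes lat: "\<And>i j. omega (w i) (w j) \<in> unit_lattice"
  obtains \<rho> where "\<rho> \<in> hom Zk (reduced_heisenberg unit_lattice)" "\<And>i. \<rho> (axis i 1) = heis_coset (w i) (z i)"
proof -
  obtain g :: "'k \<Rightarrow> nat" where g: "inj g"
    using finite_imp_inj_to_nat_seg[of "UNIV :: 'k set"] by auto
  define S where "S i j = heis_cocycle (w i) (w j)" for i j
  define Q where "Q c = (\<Sum>i\<in>UNIV. \<Sum>j\<in>UNIV. if g i < g j then c i * c j * S i j else 0)" for c :: "'k \<Rightarrow> 'f"
  \<comment> \<open>The binomial c (c - 1) / 2 has additivity defect a b and vanishes at 0 and 1: it
    absorbs the diagonal of the cocycle and leaves the values on the basis untouched.\<close>
  define D where "D c = (\<Sum>i\<in>UNIV. c i * (c i - 1) / 2 * S i i)" for c :: "'k \<Rightarrow> 'f"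
  define L where "L c = (\<Sum>i\<in>UNIV. c i * z i)" for c :: "'k \<Rightarrow> 'f"
  define cf :: "int ^ 'k \<Rightarrow> 'k \<Rightarrow> 'f" where "cf x = (\<lambda>i. of_int (x $ i))" for x
  define V where "V x = (\<Sum>i\<in>UNIV. cf x i *s w i)" for x
  define Z where "Z x = Q (cf x) + D (cf x) + L (cf x)" for x
  define \<rho> where "\<rho> x = heis_coset (V x) (Z x)" for x
  have cf_add: "cf (x + y) = (\<lambda>i. cf x i + cf y i)" for x y by (simp add: cf_def)
  have V_add: "V (x + y) = V x + V y" for x y
    by (simp add: V_def cf_add vec.scale_left_distrib sum.distrib)
  have L_add: "L (\<lambda>i. a i + b i) = L a + L b" for a b
    by (simp add: L_def sum.distrib algebra_simps)
  have D_add: "D (\<lambda>i. a i + b i) = D a + D b + (\<Sum>i\<in>UNIV. a i * b i * S i i)" for a b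
    unfolding D_def sum.distrib[symmetric] by (intro sum.cong) (auto simp: field_simps)
  have Q_add: "Q (\<lambda>i. a i + b i) = Q a + Q b + (\<Sum>i\<in>UNIV. \<Sum>j\<in>UNIV. if g i < g j then a i * b j * S i j else 0)
      + (\<Sum>i\<in>UNIV. \<Sum>j\<in>UNIV. if g i < g j then b i * a j * S i j else 0)" for a b
    unfolding Q_def sum.distrib[symmetric] by (intro sum.cong) (auto simp: algebra_simps)
  have defect: "Z x + Z y + heis_cocycle (V x) (V y) - Z (x + y) \<in> unit_lattice" for x y
  proof -
    let ?a = "cf x" and ?b = "cf y"
    have "heis_cocycle (V x) (V y) = (\<Sum>i\<in>UNIV. \<Sum>j\<in>UNIV. ?a i * ?b j * S i j)"
      by (simp add: V_def heis_cocycle_bilinear S_def)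
    also have "\<dots> = (\<Sum>i\<in>UNIV. \<Sum>j\<in>UNIV. (if g i < g j then ?a i * ?b j * S i j else 0)
        + (if g j < g i then ?a i * ?b j * S i j else 0) + (if i = j then ?a i * ?b j * S i j else 0))"
    proof (intro sum.cong refl)
      fix i j
      have "g i = g j \<longleftrightarrow> i = j" using g by (auto simp: inj_on_def)
      then show "?a i * ?b j * S i j = (if g i < g j then ?a i * ?b j * S i j else 0)
          + (if g j < g i then ?a i * ?b j * S i j else 0) + (if i = j then ?a i * ?b j * S i j else 0)"
        by (cases "g i" "g j" rule: linorder_cases) auto
    qed
    also have "\<dots> = (\<Sum>i\<in>UNIV. \<Sum>j\<in>UNIV. if g i < g j then ?a i * ?b j * S i j else 0)
        + (\<Sum>i\<in>UNIV. \<Sum>j\<in>UNIV. if g j < g i then ?a i * ?b j * S i j else 0)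
        + (\<Sum>i\<in>UNIV. ?a i * ?b i * S i i)"
      by (simp add: sum.distrib)
    also have "(\<Sum>i\<in>UNIV. \<Sum>j\<in>UNIV. if g j < g i then ?a i * ?b j * S i j else 0) =
        (\<Sum>i\<in>UNIV. \<Sum>j\<in>UNIV. if g i < g j then ?a j * ?b i * S j i else 0)"
      by (rule sum.swap)
    finally have "Z x + Z y + heis_cocycle (V x) (V y) - Z (x + y) =
        (\<Sum>i\<in>UNIV. \<Sum>j\<in>UNIV. if g i < g j then ?a j * ?b i * S j i else 0)
        - (\<Sum>i\<in>UNIV. \<Sum>j\<in>UNIV. if g i < g j then ?b i * ?a j * S i j else 0)"
      unfolding Z_def cf_add Q_add D_add L_add by simp
    \<comment> \<open>After the diagonal and one triangle have cancelled, the other triangle leaves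
      integer multiples of S j i - S i j, that is of omega (w j) (w i); this is where integrality of
      the pairings is used.\<close>
    also have "\<dots> = (\<Sum>i\<in>UNIV. \<Sum>j\<in>UNIV. if g i < g j then of_int (x $ j * y $ i) * omega (w j) (w i) else 0)"
      unfolding sum_subtractf[symmetric]
      by (intro sum.cong) (auto simp: omega_cocycle S_def cf_def algebra_simps)
    also have "\<dots> \<in> unit_lattice"
      by (intro unit_lattice_sum) (auto intro!: unit_lattice_of_int_mult lat simp del: of_int_mult)
    finally show ?thesis .
  qed
  have "\<rho> \<in> hom Zk (reduced_heisenberg unit_lattice)"
  proof (rule homI)
    show "\<rho> x \<in> carrier (reduced_heisenberg unit_lattice)" for x
      by (auto simp: \<rho>_def carrier_reduced)
    have "heis_coset (V (x + y)) (Z (x + y)) = heis_coset (V x + V y) (Z x + Z y + heis_cocycle (V x) (V y))" for x y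
      using unit_lattice_minus[OF defect[of x y]] by (simp add: heis_coset_eq_iff V_add algebra_simps)
    then show "\<rho> (x \<otimes>\<^bsub>Zk\<^esub> y) = \<rho> x \<otimes>\<^bsub>reduced_heisenberg unit_lattice\<^esub> \<rho> y" for x y
      by (simp add: \<rho>_def heis_coset_mult Zk_def)
  qed
  moreover have "\<rho> (axis i 1) = heis_coset (w i) (z i)" for i
  proof -
    have delta: "cf (axis i 1) j = (if j = i then 1 else 0)" for j by (simp add: cf_def axis_def)
    have "V (axis i 1) = (\<Sum>j\<in>UNIV. if j = i then w j else 0)"
      unfolding V_def delta by (intro sum.cong) auto
    moreover have "L (cf (axis i 1)) = (\<Sum>j\<in>UNIV. if j = i then z j else 0)"
      unfolding L_def delta by (intro sum.cong) auto
    moreover have "Q (cf (axis i 1)) = 0"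
      unfolding Q_def delta by (intro sum.neutral ballI) auto
    moreover have "D (cf (axis i 1)) = 0"
      unfolding D_def delta by (intro sum.neutral ballI) auto
    ultimately show ?thesis by (simp add: \<rho>_def Z_def)
  qed
  ultimately show thesis using that by blast
qed

lemma commutator_heis: "commutator heisenberg (heis v z) (heis w y) $ First $ Last = omega v w"
  by (simp add: heis_def commutator_heis_matrix omega_def) (simp add: heis_matrix_def)

lemma ordered_commutators_heis_coset:
  fixes \<rho> :: "int ^ 'k::finite \<Rightarrow> ('f::{field, euclidean_space}, 'n::finite) block_matrix set"
  assumes "\<And>i. \<rho> (axis i 1) = heis_coset (w i) (z i)"
  shows "ordered_commutators \<rho> = (\<chi> i j. omega (w i) (w j))"
proof -
  have "\<exists>y. (SOME h. h \<in> \<rho> (axis i 1)) = heis (w i) y" for i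
  proof -
    have "heis (w i) (z i + 0) \<in> \<rho> (axis i 1)"
      unfolding assms heis_coset_image by (rule imageI) simp
    then have "(SOME h. h \<in> \<rho> (axis i 1)) \<in> \<rho> (axis i 1)" by (rule someI)
    then show ?thesis by (auto simp: assms heis_coset_image)
  qed
  then obtain y where "\<And>i. (SOME h. h \<in> \<rho> (axis i 1)) = heis (w i) (y i)" by metis
  then show ?thesis by (simp add: ordered_commutators_def commutator_heis)
qed

definition integral_tuples :: "('k \<Rightarrow> 'f::{field, euclidean_space} ^ ('n::finite + 'n)) set" where
  "integral_tuples = {w. \<forall>i j. omega (w i) (w j) \<in> unit_lattice}"

lemma topspace_reduced_heisenberg:
  "topspace (reduced_heisenberg_topology (unit_lattice :: 'f::{real_normed_field, euclidean_space} set)) =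
    carrier (reduced_heisenberg unit_lattice :: ('f, 'n::finite) block_matrix set monoid)"
  using quotient_imp_surjective_map[OF quotient_map_heis_coset[where 'f = 'f and 'n = 'n]]
  by (simp add: carrier_reduced case_prod_unfold)

lemma topspace_Hom_heisenberg:
  "topspace (Hom_heisenberg (unit_lattice :: 'f::{real_normed_field, euclidean_space} set)) =
    hom Zk (reduced_heisenberg unit_lattice :: ('f, 'n::finite) block_matrix set monoid)"
  using hom_Zk_closed
  by (auto simp: Hom_heisenberg_def Hom_Zk_def topspace_pullback_topology topspace_reduced_heisenberg)

text \<open>Evaluation on the canonical basis is injective on homomorphisms, and its image is cut
  out by integrality of the pairings of the vector parts alone. The central coordinates are
  therefore free, and those of all basis elements are collected into one torus indexed by pairs (i,
  b).\<close>

lemma Hom_heisenberg_coordinates: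
  obtains \<Psi> \<Phi> where
    "homeomorphic_maps
      (Hom_heisenberg unit_lattice ::
        (int ^ 'k::finite \<Rightarrow> ('f::{real_normed_field, euclidean_space}, 'n::finite) block_matrix set) topology)
      (prod_topology (top_of_set (integral_tuples :: ('k \<Rightarrow> 'f ^ ('n + 'n)) set))
        (product_topology (\<lambda>_. circle) ((UNIV :: 'k set) \<times> (Basis :: 'f set)))) \<Psi> \<Phi>"
    "\<And>\<rho>. \<rho> \<in> topspace (Hom_heisenberg unit_lattice) \<Longrightarrow>
      ordered_commutators \<rho> = (\<chi> i j. omega (fst (\<Psi> \<rho>) i) (fst (\<Psi> \<rho>) j))"
proof -
  let ?X = "Hom_heisenberg unit_lattice :: (int ^ 'k \<Rightarrow> ('f, 'n) block_matrix set) topology"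
  let ?W = "integral_tuples :: ('k \<Rightarrow> 'f ^ ('n + 'n)) set"
  let ?T = "product_topology (\<lambda>_. circle) ((UNIV :: 'k set) \<times> (Basis :: 'f set))"
  let ?G = "reduced_heisenberg unit_lattice :: ('f, 'n) block_matrix set monoid"
  let ?Q = "reduced_heisenberg_topology (unit_lattice :: 'f set) :: ('f, 'n) block_matrix set topology"
  let ?P = "prod_topology (euclidean :: ('f ^ ('n + 'n)) topology) (basis_torus :: ('f \<Rightarrow> complex) topology)"
  obtain \<theta> \<eta> where hom: "homeomorphic_maps ?Q ?P \<theta> \<eta>"
    and \<theta>: "\<And>v z. \<theta> (heis_coset v z) = (v, lattice_exp z)"
    using reduced_heisenberg_coordinates by blast
  have \<theta>_cont: "continuous_map ?Q ?P \<theta>" and \<eta>_cont: "continuous_map ?P ?Q \<eta>"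
    and \<theta>\<eta>: "\<And>y. y \<in> topspace ?P \<Longrightarrow> \<theta> (\<eta> y) = y"
    using hom by (auto simp: homeomorphic_maps_def)
  have \<eta>: "\<eta> (v, lattice_exp z) = heis_coset v z" for v z
  proof -
    have "heis_coset v z \<in> topspace ?Q"
      by (auto simp: topspace_reduced_heisenberg carrier_reduced)
    then have "\<eta> (\<theta> (heis_coset v z)) = heis_coset v z"
      using hom by (simp add: homeomorphic_maps_def)
    then show ?thesis by (simp add: \<theta>)
  qed
  define \<Psi> :: "(int ^ 'k \<Rightarrow> ('f, 'n) block_matrix set) \<Rightarrow> ('k \<Rightarrow> 'f ^ ('n + 'n)) \<times> ('k \<times> 'f \<Rightarrow> complex)"
    where "\<Psi> \<rho> = (\<lambda>i. fst (\<theta> (\<rho> (axis i 1))), \<lambda>(i, b)\<in>UNIV \<times> Basis. snd (\<theta> (\<rho> (axis i 1))) b)" for \<rho>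
  define coord where "coord y i = (fst y i, \<lambda>b\<in>Basis. snd y (i, b))"
    for y :: "('k \<Rightarrow> 'f ^ ('n + 'n)) \<times> ('k \<times> 'f \<Rightarrow> complex)" and i
  \<comment> \<open>The choice is harmless, since a homomorphism is determined by its values on the
    basis.\<close>
  define \<Phi> where "\<Phi> y = (SOME \<rho>. \<rho> \<in> hom Zk ?G \<and> (\<forall>i. \<rho> (axis i 1) = \<eta> (coord y i)))" for y
  have \<Psi>_coset: "fst (\<Psi> \<rho>) = w" if "\<And>i. \<rho> (axis i 1) = heis_coset (w i) (z i)" for \<rho> w z
    by (simp add: \<Psi>_def that \<theta>)
  have cosets: "\<exists>w z. \<forall>i. \<rho> (axis i 1) = heis_coset (w i) (z i)" if "\<rho> \<in> topspace ?X" for \<rho>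
  proof -
    have "\<exists>v z. \<rho> (axis i 1) = heis_coset v z" for i
      using that hom_heis_coset[of \<rho> "axis i 1"] unfolding topspace_Hom_heisenberg by blast
    then show ?thesis by metis
  qed
  have \<Psi>_W: "fst (\<Psi> \<rho>) \<in> ?W" if \<rho>: "\<rho> \<in> topspace ?X" for \<rho>
  proof -
    obtain w z where wz: "\<And>i. \<rho> (axis i 1) = heis_coset (w i) (z i)" using cosets[OF \<rho>] by blast
    have "omega (w i) (w j) \<in> unit_lattice" for i j
      using hom_omega[OF _ wz[of i] wz[of j]] \<rho> by (simp add: topspace_Hom_heisenberg)
    then show ?thesis by (simp add: \<Psi>_coset[of \<rho> w z, OF wz] integral_tuples_def)
  qed
  have coord_P: "coord y i \<in> topspace ?P" if "y \<in> topspace (prod_topology (top_of_set ?W) ?T)" for y i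
    using that by (force simp: coord_def)
  have \<Phi>: "\<Phi> y \<in> hom Zk ?G" "\<And>i. \<Phi> y (axis i 1) = \<eta> (coord y i)"
    if y: "y \<in> topspace (prod_topology (top_of_set ?W) ?T)" for y
  proof -
    have "\<exists>z. lattice_exp z = snd (coord y i)" for i
      using coord_P[OF y, of i] lattice_exp_surj_cube[of "snd (coord y i)"]
      by (metis mem_Times_iff topspace_prod_topology)
    then obtain z where z: "\<And>i. lattice_exp (z i) = snd (coord y i)" by metis
    have "omega (fst y i) (fst y j) \<in> unit_lattice" for i j
      using y by (auto simp: integral_tuples_def)
    from hom_heisenberg_exists[of "fst y" z, OF this]
    obtain \<rho> where "\<rho> \<in> hom Zk ?G" "\<And>i. \<rho> (axis i 1) = heis_coset (fst y i) (z i)" by blast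
    moreover have "heis_coset (fst y i) (z i) = \<eta> (coord y i)" for i
      using \<eta>[of "fst y i" "z i"] by (simp add: z) (simp add: coord_def)
    ultimately have "\<exists>\<rho>. \<rho> \<in> hom Zk ?G \<and> (\<forall>i. \<rho> (axis i 1) = \<eta> (coord y i))" by auto
    from someI_ex[OF this] show "\<Phi> y \<in> hom Zk ?G" "\<And>i. \<Phi> y (axis i 1) = \<eta> (coord y i)"
      unfolding \<Phi>_def by blast+
  qed
  have coord_\<Psi>: "coord (\<Psi> \<rho>) i = \<theta> (\<rho> (axis i 1))" if \<rho>: "\<rho> \<in> topspace ?X" for \<rho> i
  proof -
    have "\<rho> (axis i 1) \<in> topspace ?Q"
      using \<rho> hom_Zk_closed by (auto simp: topspace_Hom_heisenberg topspace_reduced_heisenberg)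
    then have "\<theta> (\<rho> (axis i 1)) \<in> topspace ?P"
      using \<theta>_cont by (auto simp: continuous_map_def)
    then have "snd (\<theta> (\<rho> (axis i 1))) \<in> extensional Basis" by (auto simp: PiE_def)
    then show ?thesis
      by (simp add: coord_def \<Psi>_def prod_eq_iff fun_eq_iff restrict_def extensional_def)
  qed
  have eval_cont: "continuous_map ?X ?P (\<lambda>\<rho>. \<theta> (\<rho> (axis i 1)))" for i
  proof -
    have "continuous_map ?X ?Q ((\<lambda>x. x i) \<circ> (\<lambda>\<rho> i. \<rho> (axis i 1)))"
      unfolding Hom_heisenberg_def Hom_Zk_def
      by (intro continuous_map_pullback continuous_map_product_projection) simp
    from continuous_map_compose[OF this \<theta>_cont] show ?thesis by (simp add: o_def)
  qed
  have "continuous_map ?X (product_topology (\<lambda>i. euclidean) UNIV) (\<lambda>\<rho>. fst (\<Psi> \<rho>))"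
    unfolding continuous_map_componentwise_UNIV
    using continuous_map_compose[OF eval_cont continuous_map_fst] by (simp add: \<Psi>_def o_def)
  then have "continuous_map ?X (top_of_set ?W) (\<lambda>\<rho>. fst (\<Psi> \<rho>))"
    using \<Psi>_W by (auto simp: continuous_map_in_subtopology euclidean_product_topology)
  moreover have "continuous_map ?X ?T (\<lambda>\<rho>. snd (\<Psi> \<rho>))"
    unfolding continuous_map_componentwise
  proof (intro conjI ballI)
    fix k assume "k \<in> (UNIV :: 'k set) \<times> (Basis :: 'f set)"
    then obtain i b where k: "k = (i, b)" "b \<in> Basis" by blast
    have "continuous_map ?X circle ((\<lambda>\<tau>. \<tau> b) \<circ> (snd \<circ> (\<lambda>\<rho>. \<theta> (\<rho> (axis i 1)))))"
      by (intro continuous_map_compose[OF continuous_map_compose[OF eval_cont continuous_map_snd]]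
          continuous_map_product_projection k)
    then show "continuous_map ?X circle (\<lambda>\<rho>. snd (\<Psi> \<rho>) k)"
      using k by (simp add: \<Psi>_def o_def)
  qed (auto simp: \<Psi>_def)
  ultimately have \<Psi>_cont: "continuous_map ?X (prod_topology (top_of_set ?W) ?T) \<Psi>"
    by (simp add: continuous_map_pairwise o_def)
  have coord_cont: "continuous_map (prod_topology (top_of_set ?W) ?T) ?P (\<lambda>y. coord y i)" for i
    unfolding coord_def
  proof (intro continuous_map_pairedI)
    have "continuous_map (top_of_set ?W) euclidean (\<lambda>w. w i)"
      unfolding continuous_map_iff_continuous
      by (rule continuous_on_product_then_coordinatewise[OF continuous_on_id])
    from continuous_map_compose[OF continuous_map_fst this]
    show "continuous_map (prod_topology (top_of_set ?W) ?T) euclidean (\<lambda>y. fst y i)"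
      by (simp add: o_def)
    have "continuous_map (prod_topology (top_of_set ?W) ?T) circle (\<lambda>y. snd y (i, b))" if "b \<in> Basis" for b
    proof -
      have "continuous_map ?T circle (\<lambda>\<tau>. \<tau> (i, b))"
        using that by (intro continuous_map_product_projection) simp
      from continuous_map_compose[OF continuous_map_snd this] show ?thesis by (simp add: o_def)
    qed
    then show "continuous_map (prod_topology (top_of_set ?W) ?T) basis_torus (\<lambda>y. \<lambda>b\<in>Basis. snd y (i, b))"
      by (auto simp: continuous_map_componentwise)
  qed
  \<comment> \<open>The topology on homomorphisms is pulled back along evaluation, so continuity of
    the chosen \<open>\<Phi>\<close> depends only on its values on the basis, which are
    explicit.\<close>
  have \<Phi>_cont: "continuous_map (prod_topology (top_of_set ?W) ?T) ?X \<Phi>"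
    unfolding Hom_heisenberg_def Hom_Zk_def
  proof (rule continuous_map_pullback')
    have "continuous_map (prod_topology (top_of_set ?W) ?T) (product_topology (\<lambda>i. ?Q) UNIV) (\<lambda>y i. \<eta> (coord y i))"
      unfolding continuous_map_componentwise_UNIV
      using continuous_map_compose[OF coord_cont \<eta>_cont] by (simp add: o_def)
    then show "continuous_map (prod_topology (top_of_set ?W) ?T) (product_topology (\<lambda>i. ?Q) UNIV)
        ((\<lambda>\<rho> i. \<rho> (axis i 1)) \<circ> \<Phi>)"
      by (rule continuous_map_eq) (auto simp: \<Phi>(2))
    show "topspace (prod_topology (top_of_set ?W) ?T) \<subseteq> \<Phi> -` hom Zk ?G"
      using \<Phi>(1) by blast
  qed
  have "\<Phi> (\<Psi> \<rho>) = \<rho>" if \<rho>: "\<rho> \<in> topspace ?X" for \<rho>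
  proof -
    have "\<Psi> \<rho> \<in> topspace (prod_topology (top_of_set ?W) ?T)"
      using \<Psi>_cont \<rho> by (auto simp: continuous_map_def)
    note \<Phi>' = \<Phi>[OF this]
    have "\<Phi> (\<Psi> \<rho>) (axis i 1) = \<rho> (axis i 1)" for i
    proof -
      obtain w z where "\<And>i. \<rho> (axis i 1) = heis_coset (w i) (z i)" using cosets[OF \<rho>] by blast
      then show ?thesis by (simp add: \<Phi>'(2) coord_\<Psi>[OF \<rho>] \<theta> \<eta>)
    qed
    then show ?thesis
      using \<rho> \<Phi>'(1) by (intro hom_Zk_unique[OF group_reduced]) (auto simp: topspace_Hom_heisenberg)
  qed
  moreover have "\<Psi> (\<Phi> y) = y" if y: "y \<in> topspace (prod_topology (top_of_set ?W) ?T)" for y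
  proof -
    have "\<theta> (\<Phi> y (axis i 1)) = coord y i" for i
      by (simp add: \<Phi>(2)[OF y] \<theta>\<eta>[OF coord_P[OF y]])
    moreover have "snd y \<in> extensional (UNIV \<times> Basis)"
      using y by (auto simp: PiE_def)
    ultimately show ?thesis
      by (auto simp: \<Psi>_def coord_def prod_eq_iff fun_eq_iff restrict_def extensional_def)
  qed
  ultimately have maps: "homeomorphic_maps ?X (prod_topology (top_of_set ?W) ?T) \<Psi> \<Phi>"
    using \<Psi>_cont \<Phi>_cont by (simp add: homeomorphic_maps_def)
  have comm: "ordered_commutators \<rho> = (\<chi> i j. omega (fst (\<Psi> \<rho>) i) (fst (\<Psi> \<rho>) j))"
    if \<rho>: "\<rho> \<in> topspace ?X" for \<rho>
  proof -
    obtain w z where wz: "\<And>i. \<rho> (axis i 1) = heis_coset (w i) (z i)" using cosets[OF \<rho>] by blast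
    then show ?thesis by (simp add: ordered_commutators_heis_coset[of \<rho> w z, OF wz] \<Psi>_coset[of \<rho> w z, OF wz])
  qed
  show thesis by (rule that[OF maps comm])
qed

section \<open>Components of the space of homomorphisms\<close>

definition commutator_fibre ::
    "'f::{real_normed_field, euclidean_space} ^ 'k::finite ^ 'k \<Rightarrow> (int ^ 'k \<Rightarrow> ('f, 'n::finite) block_matrix set) set"
  where "commutator_fibre \<beta> = {\<rho> \<in> topspace (Hom_heisenberg unit_lattice). ordered_commutators \<rho> = \<beta>}"

lemma commutator_fibre_homeomorphic:
  fixes \<beta> :: "'f::{real_normed_field, euclidean_space} ^ 'k::finite ^ 'k"
  assumes "\<beta> \<in> Ant unit_lattice"
  shows "subtopology (Hom_heisenberg unit_lattice ::
      (int ^ 'k \<Rightarrow> ('f, 'n::finite) block_matrix set) topology) (commutator_fibre \<beta>)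
    homeomorphic_space
    prod_topology (top_of_set (realizations \<beta> :: ('k \<Rightarrow> 'f ^ ('n + 'n)) set)) (torus (CARD('k) * DIM('f)))"
proof -
  let ?X = "Hom_heisenberg unit_lattice :: (int ^ 'k \<Rightarrow> ('f, 'n) block_matrix set) topology"
  let ?W = "integral_tuples :: ('k \<Rightarrow> 'f ^ ('n + 'n)) set"
  let ?R = "realizations \<beta> :: ('k \<Rightarrow> 'f ^ ('n + 'n)) set"
  let ?T = "product_topology (\<lambda>_. circle) ((UNIV :: 'k set) \<times> (Basis :: 'f set))"
  obtain \<Psi> \<Phi> where hom: "homeomorphic_maps ?X (prod_topology (top_of_set ?W) ?T) \<Psi> \<Phi>"
    and comm: "\<And>\<rho>. \<rho> \<in> topspace ?X \<Longrightarrow> ordered_commutators \<rho> = (\<chi> i j. omega (fst (\<Psi> \<rho>) i) (fst (\<Psi> \<rho>) j))"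
    by (rule Hom_heisenberg_coordinates) blast
  have fst_\<Psi>: "fst (\<Psi> \<rho>) \<in> ?R \<longleftrightarrow> ordered_commutators \<rho> = \<beta>" if "\<rho> \<in> topspace ?X" for \<rho>
    by (simp add: comm[OF that] realizations_def vec_eq_iff)
  have \<Phi>\<Psi>: "\<Phi> y \<in> topspace ?X" "\<Psi> (\<Phi> y) = y" if "y \<in> topspace (prod_topology (top_of_set ?W) ?T)" for y
    using that hom by (auto simp: homeomorphic_maps_def continuous_map_def Pi_iff)
  have "homeomorphic_maps (subtopology ?X (commutator_fibre \<beta>))
      (subtopology (prod_topology (top_of_set ?W) ?T) (?R \<times> UNIV)) \<Psi> \<Phi>"
  proof (rule homeomorphic_maps_subtopologies_alt[OF hom])
    show "\<Psi> ` (topspace ?X \<inter> commutator_fibre \<beta>) \<subseteq> ?R \<times> UNIV"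
      by (rule image_subsetI) (simp add: fst_\<Psi> commutator_fibre_def mem_Times_iff)
    show "\<Phi> ` (topspace (prod_topology (top_of_set ?W) ?T) \<inter> ?R \<times> UNIV) \<subseteq> commutator_fibre \<beta>"
    proof (rule image_subsetI)
      fix y assume y: "y \<in> topspace (prod_topology (top_of_set ?W) ?T) \<inter> ?R \<times> UNIV"
      then have "\<Phi> y \<in> topspace ?X" "\<Psi> (\<Phi> y) = y" using \<Phi>\<Psi>[of y] by blast+
      then show "\<Phi> y \<in> commutator_fibre \<beta>"
        using y fst_\<Psi>[of "\<Phi> y"] by (simp add: commutator_fibre_def mem_Times_iff)
    qed
  qed
  moreover have "subtopology (prod_topology (top_of_set ?W) ?T) (?R \<times> UNIV) = prod_topology (top_of_set ?R) ?T"
  proof -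
    have "?W \<inter> ?R = ?R"
      using assms by (auto simp: integral_tuples_def realizations_def Ant_def)
    then show ?thesis by (simp add: subtopology_Times subtopology_subtopology)
  qed
  ultimately have "subtopology ?X (commutator_fibre \<beta>) homeomorphic_space prod_topology (top_of_set ?R) ?T"
    unfolding homeomorphic_space_def by auto
  moreover have "?T homeomorphic_space torus (CARD('k) * DIM('f))"
    using homeomorphic_torus[of "(UNIV :: 'k set) \<times> (Basis :: 'f set)"] by (simp add: card_cartesian_product)
  then have "prod_topology (top_of_set ?R) ?T homeomorphic_space prod_topology (top_of_set ?R) (torus (CARD('k) * DIM('f)))"
    by (intro homeomorphic_space_prod_topology homeomorphic_space_refl)
  ultimately show ?thesis by (rule homeomorphic_space_trans)
qed

lemma torus_nonempty: "topspace (torus m) \<noteq> {}"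
proof -
  have "(\<lambda>i\<in>{..<m}. 1) \<in> topspace (torus m)" by (simp add: torus_def)
  then show ?thesis by blast
qed

lemma path_connected_torus: "path_connected_space (torus m)"
  unfolding torus_def by (rule path_connected_circle_product)

lemma commutator_fibre_nonempty_iff:
  fixes \<beta> :: "'f::{real_normed_field, euclidean_space} ^ 'k::finite ^ 'k"
  assumes "\<beta> \<in> Ant unit_lattice"
  shows "(commutator_fibre \<beta> :: (int ^ 'k \<Rightarrow> ('f, 'n::finite) block_matrix set) set) \<noteq> {} \<longleftrightarrow>
    (realizations \<beta> :: ('k \<Rightarrow> 'f ^ ('n + 'n)) set) \<noteq> {}"
proof -
  let ?X = "Hom_heisenberg unit_lattice :: (int ^ 'k \<Rightarrow> ('f, 'n) block_matrix set) topology"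
  have "topspace (subtopology ?X (commutator_fibre \<beta>)) = {} \<longleftrightarrow>
      topspace (prod_topology (top_of_set (realizations \<beta> :: ('k \<Rightarrow> 'f ^ ('n + 'n)) set))
        (torus (CARD('k) * DIM('f)))) = {}"
    using homeomorphic_empty_space[OF commutator_fibre_homeomorphic[OF assms]]
    by (simp only: null_topspace_iff_trivial)
  moreover have "topspace (subtopology ?X (commutator_fibre \<beta>)) = commutator_fibre \<beta>"
    by (auto simp: commutator_fibre_def)
  ultimately show ?thesis
    using torus_nonempty by (simp del: null_topspace_iff_trivial)
qed

lemma path_connected_commutator_fibre:
  fixes \<beta> :: "'f::{real_normed_field, euclidean_space} ^ 'k::finite ^ 'k"
  assumes "\<beta> \<in> Ant unit_lattice"
  shows "path_connectedin (Hom_heisenberg unit_lattice ::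
    (int ^ 'k \<Rightarrow> ('f, 'n::finite) block_matrix set) topology) (commutator_fibre \<beta>)"
proof -
  let ?R = "realizations \<beta> :: ('k \<Rightarrow> 'f ^ ('n + 'n)) set"
  obtain r p q where "complete_system \<beta> r p q"
    using complete_system_exists[of \<beta>] assms by (auto simp: Ant_def)
  then have "path_connected ?R" by (rule complete_system.path_connected_realizations)
  then have "path_connected_space (top_of_set ?R)"
    using path_connectedin_subtopology[of euclidean ?R ?R] by (simp flip: path_connectedin_topspace)
  then have "path_connected_space (prod_topology (top_of_set ?R) (torus (CARD('k) * DIM('f))))"
    using path_connected_torus by (subst path_connected_space_prod_topology) blast
  then show ?thesis
    using homeomorphic_path_connected_space[OF commutator_fibre_homeomorphic[OF assms]]
    by (auto simp: path_connectedin_def commutator_fibre_def)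
qed

text \<open>Two inclusions: commutators are constant along C, so C lies in a fibre; and that fibre
  is path connected and meets C, so it lies in C.\<close>

lemma pi0_commutator_fibre:
  fixes C :: "(int ^ 'k::finite \<Rightarrow> ('f::{real_normed_field, euclidean_space}, 'n::finite) block_matrix set) set"
  assumes C: "C \<in> pi0 (Hom_heisenberg unit_lattice)" and \<rho>: "\<rho> \<in> C"
  shows "ordered_commutators \<rho> \<in> Ant unit_lattice" "C = commutator_fibre (ordered_commutators \<rho>)"
proof -
  let ?X = "Hom_heisenberg unit_lattice :: (int ^ 'k \<Rightarrow> ('f, 'n) block_matrix set) topology"
  let ?W = "integral_tuples :: ('k \<Rightarrow> 'f ^ ('n + 'n)) set"
  let ?T = "product_topology (\<lambda>_. circle) ((UNIV :: 'k set) \<times> (Basis :: 'f set))"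
  obtain \<Psi> \<Phi> where hom: "homeomorphic_maps ?X (prod_topology (top_of_set ?W) ?T) \<Psi> \<Phi>"
    and comm: "\<And>\<rho>. \<rho> \<in> topspace ?X \<Longrightarrow> ordered_commutators \<rho> = (\<chi> i j. omega (fst (\<Psi> \<rho>) i) (fst (\<Psi> \<rho>) j))"
    by (rule Hom_heisenberg_coordinates) blast
  have \<Psi>: "continuous_map ?X (prod_topology (top_of_set ?W) ?T) \<Psi>"
    using hom by (simp add: homeomorphic_maps_def)
  have C_sub: "C \<subseteq> topspace ?X" and C_conn: "path_connectedin ?X C"
    using C by (auto simp: pi0_def path_components_of_subset path_connectedin_path_components_of)
  have integral: "omega (fst (\<Psi> \<sigma>) i) (fst (\<Psi> \<sigma>) j) \<in> unit_lattice" if "\<sigma> \<in> topspace ?X" for \<sigma> i j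
  proof -
    have "\<Psi> \<sigma> \<in> topspace (prod_topology (top_of_set ?W) ?T)"
      using \<Psi> that by (auto simp: continuous_map_def)
    then have "fst (\<Psi> \<sigma>) \<in> ?W" by auto
    then show ?thesis by (simp add: integral_tuples_def)
  qed
  show Ant: "ordered_commutators \<rho> \<in> Ant unit_lattice"
    using integral \<rho> C_sub omega.skew
    by (auto simp: Ant_def comm transpose_def vec_eq_iff subset_iff)
  have const: "ordered_commutators \<sigma> = ordered_commutators \<rho>" if \<sigma>: "\<sigma> \<in> C" for \<sigma>
  proof -
    have "omega (fst (\<Psi> \<sigma>) i) (fst (\<Psi> \<sigma>) j) = omega (fst (\<Psi> \<rho>) i) (fst (\<Psi> \<rho>) j)" for i j
    proof (rule ccontr)
      let ?f = "\<lambda>\<tau>. omega (fst (\<Psi> \<tau>) i) (fst (\<Psi> \<tau>) j)"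
      assume neq: "?f \<sigma> \<noteq> ?f \<rho>"
      have w: "continuous_on ?W (\<lambda>w. w i)" for i
        by (rule continuous_on_product_then_coordinatewise[OF continuous_on_id])
      have "continuous_map (top_of_set ?W) euclidean (\<lambda>w. omega (w i) (w j))"
        unfolding continuous_map_iff_continuous by (intro continuous_on_omega w)
      from continuous_map_compose[OF continuous_map_compose[OF \<Psi> continuous_map_fst] this]
      have "continuous_map ?X euclidean ?f" by (simp add: o_def)
      then have "path_connectedin euclidean (?f ` C)"
        by (rule path_connectedin_continuous_map_image) (rule C_conn)
      then have "connected (?f ` C)"
        by (simp add: path_connected_imp_connected)
      \<comment> \<open>A connected set with two different points is uncountable, whereas all values
        lie in the countable lattice.\<close>
      then have "uncountable (?f ` C)"
        by (rule connected_uncountable) (use \<sigma> \<rho> neq in auto)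
      moreover have "?f ` C \<subseteq> unit_lattice"
        using integral C_sub by auto
      ultimately show False
        using countable_lattice countable_subset by blast
    qed
    then show ?thesis using \<sigma> \<rho> C_sub by (simp add: comm subset_iff)
  qed
  show "C = commutator_fibre (ordered_commutators \<rho>)"
  proof
    show "C \<subseteq> commutator_fibre (ordered_commutators \<rho>)"
      using const C_sub by (auto simp: commutator_fibre_def)
    have "\<rho> \<in> commutator_fibre (ordered_commutators \<rho>)"
      using \<rho> C_sub by (auto simp: commutator_fibre_def)
    then show "commutator_fibre (ordered_commutators \<rho>) \<subseteq> C"
      using C \<rho> path_connected_commutator_fibre[OF Ant]
      by (intro path_components_of_maximal[of C ?X]) (auto simp: pi0_def disjnt_iff)
  qed
qed

lemma pi0_commutators_eq:
  fixes C :: "(int ^ 'k::finite \<Rightarrow> ('f::{real_normed_field, euclidean_space}, 'n::finite) block_matrix set) set"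
  assumes "C \<in> pi0 (Hom_heisenberg unit_lattice)" "\<rho> \<in> C"
  shows "pi0_commutators C = ordered_commutators \<rho>"
proof -
  have "ordered_commutators ` C = {ordered_commutators \<rho>}"
    using assms(2) pi0_commutator_fibre(2)[OF assms] by (auto simp: commutator_fibre_def)
  then show ?thesis by (simp add: pi0_commutators_def)
qed

lemma pi0_eq_fibre:
  fixes C :: "(int ^ 'k::finite \<Rightarrow> ('f::{real_normed_field, euclidean_space}, 'n::finite) block_matrix set) set"
  assumes "C \<in> pi0 (Hom_heisenberg unit_lattice)"
  shows "C = commutator_fibre (pi0_commutators C)" "pi0_commutators C \<in> Ant unit_lattice"
proof -
  obtain \<rho> where "\<rho> \<in> C" using assms nonempty_path_components_of unfolding pi0_def by blast
  then show "C = commutator_fibre (pi0_commutators C)" "pi0_commutators C \<in> Ant unit_lattice"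
    using pi0_commutator_fibre[OF assms] pi0_commutators_eq[OF assms] by simp_all
qed

lemma pi0_commutators_image:
  "pi0_commutators ` pi0 (Hom_heisenberg unit_lattice ::
      (int ^ 'k \<Rightarrow> ('f, 'n) block_matrix set) topology) =
    {\<beta> \<in> Ant (unit_lattice :: 'f::{real_normed_field, euclidean_space} set).
      (commutator_fibre \<beta> :: (int ^ 'k::finite \<Rightarrow> ('f, 'n::finite) block_matrix set) set) \<noteq> {}}"
proof (intro equalityI subsetI)
  fix \<beta> :: "'f ^ 'k ^ 'k"
  assume "\<beta> \<in> pi0_commutators ` pi0 (Hom_heisenberg unit_lattice :: (int ^ 'k \<Rightarrow> ('f, 'n) block_matrix set) topology)"
  then obtain C :: "(int ^ 'k \<Rightarrow> ('f, 'n) block_matrix set) set"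
    where C: "C \<in> pi0 (Hom_heisenberg unit_lattice)" "\<beta> = pi0_commutators C" by blast
  then have "C \<noteq> {}" using nonempty_path_components_of unfolding pi0_def by blast
  then show "\<beta> \<in> {\<beta> \<in> Ant unit_lattice. (commutator_fibre \<beta> :: (int ^ 'k \<Rightarrow> ('f, 'n) block_matrix set) set) \<noteq> {}}"
    using pi0_eq_fibre[OF C(1)] C(2) by auto
next
  fix \<beta> :: "'f ^ 'k ^ 'k"
  assume "\<beta> \<in> {\<beta> \<in> Ant unit_lattice. (commutator_fibre \<beta> :: (int ^ 'k \<Rightarrow> ('f, 'n) block_matrix set) set) \<noteq> {}}"
  then obtain \<rho> :: "int ^ 'k \<Rightarrow> ('f, 'n) block_matrix set"
    where \<rho>: "\<rho> \<in> topspace (Hom_heisenberg unit_lattice)" "ordered_commutators \<rho> = \<beta>"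
    by (auto simp: commutator_fibre_def)
  let ?C = "Collect (path_component_of (Hom_heisenberg unit_lattice) \<rho>)"
  have C: "?C \<in> pi0 (Hom_heisenberg unit_lattice)" and "\<rho> \<in> ?C"
    using \<rho>(1) by (simp_all add: pi0_def path_component_in_path_components_of path_component_of_refl)
  from pi0_commutators_eq[OF this] have "\<beta> = pi0_commutators ?C" by (simp only: \<rho>(2))
  then show "\<beta> \<in> pi0_commutators ` pi0 (Hom_heisenberg unit_lattice :: (int ^ 'k \<Rightarrow> ('f, 'n) block_matrix set) topology)"
    using C by (rule image_eqI)
qed

section \<open>The surjectivity criterion\<close>

lemma maximal_rank_form_exists:
  assumes "1 \<in> (unit_lattice :: 'f::{real_normed_field, euclidean_space} set)"
  obtains \<beta> :: "'f::{real_normed_field, euclidean_space} ^ 'k::finite ^ 'k" and p q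
  where "\<beta> \<in> Ant unit_lattice" "hyperbolic (bilinear_form \<beta>) (CARD('k) div 2) p q"
proof -
  obtain h :: "'k \<Rightarrow> nat" where h: "bij_betw h UNIV {..<CARD('k)}"
    using finite_same_card_bij[of "UNIV :: 'k set" "{..<CARD('k)}"] by auto
  define g where "g = inv_into UNIV h"
  have hg: "h (g m) = m" if "m < CARD('k)" for m
    using h that by (auto simp: g_def bij_betw_def f_inv_into_f)
  \<comment> \<open>Block diagonal matrix with blocks (0, 1; -1, 0) on the index pairs 2i and 2i +
    1. When the number of indices is odd, the partner of the last one is out of range and that index
    falls into the radical.\<close>
  define F :: "nat \<Rightarrow> nat \<Rightarrow> 'f" where
    "F m n = (if even m \<and> n = Suc m then 1 else if even n \<and> m = Suc n then - 1 else 0)" for m n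
  define \<beta> :: "'f ^ 'k ^ 'k" where "\<beta> = (\<chi> a b. F (h a) (h b))"
  have skew: "F m n = - F n m" for m n by (auto simp: F_def)
  have "transpose \<beta> $ a $ b = (- \<beta>) $ a $ b" for a b
    using skew[of "h b" "h a"] by (simp add: transpose_def \<beta>_def)
  then have "transpose \<beta> = - \<beta>" by (simp only: vec_eq_iff) blast
  moreover have "F m n \<in> unit_lattice" for m n
    using assms unit_lattice_minus[OF assms] by (auto simp: F_def)
  ultimately have "\<beta> \<in> Ant unit_lattice"
    by (simp add: Ant_def) (simp add: \<beta>_def)
  moreover have "hyperbolic (bilinear_form \<beta>) (CARD('k) div 2)
      (\<lambda>i. axis (g (2 * i)) 1) (\<lambda>i. axis (g (Suc (2 * i))) 1)"
  proof -
    have "2 * i < CARD('k)" "Suc (2 * i) < CARD('k)" if "i < CARD('k) div 2" for i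
      using that by linarith+
    then show ?thesis
      unfolding hyperbolic_def bilinear_form_axis by (auto simp: \<beta>_def hg F_def)
  qed
  ultimately show thesis using that by blast
qed

lemma hyperbolic_realization:
  fixes \<beta> :: "'f::field_char_0 ^ 'k ^ 'k::finite"
  assumes "w \<in> realizations \<beta>" "hyperbolic (bilinear_form \<beta>) s p q"
  shows "hyperbolic omega s (\<lambda>i. lincomb w (p i)) (\<lambda>i. lincomb w (q i))"
  using assms(2) by (simp add: hyperbolic_def omega_lincomb[OF assms(1)])

text \<open>A realization of a form of maximal rank carries its hyperbolic system into V, whose
  dimension 2n bounds the length. Conversely a complete system of any form satisfies 2r \<le> k, so
  r \<le> n and the form is realizable.\<close>

lemma pi0_commutators_surj_iff:
  assumes "1 \<in> (unit_lattice :: 'f::{real_normed_field, euclidean_space} set)"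
  shows "pi0_commutators ` pi0 (Hom_heisenberg unit_lattice ::
      (int ^ 'k::finite \<Rightarrow> ('f, 'n::finite) block_matrix set) topology) = Ant unit_lattice \<longleftrightarrow>
    CARD('k) div 2 \<le> CARD('n)"
proof
  assume surj: "pi0_commutators ` pi0 (Hom_heisenberg unit_lattice ::
      (int ^ 'k \<Rightarrow> ('f, 'n) block_matrix set) topology) = Ant unit_lattice"
  obtain \<beta> :: "'f ^ 'k ^ 'k" and p q
    where \<beta>: "\<beta> \<in> Ant unit_lattice" "hyperbolic (bilinear_form \<beta>) (CARD('k) div 2) p q"
    by (rule maximal_rank_form_exists[OF assms])
  from \<beta>(1) have "\<beta> \<in> pi0_commutators ` pi0 (Hom_heisenberg unit_lattice ::
      (int ^ 'k \<Rightarrow> ('f, 'n) block_matrix set) topology)"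
    by (simp only: surj)
  then have "(commutator_fibre \<beta> :: (int ^ 'k \<Rightarrow> ('f, 'n) block_matrix set) set) \<noteq> {}"
    unfolding pi0_commutators_image by simp
  then obtain w :: "'k \<Rightarrow> 'f ^ ('n + 'n)" where "w \<in> realizations \<beta>"
    unfolding commutator_fibre_nonempty_iff[OF \<beta>(1)] by blast
  from omega.hyperbolic_bound[OF hyperbolic_realization[OF this \<beta>(2)]]
  show "CARD('k) div 2 \<le> CARD('n)" by simp
next
  assume le: "CARD('k) div 2 \<le> CARD('n)"
  have "(commutator_fibre \<beta> :: (int ^ 'k \<Rightarrow> ('f, 'n) block_matrix set) set) \<noteq> {}"
    if \<beta>: "\<beta> \<in> Ant unit_lattice" for \<beta> :: "'f ^ 'k ^ 'k"
  proof -
    obtain r p q where "complete_system \<beta> r p q"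
      using complete_system_exists[of \<beta>] \<beta> by (auto simp: Ant_def)
    then interpret complete_system \<beta> r p q .
    have "r \<le> CARD('n)" using rank_le le by linarith
    then show ?thesis
      unfolding commutator_fibre_nonempty_iff[OF \<beta>] realizations_nonempty_iff .
  qed
  then show "pi0_commutators ` pi0 (Hom_heisenberg unit_lattice ::
      (int ^ 'k \<Rightarrow> ('f, 'n) block_matrix set) topology) = Ant unit_lattice"
    unfolding pi0_commutators_image by blast
qed

section \<open>The homotopy type of the components\<close>

lemma homotopy_equivalent_space_prod_left:
  assumes "X homotopy_equivalent_space X'"
  shows "prod_topology X Y homotopy_equivalent_space prod_topology X' Y"
proof -
  obtain f g where f: "continuous_map X X' f" and g: "continuous_map X' X g"
    and gf: "homotopic_with (\<lambda>x. True) X X (g \<circ> f) id" and fg: "homotopic_with (\<lambda>x. True) X' X' (f \<circ> g) id"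
    using assms by (auto simp: homotopy_equivalent_space_def)
  have id: "homotopic_with (\<lambda>x. True) Y Y id id" by (simp add: homotopic_with_refl)
  let ?F = "\<lambda>z. (f (fst z), snd z)" and ?G = "\<lambda>z. (g (fst z), snd z)"
  have "continuous_map (prod_topology X Y) (prod_topology X' Y) ?F"
    using continuous_map_compose[OF continuous_map_fst f]
    by (intro continuous_map_pairedI continuous_map_snd) (simp add: o_def)
  moreover have "continuous_map (prod_topology X' Y) (prod_topology X Y) ?G"
    using continuous_map_compose[OF continuous_map_fst g]
    by (intro continuous_map_pairedI continuous_map_snd) (simp add: o_def)
  moreover have "homotopic_with (\<lambda>x. True) (prod_topology X Y) (prod_topology X Y) (?G \<circ> ?F) id"
    by (rule homotopic_with_eq[OF homotopic_with_prod_topology[OF gf id, of "\<lambda>_. True"]]) auto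
  moreover have "homotopic_with (\<lambda>x. True) (prod_topology X' Y) (prod_topology X' Y) (?F \<circ> ?G) id"
    by (rule homotopic_with_eq[OF homotopic_with_prod_topology[OF fg id, of "\<lambda>_. True"]]) auto
  ultimately show ?thesis unfolding homotopy_equivalent_space_def by blast
qed

text \<open>The torus factor is carried along unchanged while realizations are replaced by frames
  and these by the Stiefel manifold. One complete system yields both the frame length r and the rank
  2r.\<close>

lemma commutator_fibre_homotopy_equivalent:
  fixes cj :: "'f::{real_normed_field, euclidean_space} \<Rightarrow> 'f"
    and dcj :: "'d::{ring_1, topological_space} \<Rightarrow> 'd"
    and \<beta> :: "'f ^ 'k::finite ^ 'k"
  assumes double: "hermitian_double cj dcj mk p1 p2" and \<beta>: "\<beta> \<in> Ant unit_lattice"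
  shows "\<exists>r. 2 * r = rank_adjoint \<beta> \<and>
    subtopology (Hom_heisenberg unit_lattice ::
      (int ^ 'k \<Rightarrow> ('f, 'n::finite) block_matrix set) topology) (commutator_fibre \<beta>)
    homotopy_equivalent_space
    prod_topology (stiefel dcj r :: (nat \<Rightarrow> 'd ^ 'n) topology) (torus (CARD('k) * DIM('f)))"
proof -
  obtain r p q where "complete_system \<beta> r p q"
    using complete_system_exists[of \<beta>] \<beta> by (auto simp: Ant_def)
  then interpret complete_system \<beta> r p q .
  interpret hermitian_double cj dcj mk p1 p2 by fact
  note homeomorphic_imp_homotopy_equivalent_space[OF commutator_fibre_homeomorphic[OF \<beta>, where 'n = 'n]]
  moreover note homotopy_equivalent_space_prod_left[OF homotopy_eqv_trans[OF
      realizations_homotopy_equivalent_frames frames_homotopy_equivalent_stiefel[where 'n = 'n]]]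
  ultimately show ?thesis
    using rank_adjoint_eq by (intro exI[of _ r] conjI) (auto intro: homotopy_eqv_trans)
qed

lemma pi0_Hom_heisenberg:
  fixes cj :: "'f::{real_normed_field, euclidean_space} \<Rightarrow> 'f"
    and dcj :: "'d::{ring_1, topological_space} \<Rightarrow> 'd"
  assumes double: "hermitian_double cj dcj mk p1 p2" and one: "1 \<in> (unit_lattice :: 'f set)"
  shows "let X = (Hom_heisenberg unit_lattice ::
      (int ^ 'k::finite \<Rightarrow> ('f, 'n::finite) block_matrix set) topology)
    in (\<forall>C\<in>pi0 X. \<forall>\<rho>\<in>C. ordered_commutators \<rho> \<in> Ant unit_lattice \<and>
                        pi0_commutators C = ordered_commutators \<rho>)
     \<and> inj_on pi0_commutators (pi0 X)
     \<and> (pi0_commutators ` pi0 X = Ant unit_lattice \<longleftrightarrow> CARD('k) div 2 \<le> CARD('n))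
     \<and> (\<forall>\<beta>\<in>Ant unit_lattice. \<forall>C\<in>pi0 X. pi0_commutators C = \<beta> \<longrightarrow>
          (\<exists>r. 2 * r = rank_adjoint \<beta> \<and>
            subtopology X C homotopy_equivalent_space
              prod_topology (stiefel dcj r :: (nat \<Rightarrow> 'd ^ 'n) topology)
                (torus (CARD('k) * DIM('f)))))"
  unfolding Let_def
proof (intro conjI ballI impI)
  show "inj_on pi0_commutators (pi0 (Hom_heisenberg unit_lattice ::
      (int ^ 'k \<Rightarrow> ('f, 'n) block_matrix set) topology))"
    by (rule inj_onI) (metis pi0_eq_fibre(1))
next
  fix \<beta> :: "'f ^ 'k ^ 'k" and C :: "(int ^ 'k \<Rightarrow> ('f, 'n) block_matrix set) set"
  assume "\<beta> \<in> Ant unit_lattice" "C \<in> pi0 (Hom_heisenberg unit_lattice)" "pi0_commutators C = \<beta>"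
  then show "\<exists>r. 2 * r = rank_adjoint \<beta> \<and>
      subtopology (Hom_heisenberg unit_lattice) C homotopy_equivalent_space
        prod_topology (stiefel dcj r :: (nat \<Rightarrow> 'd ^ 'n) topology) (torus (CARD('k) * DIM('f)))"
    using commutator_fibre_homotopy_equivalent[OF double, of \<beta>, where 'n = 'n] pi0_eq_fibre(1)[of C] by simp
qed (use pi0_commutator_fibre(1) pi0_commutators_eq pi0_commutators_surj_iff[OF one] in blast)+

section \<open>The real and the complex case\<close>

lemma unit_lattice_real: "(unit_lattice :: real set) = \<int>"
  by (simp add: unit_lattice_def)

lemma unit_lattice_complex: "unit_lattice = gaussian_integers"
  by (simp add: unit_lattice_def gaussian_integers_def Basis_complex_def)

lemma hermitian_double_complex: "hermitian_double (\<lambda>x. x) cnj Complex Re Im"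
proof
  show "continuous_on UNIV (\<lambda>(a, b). Complex a b)"
    unfolding case_prod_unfold complex_eq by (intro continuous_intros)
qed (auto simp: complex_eq_iff power2_eq_square intro!: continuous_intros)

lemma bounded_linear_quat_coordinates:
  "bounded_linear qRe" "bounded_linear qI" "bounded_linear qJ" "bounded_linear qK"
proof -
  have norm: "norm x = sqrt ((qRe x)\<^sup>2 + (qI x)\<^sup>2 + (qJ x)\<^sup>2 + (qK x)\<^sup>2)" for x
    by (simp add: norm_quat_def inner_quat_def power2_eq_square)
  have "\<bar>qRe x\<bar> \<le> norm x" "\<bar>qI x\<bar> \<le> norm x" "\<bar>qJ x\<bar> \<le> norm x" "\<bar>qK x\<bar> \<le> norm x" for x
    unfolding norm by (rule real_le_rsqrt; simp)+
  then show "bounded_linear qRe" "bounded_linear qI" "bounded_linear qJ" "bounded_linear qK"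
    by (auto intro!: bounded_linear_intro[where K = 1])
qed

lemma quat_expansion:
  "Quat a b c d = a *\<^sub>R 1 + b *\<^sub>R Quat 0 1 0 0 + c *\<^sub>R Quat 0 0 1 0 + d *\<^sub>R Quat 0 0 0 1"
  by (simp add: quat_eq_iff)

text \<open>A quaternion is \<open>a + b j\<close> with complex \<open>a\<close> and \<open>b\<close>.\<close>

lemma hermitian_double_quat:
  "hermitian_double cnj qcnj (\<lambda>a b. Quat (Re a) (Im a) (Re b) (Im b))
    (\<lambda>x. Complex (qRe x) (qI x)) (\<lambda>x. Complex (qJ x) (qK x))"
proof
  note cont = bounded_linear_quat_coordinates[THEN bounded_linear.continuous_on[OF _ continuous_on_id]]
  show "continuous_on UNIV (\<lambda>x. Complex (qRe x) (qI x))" "continuous_on UNIV (\<lambda>x. Complex (qJ x) (qK x))"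
    unfolding complex_eq by (intro continuous_intros cont)+
  show "continuous_on UNIV (\<lambda>(a, b). Quat (Re a) (Im a) (Re b) (Im b))"
    unfolding case_prod_unfold by (subst quat_expansion) (intro continuous_intros)
  show "x * cnj x = of_real ((norm x)\<^sup>2)" for x
    by (rule complex_norm_square[symmetric])
qed (auto simp: complex_eq_iff quat_eq_iff algebra_simps intro!: continuous_intros)

theorem theorem4:
  assumes "CARD('k::finite) \<ge> 2"
  shows
    "(let X = (Hom_heisenberg \<int> :: (int ^ 'k \<Rightarrow> (real, 'n::finite) block_matrix set) topology)
      in (\<forall>C\<in>pi0 X. \<forall>\<rho>\<in>C. ordered_commutators \<rho> \<in> Ant \<int> \<and>
                          pi0_commutators C = ordered_commutators \<rho>)
       \<and> inj_on pi0_commutators (pi0 X)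
       \<and> (pi0_commutators ` pi0 X = Ant \<int> \<longleftrightarrow> CARD('k) div 2 \<le> CARD('n))
       \<and> (\<forall>\<beta>\<in>Ant \<int>. \<forall>C\<in>pi0 X. pi0_commutators C = \<beta> \<longrightarrow>
            (\<exists>r. 2 * r = rank_adjoint \<beta> \<and>
              subtopology X C homotopy_equivalent_space
                prod_topology (stiefel cnj r :: (nat \<Rightarrow> complex ^ 'n) topology)
                  (torus (CARD('k) * DIM(real))))))
   \<and> (let X = (Hom_heisenberg gaussian_integers
                 :: (int ^ 'k \<Rightarrow> (complex, 'n) block_matrix set) topology)
      in (\<forall>C\<in>pi0 X. \<forall>\<rho>\<in>C. ordered_commutators \<rho> \<in> Ant gaussian_integers \<and>
                          pi0_commutators C = ordered_commutators \<rho>)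
       \<and> inj_on pi0_commutators (pi0 X)
       \<and> (pi0_commutators ` pi0 X = Ant gaussian_integers \<longleftrightarrow> CARD('k) div 2 \<le> CARD('n))
       \<and> (\<forall>\<beta>\<in>Ant gaussian_integers. \<forall>C\<in>pi0 X. pi0_commutators C = \<beta> \<longrightarrow>
            (\<exists>r. 2 * r = rank_adjoint \<beta> \<and>
              subtopology X C homotopy_equivalent_space
                prod_topology (stiefel qcnj r :: (nat \<Rightarrow> quat ^ 'n) topology)
                  (torus (CARD('k) * DIM(complex))))))"
proof -
  have "1 \<in> (unit_lattice :: real set)" "1 \<in> (unit_lattice :: complex set)"
    by (simp_all add: unit_lattice_real unit_lattice_complex gaussian_integers_def)
  then show ?thesis
    using pi0_Hom_heisenberg[OF hermitian_double_complex, where 'k = 'k and 'n = 'n]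
      pi0_Hom_heisenberg[OF hermitian_double_quat, where 'k = 'k and 'n = 'n]
    unfolding unit_lattice_real unit_lattice_complex by (intro conjI)
qed

end
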